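(* Let $A$ be a unital C*-algebra and $B\subseteq A$ a masa. Assume that $B$ has totally disconnected spectrum, and that for every non-zero projection $e\in B$ there exists an isometry $s\in A$ such that $sBs^*\subseteq eBe$. Let $p$ be a prime number and $\alpha:\mathbb{Z}_p\curvearrowright A$ an action. Then the following are equivalent: (i) $B\subseteq A\rtimes_\alpha\mathbb{Z}_p$ is not a masa. (ii) $\alpha$ is exterior equivalent to a $\mathbb{Z}_p$-action on $A$ fixing $B$ pointwise. Moreover, if $B\subseteq A$ is regular and satisfies the equivalent conditions (i) and (ii), then $B$ is also regular as a sub-C*-algebra of $A\rtimes_\alpha\mathbb{Z}_p$.
   Context: $\mathbb{Z}_p=\mathbb{Z}/p\mathbb{Z}$. A masa is a maximal abelian sub-C*-algebra. $A$ is viewed as a sub-C*-algebra of $A\rtimes_\alpha\mathbb{Z}_p$. Regular: a sub-C*-algebra $B$ of a C*-algebra $A$ is regular if $N_A(B)=\{n\in A : nBn^*\subseteq B \text{ and } n^*Bn\subseteq B\}$ generates $A$ as a C*-algebra. Exterior equivalence: for a discrete group action $\alpha:\Gamma\curvearrowright A$, an $\alpha$-cocycle is a map $u:\Gamma\to\mathcal{U}(\mathcal{M}(A))$ (unitaries of the multiplier algebra, which is $A$ itself if $A$ is unital) with $u_{\gamma\gamma'}=u_\gamma\alpha_\gamma(u_{\gamma'})$ for all $\gamma,\gamma'\in\Gamma$. The perturbed action is $\alpha^u_\gamma=\mathrm{Ad}(u_\gamma)\circ\alpha_\gamma$. Two actions $\alpha,\beta$ of $\Gamma$ on $A$ are exterior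 equivalent if $\beta=\alpha^u$ for some $\alpha$-cocycle $u$. *)

theory Defs
  imports "HOL-Analysis.Analysis" "HOL-Algebra.Ring" "HOL-Algebra.Elementary_Groups"
    "HOL-Computational_Algebra.Primes"
begin

section \<open>Unital C*-algebras\<close>

text \<open>
  The norm is the one of \<^class>\<open>real_normed_algebra_1\<close>, so \<open>norm 1 = 1\<close>: the zero algebra is
  not a unital C*-algebra.
\<close>

class unital_cstar_algebra = real_normed_algebra_1 + complete_space +
  fixes scaleC :: "complex \<Rightarrow> 'a \<Rightarrow> 'a"
    and star :: "'a \<Rightarrow> 'a"
  assumes scaleC_add_right: "scaleC c (x + y) = scaleC c x + scaleC c y"
    and scaleC_add_left: "scaleC (c + d) x = scaleC c x + scaleC d x"
    and scaleC_scaleC: "scaleC c (scaleC d x) = scaleC (c * d) x"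
    and scaleC_of_real: "scaleC (complex_of_real r) x = r *\<^sub>R x"
    and mult_scaleC_left: "scaleC c x * y = scaleC c (x * y)"
    and mult_scaleC_right: "x * scaleC c y = scaleC c (x * y)"
    and norm_scaleC: "norm (scaleC c x) = cmod c * norm x"
    and star_add: "star (x + y) = star x + star y"
    and star_scaleC: "star (scaleC c x) = scaleC (cnj c) (star x)"
    and star_mult: "star (x * y) = star y * star x"
    and star_star: "star (star x) = x"
    and norm_star_mult_self: "norm (star x * x) = (norm x)\<^sup>2"

definition projection :: "'a::unital_cstar_algebra \<Rightarrow> bool" where
  "projection e \<longleftrightarrow> star e = e \<and> e * e = e"

definition isometry :: "'a::unital_cstar_algebra \<Rightarrow> bool" where
  "isometry s \<longleftrightarrow> star s * s = 1"

definition unitary :: "'a::unital_cstar_algebra \<Rightarrow> bool" where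
  "unitary u \<longleftrightarrow> star u * u = 1 \<and> u * star u = 1"


section \<open>Sub-C*-algebras, masas and regularity\<close>

text \<open>
  A crossed product depends on the action, hence is not a type.  The notions that are needed both
  for the algebra and for its crossed product are therefore stated for the following records of
  C*-algebra operations, of which both are examples.
\<close>

record 'a cstar_struct = "'a ring" +
  cscale :: "complex \<Rightarrow> 'a \<Rightarrow> 'a"
  cstar :: "'a \<Rightarrow> 'a"
  cnorm :: "'a \<Rightarrow> real"

definition type_cstar :: "'a::unital_cstar_algebra cstar_struct" where
  "type_cstar = \<lparr>carrier = UNIV, monoid.mult = (*), one = 1, ring.zero = 0, add = (+),
     cscale = scaleC, cstar = star, cnorm = norm\<rparr>"

text \<open>Sub-C*-algebras are not required to contain the unit.\<close>

definition sub_cstar_algebra :: "'a cstar_struct \<Rightarrow> 'a set \<Rightarrow> bool" where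
  "sub_cstar_algebra C D \<longleftrightarrow>
     D \<subseteq> carrier C \<and> \<zero>\<^bsub>C\<^esub> \<in> D \<and>
     (\<forall>x\<in>D. \<forall>y\<in>D. x \<oplus>\<^bsub>C\<^esub> y \<in> D \<and> x \<otimes>\<^bsub>C\<^esub> y \<in> D) \<and>
     (\<forall>x\<in>D. (\<forall>c. cscale C c x \<in> D) \<and> cstar C x \<in> D) \<and>
     (\<forall>f l. (\<forall>n::nat. f n \<in> D) \<and> l \<in> carrier C \<and>
        (\<lambda>n. cnorm C (f n \<ominus>\<^bsub>C\<^esub> l)) \<longlonglongrightarrow> 0 \<longrightarrow> l \<in> D)"

definition abelian_subset :: "'a cstar_struct \<Rightarrow> 'a set \<Rightarrow> bool" where
  "abelian_subset C D \<longleftrightarrow> (\<forall>x\<in>D. \<forall>y\<in>D. x \<otimes>\<^bsub>C\<^esub> y = y \<otimes>\<^bsub>C\<^esub> x)"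

definition masa :: "'a cstar_struct \<Rightarrow> 'a set \<Rightarrow> bool" where
  "masa C B \<longleftrightarrow> sub_cstar_algebra C B \<and> abelian_subset C B \<and>
     (\<forall>D. sub_cstar_algebra C D \<and> abelian_subset C D \<and> B \<subseteq> D \<longrightarrow> D = B)"

definition generated_cstar_algebra :: "'a cstar_struct \<Rightarrow> 'a set \<Rightarrow> 'a set" where
  "generated_cstar_algebra C X = \<Inter>{D. sub_cstar_algebra C D \<and> X \<subseteq> D}"

definition normalizers :: "'a cstar_struct \<Rightarrow> 'a set \<Rightarrow> 'a set" where
  "normalizers C B = {n \<in> carrier C.
     (\<forall>b\<in>B. n \<otimes>\<^bsub>C\<^esub> b \<otimes>\<^bsub>C\<^esub> cstar C n \<in> B) \<and> (\<forall>b\<in>B. cstar C n \<otimes>\<^bsub>C\<^esub> b \<otimes>\<^bsub>C\<^esub> n \<in> B)}"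

definition regular :: "'a cstar_struct \<Rightarrow> 'a set \<Rightarrow> bool" where
  "regular C B \<longleftrightarrow> sub_cstar_algebra C B \<and>
     generated_cstar_algebra C (normalizers C B) = carrier C"


section \<open>The spectrum of a commutative sub-C*-algebra\<close>

text \<open>
  Characters are functions on \<open>B\<close>, represented with value \<^const>\<open>undefined\<close> off \<open>B\<close>; the
  weak*-topology is the topology of pointwise convergence on \<open>B\<close>.
\<close>

definition characters :: "'a cstar_struct \<Rightarrow> 'a set \<Rightarrow> ('a \<Rightarrow> complex) set" where
  "characters C B = {\<omega> \<in> extensional B.
     (\<forall>x\<in>B. \<forall>y\<in>B. \<omega> (x \<oplus>\<^bsub>C\<^esub> y) = \<omega> x + \<omega> y \<and> \<omega> (x \<otimes>\<^bsub>C\<^esub> y) = \<omega> x * \<omega> y) \<and>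
     (\<forall>c. \<forall>x\<in>B. \<omega> (cscale C c x) = c * \<omega> x) \<and>
     (\<exists>x\<in>B. \<omega> x \<noteq> 0)}"

definition spectrum_topology :: "'a cstar_struct \<Rightarrow> 'a set \<Rightarrow> ('a \<Rightarrow> complex) topology" where
  "spectrum_topology C B = subtopology (product_topology (\<lambda>_. euclidean) B) (characters C B)"

definition totally_disconnected_space :: "'a topology \<Rightarrow> bool" where
  "totally_disconnected_space X \<longleftrightarrow>
     (\<forall>S. connectedin X S \<longrightarrow> (\<forall>x\<in>S. \<forall>y\<in>S. x = y))"


section \<open>Actions and exterior equivalence\<close>

definition star_automorphism :: "('a::unital_cstar_algebra \<Rightarrow> 'a) \<Rightarrow> bool" where
  "star_automorphism \<phi> \<longleftrightarrow> bij \<phi> \<and>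
     (\<forall>x y. \<phi> (x + y) = \<phi> x + \<phi> y) \<and> (\<forall>x y. \<phi> (x * y) = \<phi> x * \<phi> y) \<and>
     (\<forall>c x. \<phi> (scaleC c x) = scaleC c (\<phi> x)) \<and> (\<forall>x. \<phi> (star x) = star (\<phi> x))"

definition cstar_action ::
    "('g, 'm) monoid_scheme \<Rightarrow> ('g \<Rightarrow> 'a::unital_cstar_algebra \<Rightarrow> 'a) \<Rightarrow> bool" where
  "cstar_action G \<alpha> \<longleftrightarrow>
     (\<forall>g\<in>carrier G. star_automorphism (\<alpha> g)) \<and>
     (\<forall>g\<in>carrier G. \<forall>h\<in>carrier G. \<alpha> (g \<otimes>\<^bsub>G\<^esub> h) = \<alpha> g \<circ> \<alpha> h)"

definition action_cocycle ::
    "('g, 'm) monoid_scheme \<Rightarrow> ('g \<Rightarrow> 'a::unital_cstar_algebra \<Rightarrow> 'a) \<Rightarrow> ('g \<Rightarrow> 'a) \<Rightarrow> bool" where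
  "action_cocycle G \<alpha> u \<longleftrightarrow>
     (\<forall>g\<in>carrier G. unitary (u g)) \<and>
     (\<forall>g\<in>carrier G. \<forall>h\<in>carrier G. u (g \<otimes>\<^bsub>G\<^esub> h) = u g * \<alpha> g (u h))"

definition perturbed_action ::
    "('g \<Rightarrow> 'a::unital_cstar_algebra \<Rightarrow> 'a) \<Rightarrow> ('g \<Rightarrow> 'a) \<Rightarrow> 'g \<Rightarrow> 'a \<Rightarrow> 'a" where
  "perturbed_action \<alpha> u g x = u g * \<alpha> g x * star (u g)"

definition exterior_equivalent ::
    "('g, 'm) monoid_scheme \<Rightarrow> ('g \<Rightarrow> 'a::unital_cstar_algebra \<Rightarrow> 'a) \<Rightarrow> ('g \<Rightarrow> 'a \<Rightarrow> 'a) \<Rightarrow> bool" where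
  "exterior_equivalent G \<alpha> \<beta> \<longleftrightarrow>
     (\<exists>u. action_cocycle G \<alpha> u \<and> (\<forall>g\<in>carrier G. \<beta> g = perturbed_action \<alpha> u g))"


section \<open>Crossed products by finite groups\<close>

text \<open>
  For a finite group \<open>G\<close> the twisted convolution algebra of all functions \<open>G \<rightarrow> A\<close> is complete in
  its C*-norm, so it is the crossed product.  A function \<open>f\<close> (zero outside of \<open>G\<close>) stands for the
  element \<open>\<Sum>g. f g u\<^sub>g\<close>, where \<open>u\<^sub>g\<close> is the canonical unitary with \<open>u\<^sub>g a u\<^sub>g* = \<alpha>\<^sub>g(a)\<close>.  The norm is
  the operator norm of the regular representation
  \<open>(a \<xi>)(g) = \<alpha>\<^bsub>g\<^sup>-\<^sup>1\<^esub>(a) \<xi>(g)\<close>, \<open>(u\<^sub>h \<xi>)(g) = \<xi>(h\<^sup>-\<^sup>1 g)\<close>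
  on the right Hilbert \<open>A\<close>-module \<open>\<ell>\<^sup>2(G, A)\<close>.  As \<open>G\<close> is amenable, the full and the reduced crossed
  product agree.
\<close>

definition hilbert_module_norm ::
    "('g, 'm) monoid_scheme \<Rightarrow> ('g \<Rightarrow> 'a::unital_cstar_algebra) \<Rightarrow> real" where
  "hilbert_module_norm G \<xi> = sqrt (norm (\<Sum>g\<in>carrier G. star (\<xi> g) * \<xi> g))"

definition regular_rep ::
    "('g, 'm) monoid_scheme \<Rightarrow> ('g \<Rightarrow> 'a::unital_cstar_algebra \<Rightarrow> 'a) \<Rightarrow>
     ('g \<Rightarrow> 'a) \<Rightarrow> ('g \<Rightarrow> 'a) \<Rightarrow> ('g \<Rightarrow> 'a)" where
  "regular_rep G \<alpha> f \<xi> =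
     (\<lambda>g. \<Sum>h\<in>carrier G. \<alpha> (inv\<^bsub>G\<^esub> g) (f h) * \<xi> (inv\<^bsub>G\<^esub> h \<otimes>\<^bsub>G\<^esub> g))"

definition crossed_product ::
    "('g, 'm) monoid_scheme \<Rightarrow> ('g \<Rightarrow> 'a::unital_cstar_algebra \<Rightarrow> 'a) \<Rightarrow> ('g \<Rightarrow> 'a) cstar_struct" where
  "crossed_product G \<alpha> =
     \<lparr>carrier = {f. \<forall>g. g \<notin> carrier G \<longrightarrow> f g = 0},
      monoid.mult = (\<lambda>f f' g. if g \<in> carrier G
         then \<Sum>h\<in>carrier G. f h * \<alpha> h (f' (inv\<^bsub>G\<^esub> h \<otimes>\<^bsub>G\<^esub> g)) else 0),
      one = (\<lambda>g. if g = \<one>\<^bsub>G\<^esub> then 1 else 0),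
      ring.zero = (\<lambda>_. 0),
      add = (\<lambda>f f' g. f g + f' g),
      cscale = (\<lambda>c f g. scaleC c (f g)),
      cstar = (\<lambda>f g. if g \<in> carrier G then \<alpha> g (star (f (inv\<^bsub>G\<^esub> g))) else 0),
      cnorm = (\<lambda>f. Sup {hilbert_module_norm G (regular_rep G \<alpha> f \<xi>) | \<xi>.
         hilbert_module_norm G \<xi> \<le> 1})\<rparr>"

definition crossed_product_embed ::
    "('g, 'm) monoid_scheme \<Rightarrow> 'a::unital_cstar_algebra \<Rightarrow> 'g \<Rightarrow> 'a" where
  "crossed_product_embed G a = (\<lambda>g. if g = \<one>\<^bsub>G\<^esub> then a else 0)"

end

(*
  If B is not maximal abelian in the crossed product, an element commuting with B has a non-zero
  coefficient a at some g different from 0, and then b a = a \<alpha>_g(b) for all b in B.  So a a* lies in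
  B' = B, and cutting down by a projection of B (total disconnectedness) makes a multiple v = k a a
  partial isometry with v v* = e in B and v* v = \<alpha>_g(e).  An isometry s with s B s* contained in e B e
  turns it into the unitary u = s* v \<alpha>_g(s), and b u = u \<alpha>_g(b) still holds; passing to a power, g
  becomes 1.  The product u \<alpha>(u) ... \<alpha>^(p-1)(u) is then a unitary of B, and multiplying u by a
  p-th root of its inverse, which exists in B by total disconnectedness, gives a cocycle.  Conversely,
  a cocycle u such that Ad(u_g) \<alpha>_g fixes B provides unitaries u_g U_g of the crossed product that
  commute with B and together with A generate everything.

  Characters of a commutative C*-algebra come from minimal power-multiplicative seminorms, which are
  multiplicative and hence the absolute value of a character by an elementary Gelfand-Mazur argument;
  positivity of x* x is the Kelley-Vaught argument.
*)

theory Submission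
  imports Defs
begin

text \<open>The isometry is there because \<open>v\<close> only compares \<open>e\<close> with
  \<alpha>_g(e), and such a partial isometry need not extend to a unitary; \<open>s\<close>
  compresses the unit below \<open>e\<close> while keeping B inside B, so that
  \<open>s * b * star s\<close> can still be moved past \<open>v\<close>. Since p is prime, every
  nonzero g generates the group, hence the passage to a power. The p-fold product lies in B because
  it intertwines the identity with \<alpha>_1^p = id, so it commutes with B. Correcting u by z in B
  works because b u = u \<alpha>(b) lets z pass through u: the n-fold product of z u is z^n times
  that of u. The obstruction to a p-th root is the winding of a circle-valued function, which
  disappears once the spectrum is cut into suitable clopen pieces. Positivity of x* x is used twice:
  a a* must be nonnegative on the spectrum before its inverse square root is taken on a clopen set,
  and in the Hilbert module every coordinate of a vector must be bounded by its norm. The second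
  makes the norm of the crossed product comparable with the norms of the coefficients, so that
  limits there can be checked coefficient by coefficient.\<close>

instance unital_cstar_algebra \<subseteq> banach ..

text \<open>Characters are points of a function type with the product topology. The three instances
  make that type Hausdorff: two functions are separated at a coordinate where they differ.\<close>

instance "fun" :: (type, t0_space) t0_space
proof
  fix f g :: "'a \<Rightarrow> 'b"
  assume "f \<noteq> g"
  then obtain x where x: "f x \<noteq> g x" by auto
  then obtain U where U: "open U" "\<not> (f x \<in> U \<longleftrightarrow> g x \<in> U)"
    using t0_space_class.t0_space[OF x] by blast
  have "open {h::'a \<Rightarrow> 'b. h x \<in> U}"
    using product_topology_basis'[of "{x}" "\<lambda>_. U" "\<lambda>x. x"] U by simp
  then show "\<exists>U. open U \<and> \<not> (f \<in> U \<longleftrightarrow> g \<in> U)"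
    using U by (intro exI[of _ "{h. h x \<in> U}"]) auto
qed

instance "fun" :: (type, t1_space) t1_space
proof
  fix f g :: "'a \<Rightarrow> 'b"
  assume "f \<noteq> g"
  then obtain x where x: "f x \<noteq> g x" by auto
  then obtain U where U: "open U" "f x \<in> U" "g x \<notin> U"
    using t1_space_class.t1_space[OF x] by blast
  have "open {h::'a \<Rightarrow> 'b. h x \<in> U}"
    using product_topology_basis'[of "{x}" "\<lambda>_. U" "\<lambda>x. x"] U by simp
  then show "\<exists>U. open U \<and> f \<in> U \<and> g \<notin> U"
    using U by (intro exI[of _ "{h. h x \<in> U}"]) auto
qed

instance "fun" :: (type, t2_space) t2_space
proof
  fix f g :: "'a \<Rightarrow> 'b"
  assume "f \<noteq> g"
  then obtain x where x: "f x \<noteq> g x" by auto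
  then obtain U V where UV: "open U" "open V" "f x \<in> U" "g x \<in> V" "U \<inter> V = {}"
    using hausdorff[OF x] by blast
  have "open {h::'a \<Rightarrow> 'b. h x \<in> W}" if "open W" for W
    using product_topology_basis'[of "{x}" "\<lambda>_. W" "\<lambda>x. x"] that by simp
  then show "\<exists>U V. open U \<and> open V \<and> f \<in> U \<and> g \<in> V \<and> U \<inter> V = {}"
    using UV by (intro exI[of _ "{h. h x \<in> U}"] exI[of _ "{h. h x \<in> V}"]) auto
qed

section \<open>Involution and scalars\<close>

lemma scaleC_zero_left [simp]: "scaleC 0 (x::'a::unital_cstar_algebra) = 0"
  using scaleC_of_real[of 0 x] by simp

lemma scaleC_one [simp]: "scaleC 1 (x::'a::unital_cstar_algebra) = x"
  using scaleC_of_real[of 1 x] by simp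

lemma scaleC_minus_one: "scaleC (-1) (x::'a::unital_cstar_algebra) = - x"
  using scaleC_of_real[of "-1" x] by simp

lemma star_zero [simp]: "star (0::'a::unital_cstar_algebra) = 0"
  using star_scaleC[of 0 "0::'a"] by simp

lemma star_minus: "star (- x) = - star (x::'a::unital_cstar_algebra)"
  using star_scaleC[of "-1" x] by (simp add: scaleC_minus_one)

lemma star_diff: "star (x - y) = star x - star (y::'a::unital_cstar_algebra)"
  using star_add[of x "- y"] by (simp add: star_minus)

lemma star_one [simp]: "star (1::'a::unital_cstar_algebra) = 1"
  by (metis mult_1 star_mult star_star)

text \<open>The C*-identity gives \<open>(norm y)^2 \<le> norm (star y) * norm y\<close>;
  cancelling, and using the result for \<open>star x\<close> as well, yields both
  inequalities.\<close>

lemma norm_star [simp]: "norm (star (x::'a::unital_cstar_algebra)) = norm x"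
proof -
  have le: "norm y \<le> norm (star y)" for y :: 'a
  proof (cases "norm y = 0")
    case False
    have "(norm y)\<^sup>2 \<le> norm (star y) * norm y"
      using norm_mult_ineq[of "star y" y] by (simp add: norm_star_mult_self)
    then show ?thesis using False by (simp add: power2_eq_square)
  qed simp
  show ?thesis using le[of x] le[of "star x"] by (simp add: star_star)
qed

lemma norm_mult_star_self: "norm (x * star x) = (norm (x::'a::unital_cstar_algebra))\<^sup>2"
  using norm_star_mult_self[of "star x"] by (simp add: star_star)

text \<open>Scalars become elements of the algebra, so that \<open>x - cconst c\<close> expresses
  the shift by a spectral parameter and \<open>scaleC\<close> is an ordinary product.\<close>

definition cconst :: "complex \<Rightarrow> 'a::unital_cstar_algebra" where
  "cconst c = scaleC c 1"

lemma scaleC_cconst: "scaleC c x = cconst c * x"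
  by (simp add: cconst_def mult_scaleC_left)

lemma cconst_commute: "x * cconst c = cconst c * x"
  by (simp add: cconst_def mult_scaleC_left mult_scaleC_right)

lemma cconst_0 [simp]: "cconst 0 = 0" and cconst_1 [simp]: "cconst 1 = 1"
  by (simp_all add: cconst_def)

lemma cconst_add: "cconst (c + d) = cconst c + cconst d"
  by (simp add: cconst_def scaleC_add_left)

lemma cconst_minus: "cconst (- c) = - cconst c"
  using cconst_add[of c "- c"] by (simp add: eq_neg_iff_add_eq_0 add.commute)

lemma cconst_diff: "cconst (c - d) = cconst c - cconst d"
  using cconst_add[of c "- d"] by (simp add: cconst_minus)

lemma cconst_mult: "cconst (c * d) = cconst c * cconst d"
  by (simp add: cconst_def mult_scaleC_left scaleC_scaleC)

lemma norm_cconst [simp]: "norm (cconst c) = cmod c"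
  by (simp add: cconst_def norm_scaleC)

lemma star_cconst: "star (cconst c) = cconst (cnj c)"
  by (simp add: cconst_def star_scaleC)

lemma cconst_of_real: "cconst (complex_of_real r) = of_real r"
  by (simp add: cconst_def scaleC_of_real) (simp add: of_real_def)

section \<open>Characters of commutative C*-algebras\<close>

text \<open>The unit of the whole algebra is required to lie in \<open>D\<close>. Both the masa and
  the bicommutants of commuting star-closed sets are instances.\<close>

locale commutative_cstar =
  fixes D :: "'a::unital_cstar_algebra set"
  assumes one_mem: "1 \<in> D"
    and add_mem: "x \<in> D \<Longrightarrow> y \<in> D \<Longrightarrow> x + y \<in> D"
    and mult_mem: "x \<in> D \<Longrightarrow> y \<in> D \<Longrightarrow> x * y \<in> D"
    and scaleC_mem: "x \<in> D \<Longrightarrow> scaleC c x \<in> D"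
    and star_mem: "x \<in> D \<Longrightarrow> star x \<in> D"
    and closed_mem: "closed D"
    and comm: "x \<in> D \<Longrightarrow> y \<in> D \<Longrightarrow> x * y = y * x"
begin

lemma cconst_mem: "cconst c \<in> D"
  by (simp add: cconst_def one_mem scaleC_mem)

lemma zero_mem: "0 \<in> D"
  using cconst_mem[of 0] by simp

lemma minus_mem: "x \<in> D \<Longrightarrow> - x \<in> D"
  using scaleC_mem[of x "-1"] by (simp add: scaleC_minus_one)

lemma diff_mem: "x \<in> D \<Longrightarrow> y \<in> D \<Longrightarrow> x - y \<in> D"
  using add_mem[of x "- y"] by (simp add: minus_mem)

lemma of_real_mem: "of_real r \<in> D"
  using cconst_mem[of "complex_of_real r"] by (simp add: cconst_of_real)

lemma power_mem: "x \<in> D \<Longrightarrow> x ^ n \<in> D"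
  by (induction n) (auto simp: one_mem mult_mem)

lemmas mem = one_mem add_mem mult_mem scaleC_mem star_mem cconst_mem zero_mem minus_mem diff_mem
  power_mem

text \<open>By commutativity \<open>star (x * x) * (x * x)\<close> equals \<open>star h * h\<close>
  for \<open>h = star x * x\<close>, and the C*-identity evaluates both. This makes the norm itself
  a power-multiplicative seminorm, the starting point for constructing characters.\<close>

lemma norm_square:
  assumes "x \<in> D"
  shows "norm (x * x) = (norm x)\<^sup>2"
proof -
  have "(norm (x * x))\<^sup>2 = norm (star (x * x) * (x * x))"
    by (simp add: norm_star_mult_self)
  also have "star (x * x) * (x * x) = star (star x * x) * (star x * x)"
    using comm[OF assms star_mem[OF assms]] by (simp add: star_mult star_star mult.assoc) (metis mult.assoc)
  also have "norm \<dots> = ((norm x)\<^sup>2)\<^sup>2"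
    by (simp only: norm_star_mult_self)
  finally show ?thesis by (rule power2_eq_imp_eq) auto
qed

end

section \<open>Power-multiplicative seminorms\<close>

locale power_mult_seminorm = commutative_cstar D
  for D :: "'a::unital_cstar_algebra set" +
  fixes p :: "'a \<Rightarrow> real"
  assumes outside: "x \<notin> D \<Longrightarrow> p x = 0"
    and nonneg: "x \<in> D \<Longrightarrow> 0 \<le> p x"
    and le_norm: "x \<in> D \<Longrightarrow> p x \<le> norm x"
    and subadd: "x \<in> D \<Longrightarrow> y \<in> D \<Longrightarrow> p (x + y) \<le> p x + p y"
    and submult: "x \<in> D \<Longrightarrow> y \<in> D \<Longrightarrow> p (x * y) \<le> p x * p y"
    and square: "x \<in> D \<Longrightarrow> p (x * x) = (p x)\<^sup>2"
    and at_one: "p 1 = 1"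
begin

lemma power_le: "x \<in> D \<Longrightarrow> p (x ^ n) \<le> p x ^ n"
proof (induction n)
  case (Suc n)
  have "p (x ^ Suc n) \<le> p x * p (x ^ n)"
    using submult[of x "x ^ n"] Suc by (simp add: mem)
  also have "\<dots> \<le> p x * p x ^ n"
    using Suc nonneg by (intro mult_left_mono) auto
  finally show ?case by simp
qed (simp add: at_one)

lemma power_two_power: "x \<in> D \<Longrightarrow> p (x ^ (2 ^ k)) = p x ^ (2 ^ k)"
proof (induction k)
  case (Suc k)
  have "x ^ (2 ^ Suc k) = x ^ (2 ^ k) * x ^ (2 ^ k)"
    by (simp add: mult_2 power_add)
  then show ?case
    using Suc square[of "x ^ (2 ^ k)"] by (simp add: mem power_mult [symmetric] mult.commute)
qed simp

text \<open>Repeated squaring gives the exponents \<open>2 ^ k\<close>. For any other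
  \<open>n\<close>, the factorisation of \<open>x ^ (2 ^ n)\<close> into \<open>x ^ n\<close> and
  \<open>x ^ (2 ^ n - n)\<close> leaves submultiplicativity no slack when
  \<open>p x > 0\<close>.\<close>

lemma power_eq:
  assumes x: "x \<in> D"
  shows "p (x ^ n) = p x ^ n"
proof (cases "p x = 0")
  case True
  show ?thesis
  proof (cases n)
    case (Suc m)
    then show ?thesis
      using power_le[OF x, of n] nonneg[of "x ^ n"] x True by (auto simp: mem simp del: power_Suc)
  qed (simp add: at_one)
next
  case False
  then have pos: "p x > 0" using nonneg[OF x] by simp
  have n: "n + (2 ^ n - n) = (2 ^ n :: nat)"
    using less_exp[of n] by simp
  have "p x ^ n * p x ^ (2 ^ n - n) = p (x ^ (2 ^ n))"
    using power_two_power[OF x, of n] n by (simp add: power_add [symmetric])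
  also have "\<dots> = p (x ^ n * x ^ (2 ^ n - n))"
    using n by (simp add: power_add [symmetric])
  also have "\<dots> \<le> p (x ^ n) * p (x ^ (2 ^ n - n))"
    using x by (intro submult) (auto simp: mem)
  also have "\<dots> \<le> p (x ^ n) * p x ^ (2 ^ n - n)"
    using x by (intro mult_left_mono power_le nonneg) (auto simp: mem)
  finally have "p x ^ n \<le> p (x ^ n)" using pos by simp
  then show ?thesis using power_le[OF x, of n] by simp
qed

text \<open>The upper bound comes from the norm; the same bound for the inverse scalar, together
  with \<open>p 1 = 1\<close>, gives the lower one.\<close>

lemma at_cconst: "p (cconst c) = cmod c"
proof (cases "c = 0")
  case True
  then show ?thesis using le_norm[OF zero_mem] nonneg[OF zero_mem] by simp
next
  case False
  have "1 = p (cconst c * cconst (inverse c))"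
    using False by (simp add: cconst_mult [symmetric] at_one)
  also have "\<dots> \<le> p (cconst c) * p (cconst (inverse c))"
    by (intro submult) (auto simp: mem)
  also have "\<dots> \<le> p (cconst c) * inverse (cmod c)"
    using le_norm[OF cconst_mem, of "inverse c"] nonneg[OF cconst_mem]
    by (intro mult_left_mono) (auto simp: norm_inverse)
  finally have "cmod c \<le> p (cconst c)" using False by (simp add: field_simps)
  then show ?thesis using le_norm[OF cconst_mem, of c] by simp
qed

lemma minus_eq: "x \<in> D \<Longrightarrow> p (- x) = p x"
proof -
  have le: "p (- y) \<le> p y" if "y \<in> D" for y
    using submult[OF cconst_mem[of "-1"] that] at_cconst[of "-1"] by (simp add: cconst_minus)
  show "x \<in> D \<Longrightarrow> p (- x) = p x"
    using le[of x] le[of "- x"] by (auto simp: mem)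
qed

lemma diff_le: "x \<in> D \<Longrightarrow> y \<in> D \<Longrightarrow> p (x - y) \<le> p x + p y"
  using subadd[of x "- y"] by (simp add: mem minus_eq)

section \<open>Localisation of a seminorm at an element\<close>

context
  fixes y assumes y: "y \<in> D" and py: "p y > 0"
begin

text \<open>The approximants of the localisation of \<open>p\<close> at \<open>y\<close>: they
  decrease to a seminorm below \<open>p\<close> for which multiplication by \<open>y\<close> scales
  exactly by \<open>p y\<close>.\<close>

definition loc_seq :: "'a \<Rightarrow> nat \<Rightarrow> real" where
  "loc_seq x n = p (x * y ^ n) / p y ^ n"

definition loc :: "'a \<Rightarrow> real" where
  "loc x = (if x \<in> D then lim (loc_seq x) else 0)"

lemma loc_seq_nonneg: "x \<in> D \<Longrightarrow> 0 \<le> loc_seq x n"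
  using y py nonneg[of "x * y ^ n"] by (simp add: loc_seq_def mem)

lemma loc_seq_decseq:
  assumes x: "x \<in> D" shows "decseq (loc_seq x)"
proof (rule decseq_SucI)
  fix n
  have "p (x * y ^ Suc n) = p (x * y ^ n * y)"
    by (simp add: power_commutes mult.assoc)
  also have "\<dots> \<le> p (x * y ^ n) * p y"
    using x y by (intro submult) (auto simp: mem)
  finally have "p (x * y ^ Suc n) / p y ^ Suc n \<le> p (x * y ^ n) * p y / p y ^ Suc n"
    using py by (intro divide_right_mono) auto
  then show "loc_seq x (Suc n) \<le> loc_seq x n"
    using py by (simp add: loc_seq_def)
qed

lemma loc_seq_lim:
  assumes x: "x \<in> D" shows "loc_seq x \<longlonglongrightarrow> loc x"
proof -
  obtain L where "loc_seq x \<longlonglongrightarrow> L"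
    using decseq_convergent[OF loc_seq_decseq[OF x], of 0] loc_seq_nonneg[OF x] by metis
  then show ?thesis using x by (simp add: loc_def limI)
qed

lemma loc_le: "x \<in> D \<Longrightarrow> loc x \<le> p x"
  using decseq_ge[OF loc_seq_decseq loc_seq_lim, of x 0] by (simp add: loc_seq_def)

text \<open>Even indices are used for products, because \<open>y ^ (2 * n)\<close> can be shared out
  as \<open>y ^ n\<close> to each of the two factors.\<close>

lemma loc_double_lim: "x \<in> D \<Longrightarrow> (\<lambda>n. loc_seq x (2 * n)) \<longlonglongrightarrow> loc x"
  using LIMSEQ_subseq_LIMSEQ[OF loc_seq_lim, of x "\<lambda>n. 2 * n"]
  by (auto simp: strict_mono_def o_def)

lemma mult_power_double:
  assumes "x \<in> D" "x' \<in> D"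
  shows "x * x' * y ^ (2 * n) = (x * y ^ n) * (x' * y ^ n)"
proof -
  have "x' * y ^ n = y ^ n * x'" using assms y by (intro comm) (auto simp: mem)
  then show ?thesis by (simp add: mult_2 power_add mult.assoc) (metis mult.assoc)
qed

lemma loc_seminorm: "power_mult_seminorm D loc"
proof (unfold_locales)
  show "loc x = 0" if "x \<notin> D" for x using that by (simp add: loc_def)
  show "0 \<le> loc x" if "x \<in> D" for x
    using LIMSEQ_le_const[OF loc_seq_lim[OF that], of 0] loc_seq_nonneg[OF that] by auto
  show "loc x \<le> norm x" if "x \<in> D" for x
    using loc_le[OF that] le_norm[OF that] by simp
  show "loc (x + x') \<le> loc x + loc x'" if "x \<in> D" "x' \<in> D" for x x'
  proof (rule LIMSEQ_le[OF loc_seq_lim tendsto_add[OF loc_seq_lim loc_seq_lim]])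
    have "loc_seq (x + x') n \<le> loc_seq x n + loc_seq x' n" for n
      using subadd[of "x * y ^ n" "x' * y ^ n"] that y py
      by (simp add: loc_seq_def mem distrib_right add_divide_distrib [symmetric] divide_right_mono)
    then show "\<exists>N. \<forall>n\<ge>N. loc_seq (x + x') n \<le> loc_seq x n + loc_seq x' n" by blast
  qed (use that in \<open>auto simp: mem\<close>)
  show "loc (x * x') \<le> loc x * loc x'" if "x \<in> D" "x' \<in> D" for x x'
  proof (rule LIMSEQ_le[OF loc_double_lim tendsto_mult[OF loc_seq_lim loc_seq_lim]])
    have "loc_seq (x * x') (2 * n) \<le> loc_seq x n * loc_seq x' n" for n
    proof -
      have "p (x * y ^ n * (x' * y ^ n)) / p y ^ (2 * n) \<le> p (x * y ^ n) * p (x' * y ^ n) / p y ^ (2 * n)"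
        using that y py by (intro divide_right_mono submult) (auto simp: mem)
      then show ?thesis
        using that by (simp add: loc_seq_def mult_power_double) (simp add: mult_2 power_add)
    qed
    then show "\<exists>N. \<forall>n\<ge>N. loc_seq (x * x') (2 * n) \<le> loc_seq x n * loc_seq x' n" by blast
  qed (use that in \<open>auto simp: mem\<close>)
  show "loc (x * x) = (loc x)\<^sup>2" if "x \<in> D" for x
  proof (rule LIMSEQ_unique[OF loc_double_lim])
    have "loc_seq (x * x) (2 * n) = (loc_seq x n)\<^sup>2" for n
      using square[of "x * y ^ n"] that y py
      by (simp add: loc_seq_def mem mult_power_double power_divide) (simp add: power_mult [symmetric] mult.commute)
    then show "(\<lambda>n. loc_seq (x * x) (2 * n)) \<longlonglongrightarrow> (loc x)\<^sup>2"
      using tendsto_power[OF loc_seq_lim[OF that], of 2] by simp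
  qed (use that in \<open>auto simp: mem\<close>)
  \<comment> \<open>Here the exact value of \<open>p (y ^ n)\<close> matters: with mere
    submultiplicativity the limit at 1 could drop below 1.\<close>
  have "loc_seq 1 = (\<lambda>n. 1)"
    using py y by (auto simp: loc_seq_def power_eq)
  then show "loc 1 = 1"
    using loc_seq_lim[OF one_mem] by (simp add: LIMSEQ_const_iff)
qed

text \<open>Elements that already scale \<open>p\<close> exactly keep doing so after localisation.
  This preserves the condition on \<open>a\<close>, and with it \<open>p a = norm a\<close>, while
  the seminorm is made smaller.\<close>

lemma loc_mult_left: 
  assumes "z \<in> D" and z: "\<And>x. x \<in> D \<Longrightarrow> p (z * x) = c * p x" and x: "x \<in> D"
  shows "loc (z * x) = c * loc x"
proof (rule LIMSEQ_unique[OF loc_seq_lim])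
  have "loc_seq (z * x) = (\<lambda>n. c * loc_seq x n)"
    using z[of "x * y ^ _"] y x by (auto simp: loc_seq_def mem mult.assoc)
  then show "loc_seq (z * x) \<longlonglongrightarrow> c * loc x"
    using tendsto_mult_left[OF loc_seq_lim[OF x], of c] by simp
qed (use assms in \<open>auto simp: mem\<close>)

text \<open>Since \<open>y * x * y ^ n = x * y ^ Suc n\<close>, the approximants for
  \<open>y * x\<close> are those for \<open>x\<close> shifted by one index and multiplied by
  \<open>p y\<close>.\<close>

lemma loc_mult_self:
  assumes x: "x \<in> D"
  shows "loc (y * x) = p y * loc x"
proof (rule LIMSEQ_unique[OF loc_seq_lim])
  have "loc_seq (y * x) n = p y * loc_seq x (Suc n)" for n
  proof -
    have "y * x * y ^ n = x * y ^ Suc n"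
      using comm[OF y x] by (simp add: mult.assoc)
    then show ?thesis using py by (simp add: loc_seq_def)
  qed
  then have "loc_seq (y * x) = (\<lambda>n. p y * loc_seq x (Suc n))" by blast
  then show "loc_seq (y * x) \<longlonglongrightarrow> p y * loc x"
    using tendsto_mult_left[OF LIMSEQ_Suc[OF loc_seq_lim[OF x]], of "p y"] by simp
qed (use x y in \<open>auto simp: mem\<close>)

end
end

section \<open>Minimal seminorms by Zorn's lemma\<close>

context commutative_cstar
begin

lemma norm_seminorm: "power_mult_seminorm D (\<lambda>x. if x \<in> D then norm x else 0)"
  by unfold_locales (auto simp: mem norm_triangle_ineq norm_mult_ineq norm_square)

text \<open>Sums and products survive the infimum because the family is a chain: near-minimisers for
  \<open>x\<close> and for \<open>y\<close> are both dominated, at these two points, by the smaller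
  of the two seminorms.\<close>

lemma chain_Inf_seminorm:
  assumes ne: "C \<noteq> {}" and sem: "\<And>p. p \<in> C \<Longrightarrow> power_mult_seminorm D p"
    and chain: "\<And>p q. p \<in> C \<Longrightarrow> q \<in> C \<Longrightarrow> (\<forall>x. p x \<le> q x) \<or> (\<forall>x. q x \<le> p x)"
  shows "power_mult_seminorm D (\<lambda>x. INF p\<in>C. p x)"
    and "\<And>p x. p \<in> C \<Longrightarrow> (INF p\<in>C. p x) \<le> p x"
proof -
  define u where "u x = (INF p\<in>C. p x)" for x
  have nonneg: "0 \<le> p x" if "p \<in> C" for p x
    using power_mult_seminorm.nonneg[OF sem[OF that]] power_mult_seminorm.outside[OF sem[OF that]]
    by (cases "x \<in> D") auto
  have bdd: "bdd_below ((\<lambda>p. p x) ` C)" for x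
    using nonneg by (intro bdd_belowI2[of _ 0]) auto
  show u_le: "(INF p\<in>C. p x) \<le> p x" if "p \<in> C" for p x
    using that bdd by (intro cINF_lower)
  then have u_le: "u x \<le> p x" if "p \<in> C" for p x
    using that by (simp add: u_def)
  have u_nonneg: "0 \<le> u x" for x
    unfolding u_def using ne nonneg by (intro cINF_greatest) auto
  have approx: "\<exists>f. (\<forall>n. f n \<in> C) \<and> (\<lambda>n. f n x) \<longlonglongrightarrow> u x" for x
  proof -
    have "\<exists>p\<in>C. p x < u x + 1 / real (Suc n)" for n
      using cINF_less_iff[OF ne bdd, of x "u x + 1 / real (Suc n)"] by (simp add: u_def)
    then obtain f where f: "\<And>n. f n \<in> C" "\<And>n. f n x < u x + 1 / real (Suc n)" by metis
    have "(\<lambda>n. f n x) \<longlonglongrightarrow> u x"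
    proof (rule tendsto_sandwich[of "\<lambda>_. u x" _ _ "\<lambda>n. u x + 1 / real (Suc n)"])
      show "(\<lambda>n. u x + 1 / real (Suc n)) \<longlonglongrightarrow> u x"
        using tendsto_add[OF tendsto_const LIMSEQ_inverse_real_of_nat, of "u x"]
        by (simp add: inverse_eq_divide)
    qed (use f u_le in \<open>auto intro!: always_eventually less_imp_le\<close>)
    then show ?thesis using f by auto
  qed
  have min: "\<exists>r\<in>C. r x \<le> p x \<and> r y \<le> q y \<and> power_mult_seminorm D r" if "p \<in> C" "q \<in> C" for p q x y
    using chain[OF that] that sem by (meson order_refl)
  have submult: "u (x * y) \<le> u x * u y" if xy: "x \<in> D" "y \<in> D" for x y
  proof -
    obtain f g where f: "\<And>n. f n \<in> C" "(\<lambda>n. f n x) \<longlonglongrightarrow> u x"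
      and g: "\<And>n. g n \<in> C" "(\<lambda>n. g n y) \<longlonglongrightarrow> u y"
      using approx[of x] approx[of y] by auto
    have "u (x * y) \<le> f n x * g n y" for n
    proof -
      obtain r where r: "r \<in> C" "r x \<le> f n x" "r y \<le> g n y" "power_mult_seminorm D r"
        using min[OF f(1) g(1)] by blast
      have "u (x * y) \<le> r x * r y"
        using u_le[OF r(1)] power_mult_seminorm.submult[OF r(4) xy] by (rule order_trans)
      also have "\<dots> \<le> f n x * g n y"
        using r nonneg f g by (intro mult_mono) auto
      finally show ?thesis .
    qed
    then show ?thesis
      using LIMSEQ_le_const[OF tendsto_mult[OF f(2) g(2)]] by blast
  qed
  have "power_mult_seminorm D u"
  proof (unfold_locales)
    obtain p where p: "p \<in> C" using ne by blast
    show "u x = 0" if "x \<notin> D" for x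
      using u_le[OF p, of x] power_mult_seminorm.outside[OF sem[OF p] that] u_nonneg[of x] by simp
    show "u x \<le> norm x" if "x \<in> D" for x
      using u_le[OF p, of x] power_mult_seminorm.le_norm[OF sem[OF p] that] by simp
    show "u (x + y) \<le> u x + u y" if xy: "x \<in> D" "y \<in> D" for x y
    proof -
      obtain f g where f: "\<And>n. f n \<in> C" "(\<lambda>n. f n x) \<longlonglongrightarrow> u x"
        and g: "\<And>n. g n \<in> C" "(\<lambda>n. g n y) \<longlonglongrightarrow> u y"
        using approx[of x] approx[of y] by auto
      have "u (x + y) \<le> f n x + g n y" for n
      proof -
        obtain r where r: "r \<in> C" "r x \<le> f n x" "r y \<le> g n y" "power_mult_seminorm D r"
          using min[OF f(1) g(1)] by blast
        have "u (x + y) \<le> r x + r y"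
          using u_le[OF r(1)] power_mult_seminorm.subadd[OF r(4) xy] by (rule order_trans)
        then show ?thesis using r by simp
      qed
      then show ?thesis
        using LIMSEQ_le_const[OF tendsto_add[OF f(2) g(2)]] by blast
    qed
    show "u (x * x) = (u x)\<^sup>2" if "x \<in> D" for x
    proof (rule antisym)
      show "u (x * x) \<le> (u x)\<^sup>2"
        using submult[OF that that] by (simp add: power2_eq_square)
      have "(u x)\<^sup>2 \<le> p (x * x)" if "p \<in> C" for p
        using power_mult_seminorm.square[OF sem[OF that] \<open>x \<in> D\<close>] u_le[OF that] u_nonneg
        by (simp add: power_mono)
      then show "(u x)\<^sup>2 \<le> u (x * x)"
        unfolding u_def[of "x * x"] using ne by (intro cINF_greatest) auto
    qed
    have "u 1 = (INF p\<in>C. 1)"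
      unfolding u_def using sem power_mult_seminorm.at_one by (intro INF_cong) auto
    then show "u 1 = 1" using ne by simp
  qed (use u_nonneg submult in auto)
  moreover have "u = (\<lambda>x. INF p\<in>C. p x)" by (simp add: u_def fun_eq_iff)
  ultimately show "power_mult_seminorm D (\<lambda>x. INF p\<in>C. p x)" by simp
qed

text \<open>
  The condition \<open>p (a * x) = norm a * p x\<close> survives localisation and infima of chains, so that a
  minimal seminorm among those satisfying it equals all its localisations, i.e. is multiplicative.
\<close>

lemma multiplicative_seminorm_exists:
  assumes a: "a \<in> D"
  obtains p where "power_mult_seminorm D p" "p a = norm a"
    "\<And>x y. x \<in> D \<Longrightarrow> y \<in> D \<Longrightarrow> p (x * y) = p x * p y"
proof -
  define A where "A = {p. power_mult_seminorm D p \<and> (\<forall>x\<in>D. p (a * x) = norm a * p x)}"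
  \<comment> \<open>The order is reversed, so that a maximal element is a minimal seminorm. Since
    seminorms vanish off \<open>D\<close>, comparing them as functions is comparing them on
    \<open>D\<close>.\<close>
  define P where "P p q \<longleftrightarrow> (\<forall>x. q x \<le> p x)" for p q :: "'a \<Rightarrow> real"
  interpret N: power_mult_seminorm D "\<lambda>x. if x \<in> D then norm x else 0"
    by (rule norm_seminorm)
  \<comment> \<open>The norm localised at \<open>a\<close> satisfies the condition. Localising
    requires a positive norm; for \<open>a = 0\<close> both sides of the condition vanish.\<close>
  have ne: "A \<noteq> {}"
  proof (cases "a = 0")
    case True
    then show ?thesis using norm_seminorm by (auto simp: A_def mem)
  next
    case False
    have "N.loc a \<in> A"
      using N.loc_seminorm[OF a] N.loc_mult_self[OF a] False a by (simp add: A_def)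
    then show ?thesis by blast
  qed
  have "\<exists>m\<in>A. \<forall>p\<in>A. P m p \<longrightarrow> p = m"
  proof (rule predicate_Zorn)
    show "partial_order_on A (relation_of P A)"
    proof (rule partial_order_on_relation_ofI)
      show "P p r" if "P p q" "P q r" for p q r
        using that unfolding P_def by (meson order_trans)
      show "p = q" if "P p q" "P q p" for p q
        using that unfolding P_def by (intro ext antisym) auto
    qed (auto simp: P_def)
  next
    fix C assume "C \<in> Chains (relation_of P A)"
    then have "\<forall>p\<in>C. \<forall>q\<in>C. p \<in> A \<and> q \<in> A \<and> (P p q \<or> P q p)"
      unfolding Chains_def relation_of_def by fast
    then have CA: "\<And>p q. p \<in> C \<Longrightarrow> q \<in> C \<Longrightarrow> p \<in> A"
      and chain: "\<And>p q. p \<in> C \<Longrightarrow> q \<in> C \<Longrightarrow> (\<forall>x. p x \<le> q x) \<or> (\<forall>x. q x \<le> p x)"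
      unfolding P_def by blast+
    show "\<exists>u\<in>A. \<forall>p\<in>C. P p u"
    proof (cases "C = {}")
      case True
      then show ?thesis using ne by auto
    next
      case False
      define u where "u = (\<lambda>x. INF p\<in>C. p x)"
      have sem: "power_mult_seminorm D p" if "p \<in> C" for p
        using CA[OF that that] by (simp add: A_def)
      have u: "power_mult_seminorm D u" "\<And>p x. p \<in> C \<Longrightarrow> u x \<le> p x"
        unfolding u_def
        by (rule chain_Inf_seminorm(1)[OF False sem chain], assumption+)
           (rule chain_Inf_seminorm(2)[OF False sem chain], assumption+)
      have "u (a * x) = norm a * u x" if x: "x \<in> D" for x
      proof (rule antisym)
        show "u (a * x) \<le> norm a * u x"
        proof -
          have "u (a * x) \<le> u a * u x" by (rule power_mult_seminorm.submult[OF u(1) a x])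
          also have "\<dots> \<le> norm a * u x"
            by (intro mult_right_mono power_mult_seminorm.le_norm[OF u(1) a]
                power_mult_seminorm.nonneg[OF u(1) x])
          finally show ?thesis .
        qed
        have "norm a * u x \<le> p (a * x)" if p: "p \<in> C" for p
        proof -
          have "p (a * x) = norm a * p x" using CA[OF p p] x by (simp add: A_def)
          then show ?thesis using u(2)[OF p, of x] by (simp add: mult_left_mono)
        qed
        then show "norm a * u x \<le> u (a * x)"
          unfolding u_def using False by (intro cINF_greatest) auto
      qed
      then have "u \<in> A" using u(1) by (simp add: A_def)
      then show ?thesis using u(2) by (auto simp: P_def)
    qed
  qed
  then obtain m where m: "m \<in> A" and min: "\<And>p. p \<in> A \<Longrightarrow> (\<forall>x. p x \<le> m x) \<Longrightarrow> p = m"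
    by (auto simp: P_def)
  interpret m: power_mult_seminorm D m using m by (simp add: A_def)
  have ma: "m (a * x) = norm a * m x" if "x \<in> D" for x using m that by (simp add: A_def)
  show thesis
  proof (rule that)
    show "m a = norm a" using ma[OF one_mem] by (simp add: m.at_one)
    show "m (x * y) = m x * m y" if xy: "x \<in> D" "y \<in> D" for x y
    proof (cases "m x = 0")
      case True
      then show ?thesis
        using m.submult[OF xy] m.nonneg[of "x * y"] xy by (simp add: mem)
    next
      case False
      then have x: "x \<in> D" "m x > 0" using m.nonneg[OF xy(1)] xy by auto
      have "m.loc x \<in> A"
        using m.loc_seminorm[OF x] m.loc_mult_left[OF x a ma] by (simp add: A_def)
      moreover have "m.loc x z \<le> m z" for z
        using m.loc_le[OF x, of z] m.loc_def[OF x] m.outside by (cases "z \<in> D") auto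
      ultimately have "m.loc x = m" using min by blast
      then show ?thesis using m.loc_mult_self[OF x xy(2)] by simp
    qed
  qed (rule m.power_mult_seminorm_axioms)
qed

end

section \<open>Multiplicative seminorms and the Gelfand-Mazur argument\<close>

locale multiplicative_seminorm = power_mult_seminorm +
  assumes multiplicative: "x \<in> D \<Longrightarrow> y \<in> D \<Longrightarrow> p (x * y) = p x * p y"
begin

lemma abs_diff_le: "x \<in> D \<Longrightarrow> y \<in> D \<Longrightarrow> \<bar>p x - p y\<bar> \<le> p (x - y)"
  using subadd[of "x - y" y] subadd[of "y - x" x] minus_eq[of "x - y"] by (simp add: mem abs_le_iff)

text \<open>Split \<open>z ^ (2 ^ k) - c ^ (2 ^ k)\<close> by repeated differences of squares:
  \<open>z - c\<close> is one factor, and the others contribute at least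
  \<open>m ^ (2 ^ k - 1)\<close>. The whole is at most
  \<open>m ^ (2 ^ k) + cmod c ^ (2 ^ k)\<close>; dividing and letting \<open>k\<close> grow gives
  \<open>p (z - c) \<le> m\<close>, as \<open>cmod c < m\<close>. Exponents \<open>2 ^ k\<close>
  keep the factorisation within complex square roots.\<close>

lemma cconst_diff_const:
  assumes z: "z \<in> D" "p z = m" "m > 0" and min: "\<And>c. m \<le> p (z - cconst c)" and c: "cmod c < m"
  shows "p (z - cconst c) = m"
proof -
  have factor: "z ^ (2 ^ Suc k) - cconst (d ^ 2) = (z ^ (2 ^ k) - cconst d) * (z ^ (2 ^ k) - cconst (- d))"
    for k d
    using cconst_commute[of "z ^ (2 ^ k)" d]
    by (simp add: mult_2 power_add algebra_simps cconst_minus cconst_mult power2_eq_square)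
  have p_factor: "p (z ^ (2 ^ Suc k) - cconst (d ^ 2)) =
      p (z ^ (2 ^ k) - cconst d) * p (z ^ (2 ^ k) - cconst (- d))" for k d
    unfolding factor using z by (intro multiplicative) (auto simp: mem)
  \<comment> \<open>By successive square roots, any scalar translate of \<open>z ^ (2 ^ k)\<close>
    is a product of \<open>2 ^ k\<close> scalar translates of \<open>z\<close>, each of seminorm at
    least \<open>m\<close>.\<close>
  have A: "m ^ (2 ^ k) \<le> p (z ^ (2 ^ k) - cconst d)" for k d
  proof (induction k arbitrary: d)
    case 0
    then show ?case using min by simp
  next
    case (Suc k)
    have "m ^ (2 ^ Suc k) = m ^ (2 ^ k) * m ^ (2 ^ k)"
      by (simp add: mult_2 power_add)
    also have "\<dots> \<le> p (z ^ (2 ^ k) - cconst (csqrt d)) * p (z ^ (2 ^ k) - cconst (- csqrt d))"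
      using z by (intro mult_mono Suc.IH) (auto intro: nonneg simp: mem)
    also have "\<dots> = p (z ^ (2 ^ Suc k) - cconst d)"
      using p_factor[of k "csqrt d"] by simp
    finally show ?case .
  qed
  have B: "p (z - cconst c) * m ^ (2 ^ k - 1) \<le> p (z ^ (2 ^ k) - cconst (c ^ (2 ^ k)))" for k
  proof (induction k)
    case (Suc k)
    have "(2 ^ Suc k - 1 :: nat) = (2 ^ k - 1) + 2 ^ k"
      by (simp add: mult_2)
    then have "p (z - cconst c) * m ^ (2 ^ Suc k - 1) = p (z - cconst c) * m ^ (2 ^ k - 1) * m ^ (2 ^ k)"
      by (simp only: power_add mult.assoc)
    also have "\<dots> \<le> p (z ^ (2 ^ k) - cconst (c ^ (2 ^ k))) * p (z ^ (2 ^ k) - cconst (- (c ^ (2 ^ k))))"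
      using z by (intro mult_mono Suc.IH A) (auto intro: nonneg simp: mem)
    also have "\<dots> = p (z ^ (2 ^ Suc k) - cconst (c ^ (2 ^ Suc k)))"
      using p_factor[of k "c ^ (2 ^ k)"] by (simp add: power_mult [symmetric] mult.commute)
    finally show ?case .
  qed simp
  define r where "r = cmod c / m"
  have r: "0 \<le> r" "r < 1" using c z by (auto simp: r_def)
  have "p (z - cconst c) \<le> m * (1 + r ^ (2 ^ k))" for k
  proof -
    have m_eq: "m ^ (2 ^ k) = m * m ^ (2 ^ k - 1)"
      by (metis One_nat_def Suc_pred pos2 power_Suc zero_less_power)
    have "p (z ^ (2 ^ k) - cconst (c ^ (2 ^ k))) \<le> p (z ^ (2 ^ k)) + p (cconst (c ^ (2 ^ k)))"
      using z by (intro diff_le) (auto simp: mem)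
    also have "\<dots> = m ^ (2 ^ k) + cmod c ^ (2 ^ k)"
      using z by (simp add: power_eq at_cconst norm_power)
    also have "cmod c = r * m" using z by (simp add: r_def)
    also have "m ^ (2 ^ k) + (r * m) ^ (2 ^ k) = m * (1 + r ^ (2 ^ k)) * m ^ (2 ^ k - 1)"
      by (simp add: power_mult_distrib m_eq algebra_simps)
    finally have "p (z - cconst c) * m ^ (2 ^ k - 1) \<le> m * (1 + r ^ (2 ^ k)) * m ^ (2 ^ k - 1)"
      using B[of k] by linarith
    then show ?thesis using z by simp
  qed
  moreover have "(\<lambda>k. m * (1 + r ^ (2 ^ k))) \<longlonglongrightarrow> m * (1 + 0)"
  proof (intro tendsto_intros)
    have "(\<lambda>n. r ^ n) \<longlonglongrightarrow> 0" using r by (intro LIMSEQ_realpow_zero)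
    then show "(\<lambda>k. r ^ (2 ^ k)) \<longlonglongrightarrow> 0"
      using LIMSEQ_subseq_LIMSEQ[of "\<lambda>n. r ^ n" 0 "\<lambda>k. 2 ^ k"] by (simp add: strict_mono_def o_def)
  qed
  ultimately have "p (z - cconst c) \<le> m"
    using LIMSEQ_le_const[of "\<lambda>k. m * (1 + r ^ (2 ^ k))" m "p (z - cconst c)"] by auto
  then show ?thesis using min[of c] by simp
qed

text \<open>Gelfand--Mazur: the minimum of \<open>p (x - c)\<close> cannot be positive, since it would be constant.\<close>

lemma cconst_approximable:
  assumes x: "x \<in> D"
  obtains c where "p (x - cconst c) = 0"
proof -
  define f where "f c = p (x - cconst c)" for c
  have growth: "cmod c - p x \<le> f c" for c
    using subadd[of x "- (x - cconst c)"] minus_eq[of "x - cconst c"] x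
      abs_diff_le[of "cconst c" x] minus_eq[of "x - cconst c"]
    by (simp add: f_def mem at_cconst)
  have "\<bar>f c - f d\<bar> \<le> cmod (c - d)" for c d
    using abs_diff_le[of "x - cconst c" "x - cconst d"] x minus_eq[of "cconst (c - d)"]
    by (simp add: f_def mem at_cconst cconst_diff [symmetric])
       (metis at_cconst cconst_diff norm_minus_commute)
  then have "continuous_on UNIV f"
    by (intro continuous_at_imp_continuous_on ballI, unfold continuous_at_eps_delta)
       (metis dist_norm dist_real_def order_le_less_trans)
  \<comment> \<open>Outside this disc \<open>f c \<ge> cmod c - p x > p x + 1 > f 0\<close>, so a
    minimum over the disc is a global one.\<close>
  then have "continuous_on (cball 0 (2 * p x + 1)) f"
    by (rule continuous_on_subset) auto
  moreover have "compact (cball (0::complex) (2 * p x + 1))" by simp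
  moreover have "cball (0::complex) (2 * p x + 1) \<noteq> {}" using nonneg[OF x] by auto
  ultimately obtain c0 where "\<forall>c\<in>cball 0 (2 * p x + 1). f c0 \<le> f c"
    using continuous_attains_inf[of "cball (0::complex) (2 * p x + 1)" f] by blast
  then have c0: "\<And>c. cmod c \<le> 2 * p x + 1 \<Longrightarrow> f c0 \<le> f c" by simp
  have min: "f c0 \<le> f c" for c
  proof (cases "cmod c \<le> 2 * p x + 1")
    case False
    have "f c0 \<le> f 0" using c0[of 0] nonneg[OF x] by simp
    then show ?thesis using growth[of c] False by (simp add: f_def)
  qed (rule c0)
  have "f c0 = 0"
  proof (rule ccontr)
    assume "f c0 \<noteq> 0"
    then have m: "f c0 > 0" using nonneg[of "x - cconst c0"] x by (simp add: f_def mem)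
    \<comment> \<open>Steps of half the minimum stay strictly inside the radius of
      \<open>cconst_diff_const\<close>, so the minimal value propagates arbitrarily far along a ray,
      against the growth of \<open>f\<close>.\<close>
    have const: "f (c0 + of_real (real n * (f c0 / 2))) = f c0" for n
    proof (induction n)
      case (Suc n)
      define d where "d = c0 + of_real (real n * (f c0 / 2))"
      have "p (x - cconst d - cconst (of_real (f c0 / 2))) = f c0"
      proof (rule cconst_diff_const)
        show "f c0 \<le> p (x - cconst d - cconst c)" for c
          using min[of "d + c"] by (simp add: f_def cconst_add algebra_simps)
      qed (use x m Suc in \<open>auto simp: mem f_def d_def\<close>)
      moreover have "x - cconst d - cconst (of_real (f c0 / 2))
          = x - cconst (c0 + of_real (real (Suc n) * (f c0 / 2)))"
        by (simp add: d_def cconst_add [symmetric] diff_diff_eq) (simp add: algebra_simps add_divide_distrib)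
      ultimately show ?case
        unfolding f_def[of "c0 + of_real (real (Suc n) * (f c0 / 2))"] by (simp only:)
    qed simp
    obtain n where n: "real n * (f c0 / 2) > f c0 + p x + cmod c0"
      using reals_Archimedean3[of "f c0 / 2"] m by (meson half_gt_zero)
    have "real n * (f c0 / 2) - cmod c0 \<le> cmod (c0 + of_real (real n * (f c0 / 2)))"
      using norm_triangle_ineq4[of "c0 + of_real (real n * (f c0 / 2))" c0] m
      by (simp add: norm_mult norm_divide)
    then show False
      using growth[of "c0 + of_real (real n * (f c0 / 2))"] const[of n] n by simp
  qed
  then show thesis using that[of c0] by (simp add: f_def)
qed

end

lemma characters_type_cstar:
  "characters type_cstar D = {w \<in> extensional D.
     (\<forall>x\<in>D. \<forall>y\<in>D. w (x + y) = w x + w y \<and> w (x * y) = w x * w y) \<and>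
     (\<forall>c. \<forall>x\<in>D. w (scaleC c x) = c * w x) \<and> (\<exists>x\<in>D. w x \<noteq> 0)}"
  by (simp add: characters_def type_cstar_def)

text \<open>The value of the character at \<open>x\<close> is the unique scalar \<open>c\<close>
  with \<open>p (x - c) = 0\<close>. Uniqueness, from \<open>p (cconst c) = cmod c\<close>, turns
  the seminorm inequalities into additivity and multiplicativity, and \<open>p\<close> becomes the
  modulus of the character.\<close>

theorem (in commutative_cstar) norming_character:
  assumes a: "a \<in> D"
  obtains w where "w \<in> characters type_cstar D" "cmod (w a) = norm a"
proof -
  obtain p where "power_mult_seminorm D p" and pa: "p a = norm a"
    and "\<And>x y. x \<in> D \<Longrightarrow> y \<in> D \<Longrightarrow> p (x * y) = p x * p y"
    using multiplicative_seminorm_exists[OF a] by blast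
  then interpret multiplicative_seminorm D p
    by (simp add: multiplicative_seminorm_def multiplicative_seminorm_axioms_def)
  define w where "w = restrict (\<lambda>x. SOME c. p (x - cconst c) = 0) D"
  have w: "p (x - cconst (w x)) = 0" if "x \<in> D" for x
    using someI_ex[of "\<lambda>c. p (x - cconst c) = 0"] cconst_approximable[OF that] that
    by (auto simp: w_def)
  have w_eq: "w x = c" if x: "x \<in> D" and c: "p (x - cconst c) \<le> 0" for x c
  proof -
    have "p (cconst (c - w x)) = p ((x - cconst (w x)) - (x - cconst c))"
      by (simp add: cconst_diff)
    also have "\<dots> \<le> p (x - cconst (w x)) + p (x - cconst c)"
      using x by (intro diff_le) (auto simp: mem)
    finally have "cmod (c - w x) \<le> 0" unfolding at_cconst using w[OF x] c by linarith
    then show ?thesis by simp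
  qed
  have add: "w (x + y) = w x + w y" if "x \<in> D" "y \<in> D" for x y
  proof (rule w_eq)
    have eq: "x + y - cconst (w x + w y) = (x - cconst (w x)) + (y - cconst (w y))"
      by (simp add: cconst_add)
    show "p (x + y - cconst (w x + w y)) \<le> 0"
      unfolding eq using subadd[of "x - cconst (w x)" "y - cconst (w y)"] w that by (simp add: mem)
  qed (use that in \<open>auto simp: mem\<close>)
  have mult: "w (x * y) = w x * w y" if "x \<in> D" "y \<in> D" for x y
  proof (rule w_eq)
    have eq: "x * y - cconst (w x * w y) = x * (y - cconst (w y)) + cconst (w y) * (x - cconst (w x))"
      using cconst_commute[of x "w y"] cconst_mult[of "w y" "w x"] mult.commute[of "w x" "w y"]
      by (simp only: right_diff_distrib) simp
    show "p (x * y - cconst (w x * w y)) \<le> 0"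
      unfolding eq using subadd[of "x * (y - cconst (w y))" "cconst (w y) * (x - cconst (w x))"] w that
      by (simp add: mem multiplicative)
  qed (use that in \<open>auto simp: mem\<close>)
  have cc: "w (cconst c) = c" for c
    using at_cconst[of 0] by (intro w_eq) (auto simp: mem)
  have "w \<in> characters type_cstar D"
    unfolding characters_type_cstar
  proof (intro CollectI conjI ballI allI)
    show "w \<in> extensional D" by (simp add: w_def)
    show "w (scaleC c x) = c * w x" if "x \<in> D" for c x
      using mult[OF cconst_mem that, of c] by (simp add: cc scaleC_cconst)
    show "\<exists>x\<in>D. w x \<noteq> 0" using cc[of 1] cconst_mem[of 1] by (metis zero_neq_one)
  qed (use add mult in auto)
  moreover have "cmod (w a) = norm a"
    using abs_diff_le[OF a cconst_mem, of "w a"] w[OF a] pa by (simp add: at_cconst)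
  ultimately show thesis by (rule that)
qed

section \<open>The Gelfand transform\<close>

context commutative_cstar
begin

abbreviation Spec :: "('a \<Rightarrow> complex) set" where
  "Spec \<equiv> characters type_cstar D"

lemma char_add: "w \<in> Spec \<Longrightarrow> x \<in> D \<Longrightarrow> y \<in> D \<Longrightarrow> w (x + y) = w x + w y"
  and char_mult: "w \<in> Spec \<Longrightarrow> x \<in> D \<Longrightarrow> y \<in> D \<Longrightarrow> w (x * y) = w x * w y"
  and char_scaleC: "w \<in> Spec \<Longrightarrow> x \<in> D \<Longrightarrow> w (scaleC c x) = c * w x"
  by (auto simp: characters_type_cstar)

lemma char_one: "w \<in> Spec \<Longrightarrow> w 1 = 1"
proof -
  assume w: "w \<in> Spec"
  then obtain x where x: "x \<in> D" "w x \<noteq> 0" by (auto simp: characters_type_cstar)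
  show "w 1 = 1" using char_mult[OF w x(1) one_mem] x by simp
qed

lemma char_minus: "w \<in> Spec \<Longrightarrow> x \<in> D \<Longrightarrow> w (- x) = - w x"
  using char_scaleC[of w x "-1"] by (simp add: scaleC_minus_one)

lemma char_diff: "w \<in> Spec \<Longrightarrow> x \<in> D \<Longrightarrow> y \<in> D \<Longrightarrow> w (x - y) = w x - w y"
  using char_add[of w x "- y"] by (simp add: mem char_minus)

lemma char_cconst: "w \<in> Spec \<Longrightarrow> w (cconst c) = c"
  using char_scaleC[of w 1 c] by (simp add: cconst_def char_one mem)

lemma char_of_real: "w \<in> Spec \<Longrightarrow> w (of_real r) = of_real r"
  using char_cconst[of w "of_real r"] by (simp add: cconst_of_real)

lemma char_power: "w \<in> Spec \<Longrightarrow> x \<in> D \<Longrightarrow> w (x ^ n) = w x ^ n"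
  by (induction n) (auto simp: char_one char_mult mem)

text \<open>Otherwise a multiple \<open>y\<close> of \<open>x\<close> has norm below 1 and
  \<open>w y = 1\<close>. Its geometric series \<open>s\<close> lies in \<open>D\<close> and
  satisfies \<open>s - 1 = y * s\<close>, which \<open>w\<close> turns into
  \<open>w s - 1 = w s\<close>.\<close>

lemma char_le_norm:
  assumes w: "w \<in> Spec" and x: "x \<in> D"
  shows "cmod (w x) \<le> norm x"
proof (rule ccontr)
  assume "\<not> ?thesis"
  then have lt: "norm x < cmod (w x)" and nz: "w x \<noteq> 0" by auto
  define y where "y = scaleC (1 / w x) x"
  have y: "y \<in> D" using x by (simp add: y_def mem)
  have ny: "norm y < 1" using lt nz by (simp add: y_def norm_scaleC norm_divide field_simps)
  have wy: "w y = 1" using nz by (simp add: y_def char_scaleC[OF w x])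
  have summ: "summable (\<lambda>n. y ^ n)"
    using ny by (intro summable_comparison_test'[OF summable_geometric[of "norm y"]])
      (auto intro: norm_power_ineq)
  define s where "s = (\<Sum>n. y ^ n)"
  have "(\<Sum>i<n. y ^ i) \<in> D" for n
    using y by (induction n) (auto simp: mem)
  moreover have "(\<lambda>n. \<Sum>i<n. y ^ i) \<longlonglongrightarrow> s"
    using summ summable_LIMSEQ by (auto simp: s_def)
  ultimately have s: "s \<in> D"
    by (rule closed_sequentially[OF closed_mem])
  have "s - 1 = y * s"
    using suminf_split_head[OF summ] suminf_mult[OF summ, of y] by (simp add: s_def)
  then have "w (s - 1) = w (y * s)" by simp
  then show False using s y by (simp add: char_diff[OF w] char_mult[OF w] char_one[OF w] wy mem)
qed

text \<open>Arens' trick: adding \<open>\<i> * l\<close> to \<open>h\<close> raises the squared norm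
  by at most \<open>l^2\<close>, but the squared modulus of the character by
  \<open>2 * b * l\<close> beyond that. The choice of \<open>l\<close> makes
  \<open>2 * b * l\<close> equal to \<open>(norm h)^2 + 1\<close>, which is too much.\<close>

lemma char_selfadjoint_real:
  assumes w: "w \<in> Spec" and h: "h \<in> D" "star h = h"
  shows "Im (w h) = 0"
proof (rule ccontr)
  define b where "b = Im (w h)"
  assume "Im (w h) \<noteq> 0"
  then have b: "b \<noteq> 0" by (simp add: b_def)
  define l where "l = ((norm h)\<^sup>2 + 1) / (2 * b)"
  define y where "y = h + cconst (\<i> * of_real l)"
  have y: "y \<in> D" using h by (simp add: y_def mem)
  have "star y * y = h * h - cconst (\<i> * of_real l) * cconst (\<i> * of_real l)"
    using cconst_commute[of h "\<i> * of_real l"]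
    by (simp add: y_def star_add h star_cconst distrib_left left_diff_distrib cconst_minus)
  also have "cconst (\<i> * of_real l) * cconst (\<i> * of_real l) = - (of_real (l\<^sup>2) :: 'a)"
  proof -
    have "\<i> * of_real l * (\<i> * of_real l) = - complex_of_real (l\<^sup>2)"
      by (simp add: complex_eq_iff power2_eq_square)
    then show ?thesis
      by (simp only: cconst_mult [symmetric] cconst_of_real [symmetric] cconst_minus [symmetric])
  qed
  finally have "star y * y = h * h + of_real (l\<^sup>2)" by simp
  then have "(norm y)\<^sup>2 = norm (h * h + of_real (l\<^sup>2))"
    by (simp add: norm_star_mult_self [symmetric])
  also have "\<dots> \<le> norm (h * h) + norm (of_real (l\<^sup>2) :: 'a)" by (rule norm_triangle_ineq)
  also have "norm (h * h) = (norm h)\<^sup>2" using norm_square h by simp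
  finally have "(norm y)\<^sup>2 \<le> (norm h)\<^sup>2 + l\<^sup>2" unfolding norm_of_real by simp
  moreover have "(cmod (w y))\<^sup>2 \<le> (norm y)\<^sup>2"
    using char_le_norm[OF w y] by (simp add: power_mono)
  moreover have "w y = w h + \<i> * of_real l"
    using h by (simp add: y_def char_add[OF w] char_cconst[OF w] mem)
  then have "(cmod (w y))\<^sup>2 = (Re (w h))\<^sup>2 + (b + l)\<^sup>2"
    by (simp add: cmod_power2 b_def)
  ultimately have "(Re (w h))\<^sup>2 + b\<^sup>2 + 2 * b * l \<le> (norm h)\<^sup>2"
    by (simp add: power2_sum)
  moreover have "2 * b * l = (norm h)\<^sup>2 + 1" using b by (simp add: l_def)
  ultimately show False
    using zero_le_power2[of "Re (w h)"] zero_le_power2[of b] by linarith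
qed

lemma char_star:
  assumes w: "w \<in> Spec" and x: "x \<in> D"
  shows "w (star x) = cnj (w x)"
proof (rule complex_eqI)
  have "Im (w (x + star x)) = 0"
    using x by (intro char_selfadjoint_real[OF w]) (auto simp: mem star_add star_star add.commute)
  then show "Im (w (star x)) = Im (cnj (w x))"
    using x by (simp add: char_add[OF w] mem)
  have "star (scaleC \<i> (star x - x)) = scaleC (- \<i>) (x - star x)"
    by (simp add: star_scaleC star_diff star_star)
  also have "\<dots> = scaleC \<i> (star x - x)"
    by (simp add: scaleC_cconst cconst_minus right_diff_distrib)
  finally have "Im (w (scaleC \<i> (star x - x))) = 0"
    using x by (intro char_selfadjoint_real[OF w]) (auto simp: mem)
  then show "Re (w (star x)) = Re (cnj (w x))"
    using x by (simp add: char_scaleC[OF w] char_diff[OF w] mem)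
qed

lemma char_eqI:
  assumes "x \<in> D" "y \<in> D" "\<And>w. w \<in> Spec \<Longrightarrow> w x = w y"
  shows "x = y"
proof -
  obtain w where w: "w \<in> Spec" "cmod (w (x - y)) = norm (x - y)"
    using norming_character[OF diff_mem[OF assms(1,2)]] by blast
  then have "norm (x - y) = 0" using assms(3)[OF w(1)] assms(1,2) by (simp add: char_diff)
  then show ?thesis by simp
qed

lemma norm_leI:
  assumes "x \<in> D" "\<And>w. w \<in> Spec \<Longrightarrow> cmod (w x) \<le> r"
  shows "norm x \<le> r"
  using norming_character[OF assms(1)] assms(2) by metis

lemma char_continuous: "continuous_on Spec (\<lambda>w. w x)"
  using continuous_on_product_coordinates[of x] by (rule continuous_on_subset) auto

text \<open>Tychonoff: characters lie in a product of discs, with a single point as factor off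
  \<open>D\<close>, and are cut out there by closed conditions.\<close>

lemma compact_Spec: "compact Spec"
proof -
  define K where "K = Pi\<^sub>E UNIV (\<lambda>x. if x \<in> D then cball (0::complex) (norm x) else {undefined})"
  have "compactin (product_topology (\<lambda>_. euclidean) UNIV) K"
    unfolding K_def by (subst compactin_PiE) auto
  then have K: "compact K"
    by (simp add: euclidean_product_topology)
  have cont: "continuous_on UNIV (\<lambda>w::'a \<Rightarrow> complex. w x)" for x
    by (rule continuous_on_product_coordinates)
  \<comment> \<open>The closed condition \<open>w 1 = 1\<close> takes the place of
    \<open>w \<noteq> 0\<close> on \<open>D\<close>, which is not closed.\<close>
  define Q where "Q = (\<Inter>x\<in>-D. {w :: 'a \<Rightarrow> complex. w x = undefined}) \<inter>
    (\<Inter>x\<in>D. \<Inter>y\<in>D. {w. w (x + y) = w x + w y} \<inter> {w. w (x * y) = w x * w y}) \<inter>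
    (\<Inter>c. \<Inter>x\<in>D. {w. w (scaleC c x) = c * w x}) \<inter> {w. w 1 = 1}"
  have "closed Q"
    unfolding Q_def
    by (intro closed_Int closed_INT ballI closed_Collect_eq continuous_intros cont)
  moreover have "Spec = K \<inter> Q"
  proof (intro subset_antisym subsetI)
    fix w assume w: "w \<in> Spec"
    then have "w \<in> K" using char_le_norm[OF w]
      by (auto simp: K_def characters_type_cstar extensional_def)
    moreover have "w \<in> Q" using w char_one[OF w]
      by (auto simp: Q_def characters_type_cstar extensional_def)
    ultimately show "w \<in> K \<inter> Q" by blast
  next
    fix w assume "w \<in> K \<inter> Q"
    then show "w \<in> Spec" using one_mem
      by (auto simp: Q_def characters_type_cstar extensional_def intro!: bexI[of _ 1])
  qed
  ultimately show ?thesis using K by (metis compact_Int_closed)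
qed

text \<open>Off \<open>D\<close> all characters take the same value \<open>undefined\<close>, so the
  additional coordinates of the full function type do not change the topology.\<close>

lemma spectrum_topology_eq: "spectrum_topology type_cstar D = top_of_set Spec"
proof -
  have top: "topspace (spectrum_topology type_cstar D) = Spec"
    unfolding spectrum_topology_def by (auto simp: characters_type_cstar PiE_def)
  have "continuous_map (top_of_set Spec) (spectrum_topology type_cstar D) id"
    unfolding spectrum_topology_def continuous_map_in_subtopology continuous_map_componentwise
    using char_continuous by (auto simp: characters_type_cstar extensional_def)
  moreover have "continuous_map (spectrum_topology type_cstar D) (top_of_set Spec) id"
  proof -
    have "continuous_map (spectrum_topology type_cstar D) euclidean (\<lambda>w. w x)" for x
    proof (cases "x \<in> D")
      case True
      then show ?thesis unfolding spectrum_topology_def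
        by (intro continuous_map_from_subtopology continuous_map_product_projection)
    next
      case False
      have "continuous_map (spectrum_topology type_cstar D) euclidean (\<lambda>w. undefined :: complex)"
        by simp
      then show ?thesis
        by (rule continuous_map_eq) (use False top in \<open>auto simp: characters_type_cstar extensional_def\<close>)
    qed
    then show ?thesis
      using top unfolding continuous_map_in_subtopology euclidean_product_topology [symmetric]
        continuous_map_componentwise by auto
  qed
  ultimately have "homeomorphic_maps (top_of_set Spec) (spectrum_topology type_cstar D) id id"
    by (simp add: homeomorphic_maps_def)
  then have "homeomorphic_map (top_of_set Spec) (spectrum_topology type_cstar D) id"
    by (rule homeomorphic_maps_imp_map)
  then show ?thesis by (simp add: homeomorphic_map_id)
qed

text \<open>The transform is isometric, so elements approximating \<open>F\<close> uniformly on the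
  spectrum form a Cauchy sequence; its limit has the right values because characters are
  contractive.\<close>

lemma gelfand_complete:
  assumes approx: "\<And>e. e > 0 \<Longrightarrow> \<exists>b\<in>D. \<forall>w\<in>Spec. cmod (w b - F w) < e"
  obtains b where "b \<in> D" "\<And>w. w \<in> Spec \<Longrightarrow> w b = F w"
proof -
  have "\<exists>b\<in>D. \<forall>w\<in>Spec. cmod (w b - F w) < 1 / real (Suc n)" for n
    by (rule approx) simp
  then obtain f where f: "\<And>n. f n \<in> D" "\<And>n w. w \<in> Spec \<Longrightarrow> cmod (w (f n) - F w) < 1 / real (Suc n)"
    by metis
  have dist: "norm (f m - f n) \<le> 1 / real (Suc m) + 1 / real (Suc n)" for m n
  proof (rule norm_leI)
    show "f m - f n \<in> D" using f by (simp add: mem)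
    fix w assume w: "w \<in> Spec"
    have "w (f m - f n) = (w (f m) - F w) - (w (f n) - F w)"
      using f w by (simp add: char_diff)
    then show "cmod (w (f m - f n)) \<le> 1 / real (Suc m) + 1 / real (Suc n)"
      using norm_triangle_ineq4[of "w (f m) - F w" "w (f n) - F w"] f(2)[OF w, of m] f(2)[OF w, of n]
      by simp
  qed
  have "Cauchy f"
  proof (rule CauchyI)
    fix e :: real assume "e > 0"
    then obtain N where N: "1 / real (Suc N) < e / 2"
      using nat_approx_posE[of "e / 2"] by (metis half_gt_zero)
    have "norm (f m - f n) < e" if "m \<ge> N" "n \<ge> N" for m n
    proof -
      have "1 / real (Suc m) \<le> 1 / real (Suc N)" "1 / real (Suc n) \<le> 1 / real (Suc N)"
        using that by (auto intro!: divide_left_mono)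
      then show ?thesis using dist[of m n] N by linarith
    qed
    then show "\<exists>M. \<forall>m\<ge>M. \<forall>n\<ge>M. norm (f m - f n) < e" by blast
  qed
  then obtain b where b: "f \<longlonglongrightarrow> b"
    by (auto simp: Cauchy_convergent_iff convergent_def)
  have bD: "b \<in> D"
    by (rule closed_sequentially[OF closed_mem f(1) b])
  have "w b = F w" if w: "w \<in> Spec" for w
  proof (rule LIMSEQ_unique)
    have lim: "(\<lambda>n. norm (f n - b)) \<longlonglongrightarrow> 0"
      by (rule tendsto_norm_zero[OF LIM_zero[OF b]])
    have le: "cmod (w (f n) - w b) \<le> norm (f n - b)" for n
      using char_le_norm[OF w diff_mem[OF f(1) bD], of n] by (simp only: char_diff[OF w f(1) bD])
    have "(\<lambda>n. w (f n) - w b) \<longlonglongrightarrow> 0"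
      by (rule Lim_null_comparison[OF always_eventually[OF allI[OF le]] lim])
    then show "(\<lambda>n. w (f n)) \<longlonglongrightarrow> w b" by (rule LIM_zero_cancel)
    have le: "cmod (w (f n) - F w) \<le> inverse (real (Suc n))" for n
      using f(2)[OF w, of n] by (simp add: inverse_eq_divide)
    have "(\<lambda>n. w (f n) - F w) \<longlonglongrightarrow> 0"
      by (rule Lim_null_comparison[OF always_eventually[OF allI[OF le]] LIMSEQ_inverse_real_of_nat])
    then show "(\<lambda>n. w (f n)) \<longlonglongrightarrow> F w" by (rule LIM_zero_cancel)
  qed
  then show thesis using bD that by blast
qed

text \<open>Stone-Weierstrass for the real functions that are transforms of elements of
  \<open>D\<close>. They separate points since \<open>D\<close> is star-closed, so that real and
  imaginary parts of transforms are transforms again.\<close>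

lemma gelfand_surj_real:
  fixes F :: "('a \<Rightarrow> complex) \<Rightarrow> real"
  assumes F: "continuous_on Spec F"
  obtains b where "b \<in> D" "\<And>w. w \<in> Spec \<Longrightarrow> w b = of_real (F w)"
proof -
  define R where
    "R = {f. continuous_on Spec f \<and> (\<exists>b\<in>D. \<forall>w\<in>Spec. w b = complex_of_real (f w))}"
  interpret function_ring_on R Spec
  proof
    show "compact Spec" by (rule compact_Spec)
    show "continuous_on Spec f" if "f \<in> R" for f using that by (simp add: R_def)
    show "(\<lambda>x. f x + g x) \<in> R" if "f \<in> R" "g \<in> R" for f g
    proof -
      obtain b c where "b \<in> D" "\<forall>w\<in>Spec. w b = complex_of_real (f w)"
        "c \<in> D" "\<forall>w\<in>Spec. w c = complex_of_real (g w)"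
        using \<open>f \<in> R\<close> \<open>g \<in> R\<close> by (auto simp: R_def)
      then show ?thesis
        using \<open>f \<in> R\<close> \<open>g \<in> R\<close>
        by (auto simp: R_def mem char_add intro!: continuous_intros bexI[of _ "b + c"])
    qed
    show "(\<lambda>x. f x * g x) \<in> R" if "f \<in> R" "g \<in> R" for f g
    proof -
      obtain b c where "b \<in> D" "\<forall>w\<in>Spec. w b = complex_of_real (f w)"
        "c \<in> D" "\<forall>w\<in>Spec. w c = complex_of_real (g w)"
        using \<open>f \<in> R\<close> \<open>g \<in> R\<close> by (auto simp: R_def)
      then show ?thesis
        using \<open>f \<in> R\<close> \<open>g \<in> R\<close>
        by (auto simp: R_def mem char_mult intro!: continuous_intros bexI[of _ "b * c"])
    qed
    show "(\<lambda>_. c) \<in> R" for c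
      by (auto simp: R_def mem char_cconst intro!: bexI[of _ "cconst (of_real c)"])
    fix v w assume vw: "v \<in> Spec" "w \<in> Spec" "v \<noteq> w"
    then obtain x where x: "v x \<noteq> w x" by auto
    then have xD: "x \<in> D"
      using vw by (auto simp: characters_type_cstar extensional_def)
    have "continuous_on Spec (\<lambda>w. Re (w x))" "continuous_on Spec (\<lambda>w. Im (w x))"
      by (intro continuous_intros char_continuous)+
    moreover have "\<forall>u\<in>Spec. u (scaleC (1/2) (x + star x)) = of_real (Re (u x))"
      using xD by (auto simp: char_scaleC char_add char_star mem complex_eq_iff)
    moreover have "\<forall>u\<in>Spec. u (scaleC (-\<i>/2) (x - star x)) = of_real (Im (u x))"
      using xD by (auto simp: char_scaleC char_diff char_star mem complex_eq_iff)
    moreover have "scaleC (1/2) (x + star x) \<in> D" "scaleC (-\<i>/2) (x - star x) \<in> D"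
      using xD by (auto simp: mem)
    ultimately have "(\<lambda>w. Re (w x)) \<in> R" "(\<lambda>w. Im (w x)) \<in> R"
      unfolding R_def by blast+
    moreover have "Re (v x) \<noteq> Re (w x) \<or> Im (v x) \<noteq> Im (w x)"
      using x by (simp add: complex_eq_iff)
    ultimately show "\<exists>f\<in>R. f v \<noteq> f w"
      using bexI[of "\<lambda>f. f v \<noteq> f w" "\<lambda>w. Re (w x)" R] bexI[of "\<lambda>f. f v \<noteq> f w" "\<lambda>w. Im (w x)" R]
      by blast
  qed
  show thesis
  proof (rule gelfand_complete[of "\<lambda>w. of_real (F w)"])
    fix e :: real assume e: "e > 0"
    obtain g where g: "g \<in> R" "\<forall>w\<in>Spec. \<bar>F w - g w\<bar> < e"
      using Stone_Weierstrass_basic[OF F e] by auto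
    then obtain b where b: "b \<in> D" "\<forall>w\<in>Spec. w b = complex_of_real (g w)"
      by (auto simp: R_def)
    have "cmod (w b - of_real (F w)) < e" if "w \<in> Spec" for w
    proof -
      have "w b - of_real (F w) = of_real (g w - F w)" using b that by simp
      then have "cmod (w b - of_real (F w)) = \<bar>g w - F w\<bar>" by (simp only: norm_of_real)
      then show ?thesis using g that by (simp add: abs_minus_commute)
    qed
    then show "\<exists>b\<in>D. \<forall>w\<in>Spec. cmod (w b - of_real (F w)) < e" using b by blast
  qed (use that in blast)
qed

theorem gelfand_surj:
  fixes F :: "('a \<Rightarrow> complex) \<Rightarrow> complex"
  assumes F: "continuous_on Spec F"
  obtains b where "b \<in> D" "\<And>w. w \<in> Spec \<Longrightarrow> w b = F w"
proof -
  obtain a where a: "a \<in> D" "\<And>w. w \<in> Spec \<Longrightarrow> w a = of_real (Re (F w))"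
    using gelfand_surj_real[of "\<lambda>w. Re (F w)"] F by (auto intro: continuous_intros)
  obtain b where b: "b \<in> D" "\<And>w. w \<in> Spec \<Longrightarrow> w b = of_real (Im (F w))"
    using gelfand_surj_real[of "\<lambda>w. Im (F w)"] F by (auto intro: continuous_intros)
  show thesis
  proof (rule that[of "a + scaleC \<i> b"])
    show "a + scaleC \<i> b \<in> D" using a b by (simp add: mem)
    show "w (a + scaleC \<i> b) = F w" if "w \<in> Spec" for w
      using a b that by (simp add: char_add char_scaleC mem complex_eq_iff)
  qed
qed

end

section \<open>Totally disconnected spectra\<close>

text \<open>In a compact Hausdorff space a component has arbitrarily small clopen neighbourhoods.
  Components being points, each point of \<open>K\<close> gets one inside \<open>U\<close>, and
  finitely many of them cover \<open>K\<close>.\<close>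

lemma clopen_between:
  fixes X :: "'b::t2_space set"
  assumes X: "compact X" and td: "totally_disconnected_space (top_of_set X)"
    and K: "compact K" "K \<subseteq> U" and U: "openin (top_of_set X) U"
  obtains E where "openin (top_of_set X) E" "closedin (top_of_set X) E" "K \<subseteq> E" "E \<subseteq> U"
proof -
  have UX: "U \<subseteq> X" using U openin_imp_subset by blast
  have "\<exists>T. open T \<and> x \<in> T \<and> X \<inter> T \<subseteq> U \<and> closedin (top_of_set X) (X \<inter> T)" if x: "x \<in> K" for x
  proof -
    have xX: "x \<in> X" using x K UX by blast
    have "compact_space (top_of_set X)"
      using X by (simp add: compact_space_def compactin_subtopology)
    then have lc: "locally_compact_space (top_of_set X)"
      by (rule compact_imp_locally_compact_space)
    have hd: "Hausdorff_space (top_of_set X)"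
    proof (rule Hausdorff_space_subtopology, unfold Hausdorff_space_def, intro allI impI)
      fix a b :: 'b assume "a \<in> topspace euclidean \<and> b \<in> topspace euclidean \<and> a \<noteq> b"
      then show "\<exists>U V. openin euclidean U \<and> openin euclidean V \<and> a \<in> U \<and> b \<in> V \<and> disjnt U V"
        using hausdorff[of a b] by (simp add: disjnt_def)
    qed
    have "connected_component_of_set (top_of_set X) x = {x}"
      using td connectedin_connected_component_of[of "top_of_set X" x] xX
        connected_component_of_refl[of "top_of_set X" x]
      unfolding totally_disconnected_space_def by auto
    then have comp: "{x} \<in> connected_components_of (top_of_set X)"
      using xX by (metis connected_component_in_connected_components_of topspace_euclidean_subtopology)
    obtain V W where VW: "openin (top_of_set X) V" "openin (top_of_set X) W" "disjnt V W"
      "V \<union> W = topspace (top_of_set X)" "{x} \<subseteq> V" "V \<subseteq> U"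
      using wilder_locally_compact_component_thm[OF lc hd comp _ U] xX x K by auto
    then have "V = X - W"
      using openin_imp_subset by (fastforce simp: disjnt_def)
    then have "closedin (top_of_set X) V"
      using VW(2) by (metis closedin_diff closedin_topspace topspace_euclidean_subtopology)
    moreover obtain T where "open T" "V = X \<inter> T"
      using VW(1) by (auto simp: openin_open)
    ultimately show ?thesis using VW by auto
  qed
  then have "\<exists>T. \<forall>x\<in>K. open (T x) \<and> x \<in> T x \<and> X \<inter> T x \<subseteq> U \<and> closedin (top_of_set X) (X \<inter> T x)"
    by (intro bchoice ballI)
  then obtain T where T: "\<And>x. x \<in> K \<Longrightarrow> open (T x)" "\<And>x. x \<in> K \<Longrightarrow> x \<in> T x"
    "\<And>x. x \<in> K \<Longrightarrow> X \<inter> T x \<subseteq> U" "\<And>x. x \<in> K \<Longrightarrow> closedin (top_of_set X) (X \<inter> T x)"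
    by auto
  obtain C where C: "C \<subseteq> K" "finite C" "K \<subseteq> (\<Union>c\<in>C. T c)"
    using compactE_image[OF K(1), of K T] T by blast
  show thesis
  proof (rule that[of "\<Union>c\<in>C. X \<inter> T c"])
    show "openin (top_of_set X) (\<Union>c\<in>C. X \<inter> T c)"
      using C T by (intro openin_Union) (auto simp: openin_open)
    show "closedin (top_of_set X) (\<Union>c\<in>C. X \<inter> T c)"
      using C T by (intro closedin_Union) auto
    show "K \<subseteq> (\<Union>c\<in>C. X \<inter> T c)" using C(3) K(2) UX by auto
    show "(\<Union>c\<in>C. X \<inter> T c) \<subseteq> U" using C(1) T(3) by (intro UN_least) auto
  qed
qed

lemma continuous_on_clopen_cases:
  assumes E: "openin (top_of_set X) E" "closedin (top_of_set X) E"
    and f: "continuous_on E f" and g: "continuous_on (X - E) g"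
  shows "continuous_on X (\<lambda>x. if x \<in> E then f x else g x)"
proof -
  have EX: "E \<subseteq> X" using E openin_imp_subset by blast
  have cl: "closedin (top_of_set X) (X - E)"
    using closedin_diff[OF closedin_topspace E(1)] by simp
  have X: "E \<union> (X - E) = X" using EX by blast
  have "continuous_on (E \<union> (X - E)) (\<lambda>x. if x \<in> E then f x else g x)"
    by (rule continuous_on_cases_local[OF _ _ f g]) (unfold X, use E(2) cl in auto)
  then show ?thesis by (simp only: X)
qed

context commutative_cstar
begin

text \<open>On a clopen set where \<open>h\<close> is positive, take \<open>k\<close> to be the
  inverse square root of \<open>h\<close>, and 0 elsewhere; then \<open>k * h * star k\<close> is
  the indicator function of that set.\<close>

lemma totally_disconnected_projection:
  assumes td: "totally_disconnected_space (spectrum_topology type_cstar D)"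
    and h: "h \<in> D" "h \<noteq> 0" and pos: "\<And>w. w \<in> Spec \<Longrightarrow> w h \<in> \<real> \<and> 0 \<le> Re (w h)"
  obtains k where "k \<in> D" "projection (k * h * star k)" "k * h * star k \<noteq> 0"
proof -
  obtain w0 where w0: "w0 \<in> Spec" "cmod (w0 h) = norm h"
    using norming_character[OF h(1)] by blast
  define U where "U = Spec \<inter> {w. Re (w h) > 0}"
  have U: "openin (top_of_set Spec) U"
    unfolding U_def
    by (intro openin_open_Int open_Collect_less continuous_intros continuous_on_product_coordinates)
  have "w0 h \<noteq> 0" using w0 h by auto
  then have "w0 \<in> U"
    using w0 pos[OF w0(1)] by (auto simp: U_def complex_is_Real_iff complex_eq_iff less_le)
  then obtain E where E: "openin (top_of_set Spec) E" "closedin (top_of_set Spec) E" "{w0} \<subseteq> E" "E \<subseteq> U"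
    using clopen_between[OF compact_Spec, of "{w0}" U] td U by (auto simp: spectrum_topology_eq)
  have EU: "E \<subseteq> Spec" "\<And>w. w \<in> E \<Longrightarrow> 0 < Re (w h)" using E by (auto simp: U_def)
  have "continuous_on Spec (\<lambda>w. if w \<in> E then 1 / sqrt (Re (w h)) else 0)"
    using EU by (intro continuous_on_clopen_cases E continuous_intros
        continuous_on_subset[OF char_continuous]) force+
  then obtain k where k: "k \<in> D"
    "\<And>w. w \<in> Spec \<Longrightarrow> w k = of_real (if w \<in> E then 1 / sqrt (Re (w h)) else 0)"
    using gelfand_surj_real by blast
  have ekD: "k * h * star k \<in> D" using k h by (simp add: mem)
  have ek: "w (k * h * star k) = (if w \<in> E then 1 else 0)" if w: "w \<in> Spec" for w
  proof (cases "w \<in> E")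
    case True
    have "w h = of_real (Re (w h))" using pos[OF w] by (simp add: complex_is_Real_iff complex_eq_iff)
    moreover have "1 / sqrt (Re (w h)) * Re (w h) * (1 / sqrt (Re (w h))) = 1"
      using EU(2)[OF True] by (simp add: field_simps)
    ultimately have *: "of_real (1 / sqrt (Re (w h))) * w h * of_real (1 / sqrt (Re (w h))) = (1::complex)"
      by (metis of_real_1 of_real_mult)
    have wk: "w k = of_real (1 / sqrt (Re (w h)))" using k(2)[OF w] True by simp
    have "w (k * h * star k) = w k * w h * cnj (w k)"
      using w k h by (simp add: char_mult char_star mem)
    also have "\<dots> = 1" unfolding wk complex_cnj_complex_of_real by (rule *)
    finally show ?thesis using True by simp
  next
    case False
    then have "w k = 0" using k(2)[OF w] by simp
    then show ?thesis using False w k(1) h by (simp add: char_mult char_star mem)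
  qed
  show thesis
  proof (rule that[OF k(1)])
    define e where "e = k * h * star k"
    have e: "e \<in> D" "\<And>w. w \<in> Spec \<Longrightarrow> w e = (if w \<in> E then 1 else 0)"
      using ekD ek by (simp_all add: e_def)
    have "star e = e"
    proof (rule char_eqI)
      show "w (star e) = w e" if "w \<in> Spec" for w
        using e(2)[OF that] e(1) that by (simp add: char_star)
    qed (use e in \<open>simp_all add: mem\<close>)
    moreover have "e * e = e"
    proof (rule char_eqI)
      show "w (e * e) = w e" if "w \<in> Spec" for w
        using e(2)[OF that] e(1) that by (simp add: char_mult)
    qed (use e in \<open>simp_all add: mem\<close>)
    ultimately show "projection (k * h * star k)" by (simp add: projection_def e_def)
    show "k * h * star k \<noteq> 0"
      using ek[OF w0(1)] E(3) char_cconst[OF w0(1), of 0] by auto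
  qed
qed

text \<open>No single branch of the logarithm need be continuous on the values of \<open>u\<close>.
  A clopen set containing \<open>Re (w u) \<ge> 0\<close> and avoiding \<open>w u = -1\<close>
  separates a part where the principal branch works from one where the real part is
  negative.\<close>

lemma totally_disconnected_unitary_root:
  assumes td: "totally_disconnected_space (spectrum_topology type_cstar D)"
    and u: "u \<in> D" "unitary u" and p: "p > 0"
  obtains z where "z \<in> D" "unitary z" "z ^ p = u"
proof -
  have norm_u: "cmod (w u) = 1" if w: "w \<in> Spec" for w
  proof -
    have "w (star u * u) = 1" using u char_one[OF w] by (simp add: unitary_def)
    then have "cnj (w u) * w u = 1" using u w by (simp add: char_mult char_star mem)
    then have "of_real ((cmod (w u))\<^sup>2) = (1::complex)"
      by (simp only: complex_norm_square mult.commute)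
    then have "(cmod (w u))\<^sup>2 = 1" by (metis of_real_eq_1_iff)
    then show ?thesis by (simp add: power2_eq_1_iff) (smt (verit) norm_ge_zero)
  qed
  define K where "K = Spec \<inter> {w. Re (w u) \<ge> 0}"
  define U where "U = Spec \<inter> {w. w u \<noteq> -1}"
  have U: "openin (top_of_set Spec) U"
    unfolding U_def
    by (intro openin_open_Int open_Collect_neq continuous_intros continuous_on_product_coordinates)
  have "closed {w :: 'a \<Rightarrow> complex. Re (w u) \<ge> 0}"
    by (intro closed_Collect_le continuous_intros continuous_on_product_coordinates)
  then have K: "compact K" unfolding K_def using compact_Spec by blast
  have "K \<subseteq> U" by (auto simp: K_def U_def)
  then obtain E where E: "openin (top_of_set Spec) E" "closedin (top_of_set Spec) E" "K \<subseteq> E" "E \<subseteq> U"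
    using clopen_between[OF compact_Spec _ K _ U] td by (auto simp: spectrum_topology_eq)
  have EU: "E \<subseteq> Spec" using E by (auto simp: U_def)
  \<comment> \<open>The constant \<open>exp (\<i> * pi / p)\<close> is a p-th root of -1 and makes
    up for the sign in \<open>Ln (- w u)\<close>.\<close>
  define F where "F w = (if w \<in> E then exp (Ln (w u) / of_nat p)
     else exp (\<i> * of_real pi / of_nat p) * exp (Ln (- w u) / of_nat p))" for w :: "'a \<Rightarrow> complex"
  have inE: "w u \<notin> \<real>\<^sub>\<le>\<^sub>0" if w: "w \<in> E" for w
  proof
    assume "w u \<in> \<real>\<^sub>\<le>\<^sub>0"
    then obtain r where "w u = of_real r" "r \<le> 0" by (auto elim: nonpos_Reals_cases)
    moreover have "cmod (w u) = 1" using norm_u EU w by blast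
    ultimately have "w u = -1" by simp
    then show False using E w by (auto simp: U_def)
  qed
  have outE: "- w u \<notin> \<real>\<^sub>\<le>\<^sub>0" if w: "w \<in> Spec - E" for w
  proof -
    have "Re (w u) < 0" using w E by (auto simp: K_def)
    then show ?thesis by (auto simp: complex_nonpos_Reals_iff)
  qed
  have "continuous_on Spec F"
    unfolding F_def using EU inE outE p
    by (intro continuous_on_clopen_cases E continuous_intros
        continuous_on_subset[OF char_continuous]) auto
  then obtain z where z: "z \<in> D" "\<And>w. w \<in> Spec \<Longrightarrow> w z = F w"
    using gelfand_surj by blast
  have Fp: "F w ^ p = w u" and FF: "cnj (F w) * F w = 1" if w: "w \<in> Spec" for w
  proof -
    have nz: "w u \<noteq> 0" using norm_u[OF w] by auto
    have root: "exp (x / of_nat p) ^ p = exp x" for x :: complex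
      using p by (simp add: exp_of_nat_mult [symmetric])
    show "F w ^ p = w u"
      using nz by (simp add: F_def power_mult_distrib root)
    then have "cmod (F w) ^ p = 1" using norm_u[OF w] by (metis norm_power)
    then have "cmod (F w) = 1"
      using p by (intro power_eq_imp_eq_base[of "cmod (F w)" p 1]) auto
    then show "cnj (F w) * F w = 1"
      by (metis complex_norm_square mult.commute of_real_1 power_one)
  qed
  show thesis
  proof (rule that[OF z(1)])
    have "star z * z = 1"
    proof (rule char_eqI)
      show "w (star z * z) = w 1" if "w \<in> Spec" for w
        using z(2)[OF that] FF[OF that] z(1) that by (simp add: char_mult char_star char_one mem)
    qed (use z in \<open>simp_all add: mem\<close>)
    then show "unitary z"
      using comm[OF z(1) star_mem[OF z(1)]] by (simp add: unitary_def)
    show "z ^ p = u"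
    proof (rule char_eqI)
      show "w (z ^ p) = w u" if "w \<in> Spec" for w
        using z(2)[OF that] Fp[OF that] z(1) that by (simp add: char_power)
    qed (use z u in \<open>simp_all add: mem\<close>)
  qed
qed

end

section \<open>Commutants\<close>

definition commutant :: "'a::unital_cstar_algebra set \<Rightarrow> 'a set" where
  "commutant S = {y. \<forall>x\<in>S. x * y = y * x}"

lemma commutant_antimono: "S \<subseteq> T \<Longrightarrow> commutant T \<subseteq> commutant S"
  by (auto simp: commutant_def)

lemma subset_bicommutant: "S \<subseteq> commutant (commutant S)"
  by (auto simp: commutant_def)

lemma closed_commutant: "closed (commutant S)"
proof -
  have "commutant S = (\<Inter>x\<in>S. {y. x * y = y * x})" by (auto simp: commutant_def)
  then show ?thesis
    by (simp only:) (intro closed_INT ballI closed_Collect_eq continuous_intros)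
qed

lemma star_commutant:
  assumes S: "\<And>x. x \<in> S \<Longrightarrow> star x \<in> S" and y: "y \<in> commutant S"
  shows "star y \<in> commutant S"
proof -
  have "x * star y = star y * x" if "x \<in> S" for x
  proof -
    have "star x * y = y * star x" using S[OF that] y by (simp add: commutant_def)
    then have "star (star x * y) = star (y * star x)" by simp
    then show ?thesis by (simp add: star_mult star_star)
  qed
  then show ?thesis by (simp add: commutant_def)
qed

text \<open>A self-adjoint commuting set lies in its commutant, hence its bicommutant is commutative.\<close>

lemma commutative_cstar_bicommutant:
  assumes star: "\<And>x. x \<in> S \<Longrightarrow> star x \<in> S" and comm: "\<And>x y. x \<in> S \<Longrightarrow> y \<in> S \<Longrightarrow> x * y = y * x"
  shows "commutative_cstar (commutant (commutant S))"
proof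
  let ?C = "commutant (commutant S)"
  show "1 \<in> ?C" by (simp add: commutant_def)
  show "x + y \<in> ?C" if "x \<in> ?C" "y \<in> ?C" for x y
    using that by (auto simp: commutant_def[of "commutant S"] distrib_left distrib_right)
  show "x * y \<in> ?C" if "x \<in> ?C" "y \<in> ?C" for x y
    using that by (auto simp: commutant_def[of "commutant S"]) (metis mult.assoc)
  show "scaleC c x \<in> ?C" if "x \<in> ?C" for c x
    using that by (auto simp: commutant_def[of "commutant S"] mult_scaleC_left mult_scaleC_right)
  show "star x \<in> ?C" if "x \<in> ?C" for x
    using that by (rule star_commutant[rotated]) (rule star_commutant[OF star])
  show "closed ?C" by (rule closed_commutant)
  have "S \<subseteq> commutant S" using comm by (auto simp: commutant_def)
  then have "?C \<subseteq> commutant S" by (rule commutant_antimono)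
  then show "x * y = y * x" if "x \<in> ?C" "y \<in> ?C" for x y
    using that by (auto simp: commutant_def[of "commutant S"])
qed

text \<open>The bicommutant stands in for the C*-algebra generated by \<open>h\<close> and 1: it is
  commutative and contains \<open>h\<close>, and closedness comes with the definition. Its
  characters serve as the spectrum of \<open>h\<close>.\<close>

lemma commutative_cstar_selfadjoint:
  assumes "star h = h"
  shows "commutative_cstar (commutant (commutant {h}))"
  using assms by (intro commutative_cstar_bicommutant) auto

lemma selfadjoint_mem: "h \<in> commutant (commutant {h})"
  using subset_bicommutant[of "{h}"] by simp

section \<open>Positive elements\<close>

text \<open>
  For self-adjoint \<open>h\<close> the norm condition says that the spectrum lies in some \<open>[0, 2 t]\<close>; in this
  form it is visibly stable under sums.
\<close>

definition cpos :: "'a::unital_cstar_algebra \<Rightarrow> bool" where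
  "cpos h \<longleftrightarrow> star h = h \<and> (\<exists>t. norm (of_real t - h) \<le> t)"

lemma cpos_add: "cpos h \<Longrightarrow> cpos k \<Longrightarrow> cpos (h + k)"
proof -
  assume h: "cpos h" and k: "cpos k"
  then obtain s t where "norm (of_real s - h) \<le> s" "norm (of_real t - k) \<le> t"
    by (auto simp: cpos_def)
  moreover have "of_real (s + t) - (h + k) = (of_real s - h) + (of_real t - k)" by simp
  ultimately have "norm (of_real (s + t) - (h + k)) \<le> s + t"
    by (metis add_mono norm_triangle_mono)
  then have "\<exists>r. norm (of_real r - (h + k)) \<le> r" by blast
  then show "cpos (h + k)" using h k by (simp add: cpos_def star_add)
qed

lemma cpos_zero: "cpos 0"
  by (auto simp: cpos_def intro!: exI[of _ 0])

lemma cpos_sum: "(\<And>i. i \<in> I \<Longrightarrow> cpos (f i)) \<Longrightarrow> cpos (sum f I)"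
  by (induction I rule: infinite_finite_induct) (auto simp: cpos_zero cpos_add)

lemma star_of_real [simp]: "star (of_real r) = (of_real r :: 'a::unital_cstar_algebra)"
  using star_cconst[of "complex_of_real r"] by (simp add: cconst_of_real)

text \<open>The witness is \<open>t = 2 * norm h\<close>, for which the difference in question is
  \<open>norm h + h\<close>.\<close>

lemma cpos_norm_diff:
  assumes "star h = h"
  shows "cpos (of_real (norm h) - h)"
proof -
  have "a + a - (a - h) = a + h" for a :: 'a by (simp add: algebra_simps)
  then have "norm (of_real (norm h + norm h) - (of_real (norm h) - h)) \<le> norm h + norm h"
    using norm_triangle_ineq[of "of_real (norm h)" h] by (simp only: of_real_add norm_of_real abs_norm_cancel)
  then have "\<exists>t. norm (of_real t - (of_real (norm h) - h)) \<le> t" by (rule exI)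
  then show ?thesis using assms by (simp add: cpos_def star_diff)
qed

text \<open>From \<open>norm (t - h) \<le> t\<close> one reads off
  \<open>t - Re (w h) \<le> t\<close>. Conversely \<open>t = norm h\<close> works, because the
  values of \<open>h\<close> lie between 0 and \<open>norm h\<close>.\<close>

lemma (in commutative_cstar) cpos_iff:
  assumes h: "h \<in> D"
  shows "cpos h \<longleftrightarrow> (\<forall>w\<in>Spec. w h \<in> \<real> \<and> 0 \<le> Re (w h))"
proof
  assume "cpos h"
  then obtain t where sa: "star h = h" and t: "norm (of_real t - h) \<le> t" by (auto simp: cpos_def)
  show "\<forall>w\<in>Spec. w h \<in> \<real> \<and> 0 \<le> Re (w h)"
  proof (intro ballI conjI)
    fix w assume w: "w \<in> Spec"
    show "w h \<in> \<real>" using char_selfadjoint_real[OF w h sa] by (simp add: complex_is_Real_iff)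
    have "Re (w (of_real t - h)) \<le> norm (of_real t - h)"
      using h by (intro order_trans[OF complex_Re_le_cmod char_le_norm[OF w]]) (auto simp: mem of_real_mem)
    moreover have "w (of_real t - h) = of_real t - w h"
      using h by (simp add: char_diff[OF w] char_of_real[OF w] of_real_mem)
    ultimately show "0 \<le> Re (w h)" using t by simp
  qed
next
  assume pos: "\<forall>w\<in>Spec. w h \<in> \<real> \<and> 0 \<le> Re (w h)"
  have "star h = h"
  proof (rule char_eqI)
    show "w (star h) = w h" if "w \<in> Spec" for w
      using pos that by (simp add: char_star[OF that h] complex_is_Real_iff complex_eq_iff)
  qed (use h in \<open>auto simp: mem\<close>)
  moreover have "norm (of_real (norm h) - h) \<le> norm h"
  proof (rule norm_leI)
    show "of_real (norm h) - h \<in> D" using h by (simp add: mem of_real_mem)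
    fix w assume w: "w \<in> Spec"
    have wh: "w h = of_real (Re (w h))" "0 \<le> Re (w h)"
      using pos w by (auto simp: complex_is_Real_iff complex_eq_iff)
    have "w (of_real (norm h) - h) = of_real (norm h - Re (w h))"
      using h wh(1) by (simp add: char_diff[OF w] char_of_real[OF w] of_real_mem)
    then have "cmod (w (of_real (norm h) - h)) = \<bar>norm h - Re (w h)\<bar>"
      by (simp only: norm_of_real)
    moreover have "Re (w h) \<le> norm h"
      using char_le_norm[OF w h] complex_Re_le_cmod[of "w h"] by linarith
    ultimately show "cmod (w (of_real (norm h) - h)) \<le> norm h" using wh(2) by simp
  qed
  ultimately show "cpos h" by (auto simp: cpos_def)
qed

lemma cpos_square:
  assumes h: "star h = h"
  shows "cpos (h * h)"
proof -
  interpret commutative_cstar "commutant (commutant {h})"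
    by (rule commutative_cstar_selfadjoint[OF h])
  have hD: "h \<in> commutant (commutant {h})" by (rule selfadjoint_mem)
  have "w (h * h) \<in> \<real> \<and> 0 \<le> Re (w (h * h))" if w: "w \<in> Spec" for w
    using char_selfadjoint_real[OF w hD h] by (simp add: char_mult[OF w hD hD] complex_is_Real_iff)
  then show ?thesis using hD by (subst cpos_iff) (auto simp: mem)
qed

lemma cpos_antisym:
  assumes "cpos h" "cpos (- h)"
  shows "h = 0"
proof -
  have h: "star h = h" using assms by (simp add: cpos_def)
  interpret commutative_cstar "commutant (commutant {h})"
    by (rule commutative_cstar_selfadjoint[OF h])
  have hD: "h \<in> commutant (commutant {h})" by (rule selfadjoint_mem)
  show ?thesis
  proof (rule char_eqI[OF hD zero_mem])
    fix w assume w: "w \<in> Spec"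
    have "w h \<in> \<real>" "0 \<le> Re (w h)" "0 \<le> Re (w (- h))"
      using assms w cpos_iff[OF hD] cpos_iff[OF minus_mem[OF hD]] by blast+
    then have "w h = 0"
      by (simp add: char_minus[OF w hD] complex_is_Real_iff complex_eq_iff)
    then show "w h = w 0" using char_cconst[OF w, of 0] by simp
  qed
qed

text \<open>\<open>h\<close> and \<open>k\<close> may fail to commute, so \<open>k\<close> is first
  bounded by the scalar \<open>norm k\<close>; positivity of \<open>norm k - h\<close> is then
  tested on characters of the bicommutant of \<open>h\<close> alone.\<close>

lemma norm_mono_cpos:
  assumes h: "cpos h" and kh: "cpos (k - h)"
  shows "norm h \<le> norm k"
proof -
  have sh: "star h = h" using h by (simp add: cpos_def)
  have "star k - h = k - h" using kh sh by (simp add: cpos_def star_diff)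
  then have "star k = k" by simp
  then have "cpos ((of_real (norm k) - k) + (k - h))"
    using kh by (intro cpos_add cpos_norm_diff)
  then have kh': "cpos (of_real (norm k) - h)" by simp
  interpret commutative_cstar "commutant (commutant {h})"
    by (rule commutative_cstar_selfadjoint[OF sh])
  have hD: "h \<in> commutant (commutant {h})" by (rule selfadjoint_mem)
  show ?thesis
  proof (rule norm_leI[OF hD])
    fix w assume w: "w \<in> Spec"
    have "w (of_real (norm k) - h) = of_real (norm k) - w h"
      using hD by (simp add: char_diff[OF w] char_of_real[OF w] of_real_mem)
    then have "Re (w h) \<le> norm k"
      using kh' w cpos_iff[OF diff_mem[OF of_real_mem[of "norm k"] hD]] by auto
    moreover have "w h \<in> \<real>" "0 \<le> Re (w h)" using h w cpos_iff[OF hD] by auto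
    ultimately show "cmod (w h) \<le> norm k"
      by (simp add: complex_is_Real_iff cmod_eq_Re)
  qed
qed

text \<open>
  The geometric growth of \<open>(t + y * star y) ^ n\<close> is compared with that of \<open>(t + star y * y) ^ n\<close>,
  using \<open>(t + y * star y) ^ n * y = y * (t + star y * y) ^ n\<close>.
\<close>

lemma cpos_minus_mult_star:
  assumes "cpos (- (star y * y))"
  shows "cpos (- (y * star y))"
proof -
  obtain s where s: "norm (of_real s + star y * y) \<le> s"
    using assms by (auto simp: cpos_def)
  \<comment> \<open>Adding 1 keeps \<open>t\<close> strictly positive even when
    \<open>s = 0\<close>.\<close>
  define t where "t = s + 1"
  have t: "t > 0" using s norm_ge_zero[of "of_real s + star y * y"] unfolding t_def by linarith
  define T :: 'a where "T = of_real t"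
  define k where "k = T + star y * y"
  define l where "l = T + y * star y"
  have T_comm: "T * x = x * T" for x
    using cconst_commute[of x "of_real t"] by (simp add: T_def cconst_of_real)
  have "k = (of_real s + star y * y) + 1" by (simp add: k_def T_def t_def)
  then have nk: "norm k \<le> t"
    using norm_triangle_ineq[of "of_real s + star y * y" 1] s by (simp add: t_def)
  have intertwine: "l ^ n * y = y * k ^ n" for n
  proof (induction n)
    case (Suc n)
    have "l * y = y * k"
      by (simp add: k_def l_def distrib_left distrib_right T_comm mult.assoc)
    then show ?case using Suc by (simp only: power_Suc2 power_Suc mult.assoc) (metis mult.assoc power_commutes)
  qed simp
  \<comment> \<open>Only a factor linear in \<open>n\<close> is lost against \<open>t ^ n\<close>.
    As \<open>norm (l ^ n) = norm l ^ n\<close>, this rules out \<open>norm l > t\<close>.\<close>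
  have bound: "norm (l ^ n) * t \<le> t ^ n * (t + real n * (norm y)\<^sup>2)" for n
  proof (induction n)
    case (Suc n)
    have "l ^ Suc n = T * l ^ n + y * k ^ n * star y"
      unfolding intertwine [symmetric] by (simp add: power_Suc2 l_def distrib_left T_comm mult.assoc del: power_Suc)
    then have "norm (l ^ Suc n) \<le> norm (T * l ^ n) + norm (y * k ^ n * star y)"
      by (simp add: norm_triangle_ineq del: power_Suc)
    also have "norm (T * l ^ n) \<le> t * norm (l ^ n)"
      using norm_mult_ineq[of T "l ^ n"] t by (simp add: T_def)
    also have "norm (y * k ^ n * star y) \<le> norm y * t ^ n * norm y"
    proof -
      have "norm (y * k ^ n * star y) \<le> norm y * norm (k ^ n) * norm (star y)"
        by (meson norm_mult_ineq order_trans mult_right_mono norm_ge_zero)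
      also have "\<dots> \<le> norm y * t ^ n * norm y"
        using t nk norm_power_ineq[of k n] power_mono[OF nk norm_ge_zero, of n]
        by (simp only: norm_star) (intro mult_mono, auto)
      finally show ?thesis .
    qed
    finally have "norm (l ^ Suc n) \<le> t * norm (l ^ n) + norm y * t ^ n * norm y" by simp
    then have "norm (l ^ Suc n) * t \<le> (t * norm (l ^ n) + norm y * t ^ n * norm y) * t"
      using t by (intro mult_right_mono) auto
    also have "\<dots> = t * (norm (l ^ n) * t) + t ^ Suc n * (norm y)\<^sup>2"
      by (simp add: algebra_simps power2_eq_square)
    also have "\<dots> \<le> t * (t ^ n * (t + real n * (norm y)\<^sup>2)) + t ^ Suc n * (norm y)\<^sup>2"
      using Suc t by (intro add_right_mono mult_left_mono) auto
    finally show ?case by (simp add: algebra_simps)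
  qed simp
  have sl: "star l = l" by (simp add: l_def T_def star_add star_mult star_star)
  interpret commutative_cstar "commutant (commutant {l})"
    by (rule commutative_cstar_selfadjoint[OF sl])
  interpret N: power_mult_seminorm "commutant (commutant {l})"
    "\<lambda>x. if x \<in> commutant (commutant {l}) then norm x else 0"
    by (rule norm_seminorm)
  have pow: "norm (l ^ n) = norm l ^ n" for n
    using N.power_eq[OF selfadjoint_mem[of l], of n] power_mem[OF selfadjoint_mem[of l], of n]
    by (simp add: selfadjoint_mem)
  have "norm l \<le> t"
  proof (rule ccontr)
    assume "\<not> norm l \<le> t"
    then have lt: "t < norm l" by simp
    then have nl: "norm l > 0" using t by linarith
    define r where "r = t / norm l"
    have r: "0 < r" "r < 1" using t lt nl by (simp_all add: r_def)
    have "t \<le> t * r ^ n + (norm y)\<^sup>2 * (real n * r ^ n)" for n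
    proof -
      have "norm l ^ n * t \<le> t ^ n * (t + real n * (norm y)\<^sup>2)" using bound[of n] by (simp add: pow)
      then have "t \<le> t ^ n * (t + real n * (norm y)\<^sup>2) / norm l ^ n"
        using nl by (simp add: pos_le_divide_eq mult.commute)
      also have "\<dots> = t * r ^ n + (norm y)\<^sup>2 * (real n * r ^ n)"
        using nl by (simp add: r_def power_divide field_simps)
      finally show ?thesis .
    qed
    moreover have "(\<lambda>n. r ^ n) \<longlonglongrightarrow> 0" "(\<lambda>n. real n * r ^ n) \<longlonglongrightarrow> 0"
      using r powser_times_n_limit_0[of r] by (auto intro: LIMSEQ_realpow_zero)
    then have "(\<lambda>n. t * r ^ n + (norm y)\<^sup>2 * (real n * r ^ n)) \<longlonglongrightarrow> t * 0 + (norm y)\<^sup>2 * 0"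
      by (intro tendsto_add tendsto_mult_left)
    ultimately have "t \<le> t * 0 + (norm y)\<^sup>2 * 0"
      by (intro LIMSEQ_le_const) auto
    then show False using t by simp
  qed
  then have "norm (of_real t - (- (y * star y))) \<le> t" by (simp add: l_def T_def)
  then show ?thesis unfolding cpos_def by (auto simp: star_minus star_mult star_star)
qed

text \<open>With \<open>c\<close> the negative part of \<open>h = star x * x\<close> and
  \<open>y = x * c\<close>, the element \<open>star y * y = c * h * c\<close> is minus the cube of
  \<open>c\<close>. So \<open>star y * y\<close> and \<open>y * star y\<close> are both negative,
  whereas their sum is half a sum of two squares; hence both vanish in turn, and \<open>c\<close>
  with them.\<close>

theorem cpos_star_mult: "cpos (star x * x)"
proof -
  define h where "h = star x * x"
  have sh: "star h = h" by (simp add: h_def star_mult star_star)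
  define D where "D = commutant (commutant {h})"
  interpret commutative_cstar D
    unfolding D_def by (rule commutative_cstar_selfadjoint[OF sh])
  have hD: "h \<in> D" unfolding D_def by (rule selfadjoint_mem)
  have hr: "w h = of_real (Re (w h))" if "w \<in> Spec" for w
    using char_selfadjoint_real[OF that hD sh] by (simp add: complex_eq_iff)
  have "continuous_on Spec (\<lambda>w. max 0 (- Re (w h)))"
    by (intro continuous_intros char_continuous)
  then obtain c where c: "c \<in> D" "\<And>w. w \<in> Spec \<Longrightarrow> w c = of_real (max 0 (- Re (w h)))"
    using gelfand_surj_real by blast
  have sc: "star c = c"
  proof (rule char_eqI)
    show "w (star c) = w c" if "w \<in> Spec" for w
      using c(2)[OF that] by (simp add: char_star[OF that c(1)])
  qed (use c in \<open>auto simp: mem\<close>)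
  define y where "y = x * c"
  have yy: "star y * y = c * h * c"
    by (simp add: y_def h_def star_mult sc mult.assoc)
  have chc: "w (- (c * h * c)) = of_real (max 0 (- Re (w h)) ^ 3)" if w: "w \<in> Spec" for w
  proof -
    have "w (- (c * h * c)) = - (w c * w h * w c)"
      using c hD by (simp add: char_minus[OF w] char_mult[OF w] mem)
    also have "\<dots> = of_real (- (max 0 (- Re (w h)) * Re (w h) * max 0 (- Re (w h))))"
      using hr[OF w] c(2)[OF w] by (metis of_real_minus of_real_mult)
    also have "- (max 0 (- Re (w h)) * Re (w h) * max 0 (- Re (w h))) = max 0 (- Re (w h)) ^ 3"
      by (simp add: max_def power3_eq_cube)
    finally show ?thesis .
  qed
  have "cpos (- (c * h * c))"
  proof (subst cpos_iff)
    show "- (c * h * c) \<in> D" using c hD by (simp add: mem)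
    show "\<forall>w\<in>Spec. w (- (c * h * c)) \<in> \<real> \<and> 0 \<le> Re (w (- (c * h * c)))"
    proof
      fix w assume "w \<in> Spec"
      then show "w (- (c * h * c)) \<in> \<real> \<and> 0 \<le> Re (w (- (c * h * c)))"
        unfolding chc[OF \<open>w \<in> Spec\<close>] by simp
    qed
  qed
  then have neg: "cpos (- (star y * y))" by (simp add: yy)
  then have neg': "cpos (- (y * star y))" by (rule cpos_minus_mult_star)
  \<comment> \<open>Twice the real and imaginary parts of \<open>y\<close>:
    \<open>a * a + b * b\<close> is twice the sum of \<open>star y * y\<close> and
    \<open>y * star y\<close>.\<close>
  define a where "a = y + star y"
  define b where "b = scaleC \<i> (star y - y)"
  have "star b = scaleC (- \<i>) (y - star y)" by (simp add: b_def star_scaleC star_diff star_star)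
  then have "star b = b" by (simp add: b_def scaleC_cconst cconst_minus right_diff_distrib)
  moreover have "star a = a" by (simp add: a_def star_add star_star add.commute)
  ultimately have "cpos (a * a + b * b + - (y * star y) + - (y * star y))"
    by (intro cpos_add cpos_square neg')
  also have "b * b = - ((star y - y) * (star y - y))"
    by (simp add: b_def mult_scaleC_left mult_scaleC_right scaleC_scaleC scaleC_minus_one)
  also have "a * a + - ((star y - y) * (star y - y)) + - (y * star y) + - (y * star y)
      = star y * y + star y * y"
    by (simp add: a_def algebra_simps)
  finally have "cpos (star y * y + star y * y)" .
  then have "cpos (star y * y + star y * y + - (star y * y))" by (rule cpos_add[OF _ neg])
  moreover have "star y * y + star y * y + - (star y * y) = star y * y" by simp
  ultimately have "cpos (star y * y)" by (simp only:)
  then have "star y * y = 0" using neg by (rule cpos_antisym)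
  then have "c * h * c = 0" by (simp add: yy)
  then have max0: "max 0 (- Re (w h)) ^ 3 = 0" if w: "w \<in> Spec" for w
    using chc[OF w] char_cconst[OF w, of 0] by (simp add: complex_eq_iff)
  have "0 \<le> Re (w h)" if w: "w \<in> Spec" for w
    using max0[OF w] by (simp add: max_def split: if_splits)
  moreover have "w h \<in> \<real>" if "w \<in> Spec" for w
    using hr[OF that] by (metis Reals_of_real)
  ultimately have "cpos h" using cpos_iff[OF hD] by blast
  then show ?thesis by (simp add: h_def)
qed

text \<open>The remaining summands are positive and the norm is monotone on positive elements. This
  bounds the coordinates of a vector of the Hilbert module.\<close>

lemma norm_le_norm_sum_star_mult:
  fixes x :: "'i \<Rightarrow> 'a::unital_cstar_algebra"
  assumes I: "finite I" "i \<in> I"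
  shows "(norm (x i))\<^sup>2 \<le> norm (\<Sum>j\<in>I. star (x j) * x j)"
proof -
  have "norm (star (x i) * x i) \<le> norm (\<Sum>j\<in>I. star (x j) * x j)"
  proof (rule norm_mono_cpos)
    have "(\<Sum>j\<in>I. star (x j) * x j) - star (x i) * x i = (\<Sum>j\<in>I - {i}. star (x j) * x j)"
      using I by (simp add: sum_diff1)
    then show "cpos ((\<Sum>j\<in>I. star (x j) * x j) - star (x i) * x i)"
      by (simp add: cpos_sum cpos_star_mult)
  qed (rule cpos_star_mult)
  then show ?thesis by (simp add: norm_star_mult_self)
qed

section \<open>Automorphisms\<close>

lemma star_automorphismD:
  assumes "star_automorphism \<phi>"
  shows "bij \<phi>" "\<phi> (x + y) = \<phi> x + \<phi> y" "\<phi> (x * y) = \<phi> x * \<phi> y"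
    "\<phi> (scaleC c x) = scaleC c (\<phi> x)" "\<phi> (star x) = star (\<phi> x)"
  using assms by (auto simp: star_automorphism_def)

lemma star_automorphism_one:
  assumes "star_automorphism \<phi>" shows "\<phi> 1 = 1"
proof -
  obtain e where "\<phi> e = 1" using star_automorphismD(1)[OF assms] by (metis bij_pointE)
  then show ?thesis using star_automorphismD(3)[OF assms, of 1 e] by simp
qed

lemma star_automorphism_zero: "star_automorphism \<phi> \<Longrightarrow> \<phi> 0 = 0"
  using star_automorphismD(2)[of \<phi> 0 0] by simp

lemma star_automorphism_inv:
  assumes "star_automorphism \<phi>" shows "star_automorphism (inv_into UNIV \<phi>)"
proof -
  have b: "bij \<phi>" by (rule star_automorphismD(1)[OF assms])
  then have i: "inv_into UNIV \<phi> (\<phi> x) = x" "\<phi> (inv_into UNIV \<phi> x) = x" for x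
    by (auto simp: bij_is_inj bij_is_surj surj_f_inv_f)
  have eqI: "inv_into UNIV \<phi> x = y" if "x = \<phi> y" for x y using that i by simp
  show ?thesis
    unfolding star_automorphism_def using b i
    by (auto simp: bij_imp_bij_inv star_automorphismD[OF assms] intro!: eqI)
qed

text \<open>For self-adjoint \<open>h\<close>, a character norming the image of \<open>h\<close>
  pulls back to a character of the bicommutant of \<open>h\<close>, so automorphisms are contractive
  there. The C*-identity extends this to all elements, and the inverse automorphism gives
  equality.\<close>

lemma star_automorphism_norm:
  assumes "star_automorphism \<phi>"
  shows "norm (\<phi> x) = norm x"
proof -
  have sa: "norm (\<psi> h) \<le> norm h" if psi: "star_automorphism \<psi>" and h: "star h = h"
    for \<psi> and h :: 'a
  proof -
    note D = star_automorphismD[OF psi]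
    have sh: "star (\<psi> h) = \<psi> h" using D(5)[of h] h by simp
    interpret H: commutative_cstar "commutant (commutant {h})"
      by (rule commutative_cstar_selfadjoint[OF h])
    interpret P: commutative_cstar "commutant (commutant {\<psi> h})"
      by (rule commutative_cstar_selfadjoint[OF sh])
    \<comment> \<open>Surjectivity of \<open>\<psi>\<close> is what makes every element commuting
      with \<open>\<psi> h\<close> an image of one commuting with \<open>h\<close>.\<close>
    have maps: "\<psi> y \<in> commutant (commutant {\<psi> h})" if y: "y \<in> commutant (commutant {h})" for y
      unfolding commutant_def[of "commutant {\<psi> h}"]
    proof (intro CollectI ballI)
      fix z assume z: "z \<in> commutant {\<psi> h}"
      obtain z' where z': "z = \<psi> z'" using D(1) by (metis bij_pointE)
      have "\<psi> (h * z') = \<psi> (z' * h)" using z by (simp add: z' D commutant_def)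
      then have "h * z' = z' * h" using D(1) by (simp add: bij_is_inj inj_eq)
      then have "z' * y = y * z'" using y by (simp add: commutant_def)
      then show "z * \<psi> y = \<psi> y * z" by (metis D(3) z')
    qed
    obtain w where w: "w \<in> P.Spec" "cmod (w (\<psi> h)) = norm (\<psi> h)"
      using P.norming_character[OF selfadjoint_mem] by blast
    define v where "v = restrict (w \<circ> \<psi>) (commutant (commutant {h}))"
    have "v 1 = 1"
      using P.char_one[OF w(1)] by (simp add: v_def H.one_mem star_automorphism_one[OF psi])
    then have "v \<in> H.Spec"
      unfolding characters_type_cstar using H.one_mem
      by (auto simp: v_def H.mem D P.char_add[OF w(1)] P.char_mult[OF w(1)] P.char_scaleC[OF w(1)] maps
          intro!: bexI[of _ 1])
    then have "cmod (v h) \<le> norm h" using H.char_le_norm selfadjoint_mem by blast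
    then show ?thesis using w(2) by (simp add: v_def selfadjoint_mem)
  qed
  have le: "norm (\<psi> x) \<le> norm x" if psi: "star_automorphism \<psi>" for \<psi> and x :: 'a
  proof -
    have "(norm (\<psi> x))\<^sup>2 = norm (\<psi> (star x * x))"
      by (simp add: star_automorphismD[OF psi] norm_star_mult_self)
    also have "\<dots> \<le> norm (star x * x)"
      by (rule sa[OF psi]) (simp add: star_mult star_star)
    finally have "(norm (\<psi> x))\<^sup>2 \<le> (norm x)\<^sup>2" by (simp add: norm_star_mult_self)
    then show ?thesis by (rule power2_le_imp_le) simp
  qed
  have "inv_into UNIV \<phi> (\<phi> x) = x" using star_automorphismD(1)[OF assms] by (simp add: bij_is_inj)
  then show ?thesis
    using le[OF assms, of x] le[OF star_automorphism_inv[OF assms], of "\<phi> x"] by simp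
qed

section \<open>Maximal abelian subalgebras\<close>

lemma type_cstar_minus: "a_minus type_cstar x y = x - y"
proof -
  have "a_inv type_cstar y = - y"
    unfolding a_inv_def m_inv_def type_cstar_def
    by (rule the_equality) (auto simp: eq_neg_iff_add_eq_0)
  then show ?thesis by (simp add: a_minus_def) (simp add: type_cstar_def)
qed

lemma sub_cstar_algebra_type_cstar:
  "sub_cstar_algebra type_cstar D \<longleftrightarrow>
     0 \<in> D \<and> (\<forall>x\<in>D. \<forall>y\<in>D. x + y \<in> D \<and> x * y \<in> D) \<and>
     (\<forall>x\<in>D. (\<forall>c. scaleC c x \<in> D) \<and> star x \<in> D) \<and> closed D"
proof -
  have "(\<forall>f l. (\<forall>n::nat. f n \<in> D) \<and> (\<lambda>n. norm (f n - l)) \<longlonglongrightarrow> 0 \<longrightarrow> l \<in> D) \<longleftrightarrow> closed D"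
    unfolding closed_sequential_limits tendsto_norm_zero_iff LIM_zero_iff by blast
  moreover have "\<zero>\<^bsub>type_cstar\<^esub> = (0::'a)" "x \<oplus>\<^bsub>type_cstar\<^esub> y = x + y" "x \<otimes>\<^bsub>type_cstar\<^esub> y = x * y"
    "cscale type_cstar c x = scaleC c x" "cstar type_cstar x = star x" "cnorm type_cstar x = norm x"
    "carrier type_cstar = (UNIV :: 'a set)" for x y :: 'a and c
    by (simp_all add: type_cstar_def)
  ultimately show ?thesis
    unfolding sub_cstar_algebra_def type_cstar_minus by simp
qed

text \<open>For self-adjoint \<open>h\<close> commuting with \<open>B\<close>, the bicommutant of
  \<open>insert h B\<close> is an abelian C*-algebra above \<open>B\<close>, so maximality puts
  \<open>h\<close> into \<open>B\<close>. Real and imaginary parts reduce the general case to this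
  one; in particular \<open>B\<close> contains the unit.\<close>

lemma masa_commutant:
  assumes "masa type_cstar B"
  shows "commutative_cstar B" "commutant B = B"
proof -
  have sub: "sub_cstar_algebra type_cstar B" and comm: "\<And>x y. x \<in> B \<Longrightarrow> y \<in> B \<Longrightarrow> x * y = y * x"
    and max: "\<And>D. sub_cstar_algebra type_cstar D \<Longrightarrow> abelian_subset type_cstar D \<Longrightarrow> B \<subseteq> D \<Longrightarrow> D = B"
    using assms by (auto simp: masa_def abelian_subset_def type_cstar_def)
  note B = sub[unfolded sub_cstar_algebra_type_cstar]
  have sa: "h \<in> B" if h: "star h = h" "h \<in> commutant B" for h
  proof -
    let ?S = "insert h B"
    interpret S: commutative_cstar "commutant (commutant ?S)"
      using B h comm by (intro commutative_cstar_bicommutant) (auto simp: commutant_def)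
    have "commutant (commutant ?S) = B"
    proof (rule max)
      show "sub_cstar_algebra type_cstar (commutant (commutant ?S))"
        unfolding sub_cstar_algebra_type_cstar by (auto simp: S.mem S.closed_mem)
      show "abelian_subset type_cstar (commutant (commutant ?S))"
        using S.comm by (auto simp: abelian_subset_def type_cstar_def)
      show "B \<subseteq> commutant (commutant ?S)" using subset_bicommutant[of ?S] by auto
    qed
    then show ?thesis using subset_bicommutant[of ?S] by auto
  qed
  have "commutant B \<subseteq> B"
  proof
    fix y assume y: "y \<in> commutant B"
    have y': "star y \<in> commutant B" using y B by (intro star_commutant) auto
    have a: "y + star y \<in> B"
      using y y' by (intro sa) (auto simp: star_add star_star add.commute commutant_def algebra_simps)
    have "star (scaleC \<i> (star y - y)) = scaleC (- \<i>) (y - star y)"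
      by (simp add: star_scaleC star_diff star_star)
    also have "\<dots> = scaleC \<i> (star y - y)"
      by (simp add: scaleC_cconst cconst_minus right_diff_distrib)
    finally have b: "scaleC \<i> (star y - y) \<in> B"
      using y y' by (intro sa)
        (auto simp: commutant_def mult_scaleC_left mult_scaleC_right algebra_simps)
    have "scaleC (1/2) (y + star y) + scaleC (\<i>/2) (scaleC \<i> (star y - y)) \<in> B"
      using a b B by blast
    also have "scaleC (1/2) (y + star y) + scaleC (\<i>/2) (scaleC \<i> (star y - y)) = y"
    proof -
      have "scaleC (\<i>/2) (scaleC \<i> (star y - y)) = scaleC (1/2) (y - star y)"
        using scaleC_scaleC[of "1/2" "-1" "star y - y"] by (simp add: scaleC_scaleC scaleC_minus_one)
      then have "scaleC (1/2) (y + star y) + scaleC (\<i>/2) (scaleC \<i> (star y - y))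
          = scaleC (1/2) (y + y)"
        by (simp add: scaleC_add_right [symmetric])
      also have "\<dots> = y" by (simp add: scaleC_add_right) (simp add: scaleC_add_left [symmetric])
      finally show ?thesis .
    qed
    finally show "y \<in> B" .
  qed
  moreover have "B \<subseteq> commutant B" using comm by (auto simp: commutant_def)
  ultimately show "commutant B = B" by blast
  then have "1 \<in> B" by (auto simp: commutant_def)
  then show "commutative_cstar B" using B comm by unfold_locales auto
qed

section \<open>Crossed products by finite groups\<close>

locale finite_action = group G for G :: "('g, 'm) monoid_scheme" (structure) +
  fixes \<alpha> :: "'g \<Rightarrow> 'a::unital_cstar_algebra \<Rightarrow> 'a"
  assumes fin: "finite (carrier G)" and action: "cstar_action G \<alpha>"
begin

abbreviation CP :: "('g \<Rightarrow> 'a) cstar_struct" where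
  "CP \<equiv> crossed_product G \<alpha>"

abbreviation embed :: "'a \<Rightarrow> 'g \<Rightarrow> 'a" where
  "embed \<equiv> crossed_product_embed G"

lemma aut: "g \<in> carrier G \<Longrightarrow> star_automorphism (\<alpha> g)"
  using action by (simp add: cstar_action_def)

lemma act_mult: "g \<in> carrier G \<Longrightarrow> h \<in> carrier G \<Longrightarrow> \<alpha> (g \<otimes> h) x = \<alpha> g (\<alpha> h x)"
  using action by (simp add: cstar_action_def)

lemma act_one: "\<alpha> \<one> x = x"
proof -
  have "\<alpha> \<one> (\<alpha> \<one> x) = \<alpha> \<one> x" using act_mult[of \<one> \<one> x] by simp
  then show ?thesis
    using star_automorphismD(1)[OF aut[OF one_closed]] by (simp add: bij_is_inj inj_eq)
qed

lemma act_inv: "g \<in> carrier G \<Longrightarrow> \<alpha> g (\<alpha> (inv g) x) = x"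
  and act_inv': "g \<in> carrier G \<Longrightarrow> \<alpha> (inv g) (\<alpha> g x) = x"
  using act_mult[of g "inv g" x] act_mult[of "inv g" g x] by (simp_all add: act_one)

lemmas act_simps = star_automorphismD(2-5)[OF aut] star_automorphism_one[OF aut]
  star_automorphism_zero[OF aut] star_automorphism_norm[OF aut]

lemma CP_carrier: "f \<in> carrier CP \<longleftrightarrow> (\<forall>g. g \<notin> carrier G \<longrightarrow> f g = 0)"
  by (simp add: crossed_product_def)

lemma CP_zero: "\<zero>\<^bsub>CP\<^esub> = (\<lambda>_. 0)"
  by (simp add: crossed_product_def)

lemma CP_add: "f \<oplus>\<^bsub>CP\<^esub> f' = (\<lambda>g. f g + f' g)"
  by (simp add: crossed_product_def)

lemma CP_mult: "f \<otimes>\<^bsub>CP\<^esub> f' =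
    (\<lambda>g. if g \<in> carrier G then \<Sum>h\<in>carrier G. f h * \<alpha> h (f' (inv h \<otimes> g)) else 0)"
  by (simp add: crossed_product_def)

lemma CP_scale: "cscale CP c f = (\<lambda>g. scaleC c (f g))"
  by (simp add: crossed_product_def)

lemma CP_star: "cstar CP f = (\<lambda>g. if g \<in> carrier G then \<alpha> g (star (f (inv g))) else 0)"
  by (simp add: crossed_product_def)

lemma CP_norm: "cnorm CP f =
    Sup ((\<lambda>\<xi>. hilbert_module_norm G (regular_rep G \<alpha> f \<xi>)) ` {\<xi>. hilbert_module_norm G \<xi> \<le> 1})"
  by (simp add: crossed_product_def) (rule arg_cong[of _ _ Sup], blast)

lemma CP_minus:
  assumes "l \<in> carrier CP"
  shows "f \<ominus>\<^bsub>CP\<^esub> l = (\<lambda>g. f g - l g)"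
proof -
  have "\<ominus>\<^bsub>CP\<^esub> l = (\<lambda>g. - l g)"
    unfolding a_inv_def m_inv_def
  proof (rule the_equality)
    fix y assume "y \<in> carrier (add_monoid CP) \<and> l \<otimes>\<^bsub>add_monoid CP\<^esub> y = \<one>\<^bsub>add_monoid CP\<^esub> \<and>
      y \<otimes>\<^bsub>add_monoid CP\<^esub> l = \<one>\<^bsub>add_monoid CP\<^esub>"
    then have "l g + y g = 0" for g by (simp add: CP_add CP_zero fun_eq_iff)
    then show "y = (\<lambda>g. - l g)" by (auto simp: fun_eq_iff eq_neg_iff_add_eq_0 add.commute)
  qed (use assms in \<open>auto simp: CP_carrier CP_add CP_zero\<close>)
  then show ?thesis by (simp add: a_minus_def CP_add)
qed

section \<open>The norm of the crossed product and convergence of coefficients\<close>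

lemma norm_le_hilbert_module_norm:
  "g \<in> carrier G \<Longrightarrow> norm (\<xi> g) \<le> hilbert_module_norm G \<xi>"
  unfolding hilbert_module_norm_def
  using norm_le_norm_sum_star_mult[OF fin, of g \<xi>] by (rule real_le_rsqrt)

lemma hilbert_module_norm_le: "hilbert_module_norm G \<xi> \<le> (\<Sum>g\<in>carrier G. norm (\<xi> g))"
proof -
  have "norm (\<Sum>g\<in>carrier G. star (\<xi> g) * \<xi> g) \<le> (\<Sum>g\<in>carrier G. (norm (\<xi> g))\<^sup>2)"
    by (rule sum_norm_le) (simp add: norm_star_mult_self)
  then have "hilbert_module_norm G \<xi> \<le> L2_set (\<lambda>g. norm (\<xi> g)) (carrier G)"
    by (simp add: hilbert_module_norm_def L2_set_def)
  also have "\<dots> \<le> (\<Sum>g\<in>carrier G. norm (\<xi> g))" by (rule L2_set_le_sum) simp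
  finally show ?thesis .
qed

lemma regular_rep_norm_le:
  assumes xi: "hilbert_module_norm G \<xi> \<le> 1"
  shows "hilbert_module_norm G (regular_rep G \<alpha> f \<xi>)
    \<le> real (card (carrier G)) * (\<Sum>h\<in>carrier G. norm (f h))"
proof -
  have "norm (regular_rep G \<alpha> f \<xi> g) \<le> (\<Sum>h\<in>carrier G. norm (f h))" if g: "g \<in> carrier G" for g
    unfolding regular_rep_def
  proof (rule sum_norm_le)
    fix h assume h: "h \<in> carrier G"
    have "norm (\<alpha> (inv g) (f h) * \<xi> (inv h \<otimes> g)) \<le> norm (\<alpha> (inv g) (f h)) * norm (\<xi> (inv h \<otimes> g))"
      by (rule norm_mult_ineq)
    also have "\<dots> \<le> norm (f h) * 1"
      using norm_le_hilbert_module_norm[of "inv h \<otimes> g" \<xi>] xi g h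
      by (intro mult_mono) (auto simp: act_simps)
    finally show "norm (\<alpha> (inv g) (f h) * \<xi> (inv h \<otimes> g)) \<le> norm (f h)" by simp
  qed
  then have "(\<Sum>g\<in>carrier G. norm (regular_rep G \<alpha> f \<xi> g))
      \<le> real (card (carrier G)) * (\<Sum>h\<in>carrier G. norm (f h))"
    by (intro sum_bounded_above)
  then show ?thesis using hilbert_module_norm_le[of "regular_rep G \<alpha> f \<xi>"] by simp
qed

text \<open>Crude, but with \<open>norm_le_CP_norm\<close> it makes the operator norm equivalent to
  the sum of the coefficient norms, and convergence asks for no more.\<close>

lemma CP_norm_le: "cnorm CP f \<le> real (card (carrier G)) * (\<Sum>h\<in>carrier G. norm (f h))"
proof -
  have "hilbert_module_norm G (\<lambda>_. 0 :: 'a) \<le> 1" by (simp add: hilbert_module_norm_def)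
  then show ?thesis
    unfolding CP_norm using regular_rep_norm_le by (intro cSUP_least) auto
qed

text \<open>The unit vector supported at the neutral element is mapped by \<open>f\<close> to the
  vector with coordinates \<open>\<alpha> (inv g) (f g)\<close>, and automorphisms are
  isometric.\<close>

lemma norm_le_CP_norm:
  assumes g: "g \<in> carrier G"
  shows "norm (f g) \<le> cnorm CP f"
proof -
  define \<xi> :: "'g \<Rightarrow> 'a" where "\<xi> k = (if k = \<one> then 1 else 0)" for k
  have "star (\<xi> k) * \<xi> k = (if k = \<one> then 1 else 0)" for k
    by (simp add: \<xi>_def)
  then have xi: "hilbert_module_norm G \<xi> \<le> 1"
    using fin by (simp add: hilbert_module_norm_def)
  have "\<alpha> (inv g) (f h) * \<xi> (inv h \<otimes> g) = (if h = g then \<alpha> (inv g) (f g) else 0)"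
    if h: "h \<in> carrier G" for h
  proof -
    have "inv h \<otimes> g = \<one> \<longleftrightarrow> h = g"
      using g h by (metis inv_closed inv_inv inv_equality l_inv)
    then show ?thesis by (simp add: \<xi>_def)
  qed
  then have "regular_rep G \<alpha> f \<xi> g = \<alpha> (inv g) (f g)"
    using fin g by (simp add: regular_rep_def)
  then have "norm (f g) = norm (regular_rep G \<alpha> f \<xi> g)"
    using g by (simp add: act_simps)
  also have "\<dots> \<le> hilbert_module_norm G (regular_rep G \<alpha> f \<xi>)"
    by (rule norm_le_hilbert_module_norm[OF g])
  also have "\<dots> \<le> cnorm CP f"
    unfolding CP_norm using xi regular_rep_norm_le[of _ f]
    by (intro cSUP_upper bdd_aboveI2) auto
  finally show ?thesis .
qed

lemma CP_tendsto_iff: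
  assumes l: "l \<in> carrier CP"
  shows "(\<lambda>n. cnorm CP (F n \<ominus>\<^bsub>CP\<^esub> l)) \<longlonglongrightarrow> 0 \<longleftrightarrow> (\<forall>g\<in>carrier G. (\<lambda>n. F n g) \<longlonglongrightarrow> l g)"
    (is "?L \<longleftrightarrow> ?R")
proof
  assume L: ?L
  show ?R
  proof
    fix g assume g: "g \<in> carrier G"
    have le: "norm (F n g - l g) \<le> cnorm CP (F n \<ominus>\<^bsub>CP\<^esub> l)" for n
      using norm_le_CP_norm[OF g, of "F n \<ominus>\<^bsub>CP\<^esub> l"] by (simp add: CP_minus[OF l])
    show "(\<lambda>n. F n g) \<longlonglongrightarrow> l g"
      by (rule LIM_zero_cancel, rule Lim_null_comparison[OF always_eventually[OF allI[OF le]] L])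
  qed
next
  assume R: ?R
  have le: "norm (cnorm CP (F n \<ominus>\<^bsub>CP\<^esub> l))
      \<le> real (card (carrier G)) * (\<Sum>h\<in>carrier G. norm (F n h - l h))" for n
    using CP_norm_le[of "F n \<ominus>\<^bsub>CP\<^esub> l"] order_trans[OF norm_ge_zero norm_le_CP_norm[OF one_closed]]
    by (simp add: CP_minus[OF l])
  have "(\<lambda>n. \<Sum>h\<in>carrier G. norm (F n h - l h)) \<longlonglongrightarrow> (\<Sum>h\<in>carrier G. 0)"
    using R by (intro tendsto_sum tendsto_norm_zero LIM_zero) auto
  then have lim: "(\<lambda>n. real (card (carrier G)) * (\<Sum>h\<in>carrier G. norm (F n h - l h))) \<longlonglongrightarrow> 0"
    by (intro tendsto_mult_right_zero) simp
  show ?L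
    by (rule Lim_null_comparison[OF always_eventually[OF allI[OF le]] lim])
qed

lemma sub_cstar_algebra_CP:
  "sub_cstar_algebra CP D \<longleftrightarrow> D \<subseteq> carrier CP \<and> \<zero>\<^bsub>CP\<^esub> \<in> D \<and>
     (\<forall>x\<in>D. \<forall>y\<in>D. x \<oplus>\<^bsub>CP\<^esub> y \<in> D \<and> x \<otimes>\<^bsub>CP\<^esub> y \<in> D) \<and>
     (\<forall>x\<in>D. (\<forall>c. cscale CP c x \<in> D) \<and> cstar CP x \<in> D) \<and>
     (\<forall>F l. (\<forall>n::nat. F n \<in> D) \<and> l \<in> carrier CP \<and> (\<forall>g\<in>carrier G. (\<lambda>n. F n g) \<longlonglongrightarrow> l g) \<longrightarrow> l \<in> D)"
  unfolding sub_cstar_algebra_def using CP_tendsto_iff by auto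

section \<open>The copy of A inside the crossed product\<close>

lemma embed_apply: "embed a g = (if g = \<one> then a else 0)"
  by (simp add: crossed_product_embed_def)

lemma embed_carrier: "embed a \<in> carrier CP"
  by (auto simp: CP_carrier embed_apply)

lemma embed_mult_apply:
  assumes g: "g \<in> carrier G"
  shows "(embed a \<otimes>\<^bsub>CP\<^esub> f) g = a * f g"
proof -
  have "embed a h * \<alpha> h (f (inv h \<otimes> g)) = (if h = \<one> then a * f g else 0)" for h
    using g by (simp add: embed_apply act_one)
  then show ?thesis using g fin by (simp add: CP_mult)
qed

lemma mult_embed_apply:
  assumes g: "g \<in> carrier G"
  shows "(f \<otimes>\<^bsub>CP\<^esub> embed a) g = f g * \<alpha> g a"
proof -
  have "f h * \<alpha> h (embed a (inv h \<otimes> g)) = (if h = g then f g * \<alpha> g a else 0)" if h: "h \<in> carrier G" for h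
  proof -
    have "inv h \<otimes> g = \<one> \<longleftrightarrow> h = g"
      using g h by (metis inv_closed inv_inv inv_equality l_inv)
    then show ?thesis using h by (simp add: embed_apply act_simps)
  qed
  then show ?thesis using g fin by (simp add: CP_mult)
qed

lemma CP_eqI:
  assumes "f \<in> carrier CP" "f' \<in> carrier CP" "\<And>g. g \<in> carrier G \<Longrightarrow> f g = f' g"
  shows "f = f'"
proof (rule ext)
  show "f g = f' g" for g
    using assms(1,2) assms(3)[of g] by (cases "g \<in> carrier G") (simp_all add: CP_carrier)
qed

lemma CP_mult_carrier: "f \<otimes>\<^bsub>CP\<^esub> f' \<in> carrier CP"
  by (simp add: CP_carrier CP_mult)

lemma CP_star_carrier: "cstar CP f \<in> carrier CP"
  by (simp add: CP_carrier CP_star)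

lemma embed_mult: "embed a \<otimes>\<^bsub>CP\<^esub> embed b = embed (a * b)"
  by (rule CP_eqI) (auto simp: CP_mult_carrier embed_carrier embed_mult_apply embed_apply)

lemma embed_star: "cstar CP (embed a) = embed (star a)"
  by (rule CP_eqI[OF CP_star_carrier embed_carrier])
     (auto simp: CP_star embed_apply act_one act_simps)

lemma embed_add: "embed a \<oplus>\<^bsub>CP\<^esub> embed b = embed (a + b)"
  by (auto simp: CP_add embed_apply)

lemma embed_scale: "cscale CP c (embed a) = embed (scaleC c a)"
  by (rule ext) (simp add: CP_scale embed_apply scaleC_cconst)

lemma sub_cstar_algebra_embed:
  assumes "sub_cstar_algebra type_cstar B"
  shows "sub_cstar_algebra CP (embed ` B)"
proof -
  note B = assms[unfolded sub_cstar_algebra_type_cstar]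
  have lim: "l \<in> embed ` B" if F: "\<And>n. F n \<in> embed ` B" and l: "l \<in> carrier CP"
    and conv: "\<And>g. g \<in> carrier G \<Longrightarrow> (\<lambda>n. F n g) \<longlonglongrightarrow> l g" for F :: "nat \<Rightarrow> 'g \<Rightarrow> 'a" and l
  proof -
    define b where "b n = F n \<one>" for n
    have b: "b n \<in> B" "F n = embed (b n)" for n
      using F[of n] by (auto simp: b_def embed_apply)
    have "b \<longlonglongrightarrow> l \<one>" using conv[OF one_closed] by (simp add: b(2) embed_apply)
    then have "l \<one> \<in> B" using closed_sequentially[of B b "l \<one>"] B b(1) by simp
    moreover have "l = embed (l \<one>)"
    proof (rule CP_eqI[OF l embed_carrier])
      fix g assume g: "g \<in> carrier G"
      show "l g = embed (l \<one>) g"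
      proof (cases "g = \<one>")
        case False
        then have "(\<lambda>n. F n g) = (\<lambda>n. 0)" by (simp add: b(2) embed_apply)
        then show ?thesis using conv[OF g] False by (simp add: embed_apply LIMSEQ_const_iff)
      qed (simp add: embed_apply)
    qed
    ultimately show ?thesis by blast
  qed
  have zero: "\<zero>\<^bsub>CP\<^esub> = embed 0" by (auto simp: CP_zero embed_apply)
  show ?thesis
    unfolding sub_cstar_algebra_CP
  proof (intro conjI ballI allI impI)
    show "embed ` B \<subseteq> carrier CP" using embed_carrier by blast
    show "\<zero>\<^bsub>CP\<^esub> \<in> embed ` B" unfolding zero using B by blast
  next
    fix x y assume "x \<in> embed ` B" "y \<in> embed ` B"
    then obtain a b where ab: "a \<in> B" "b \<in> B" "x = embed a" "y = embed b" by blast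
    show "x \<oplus>\<^bsub>CP\<^esub> y \<in> embed ` B" unfolding ab embed_add using ab B by blast
    show "x \<otimes>\<^bsub>CP\<^esub> y \<in> embed ` B" unfolding ab embed_mult using ab B by blast
  next
    fix x c assume "x \<in> embed ` B"
    then obtain a where a: "a \<in> B" "x = embed a" by blast
    show "cscale CP c x \<in> embed ` B" unfolding a embed_scale using a B by blast
  next
    fix x assume "x \<in> embed ` B"
    then obtain a where a: "a \<in> B" "x = embed a" by blast
    show "cstar CP x \<in> embed ` B" unfolding a embed_star using a B by blast
  next
    fix F :: "nat \<Rightarrow> 'g \<Rightarrow> 'a" and l
    assume F: "(\<forall>n. F n \<in> embed ` B) \<and> l \<in> carrier CP \<and> (\<forall>g\<in>carrier G. (\<lambda>n. F n g) \<longlonglongrightarrow> l g)"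
    show "l \<in> embed ` B"
    proof (rule lim)
      show "F n \<in> embed ` B" for n using F by (elim conjE) (rule spec)
      show "l \<in> carrier CP" using F by (elim conjE)
      show "(\<lambda>n. F n g) \<longlonglongrightarrow> l g" if "g \<in> carrier G" for g using F that by (elim conjE) (rule bspec)
    qed
  qed
qed

text \<open>
  Comparing coefficients at \<open>g\<close> in \<open>b f = f b\<close>, for a witness \<open>f\<close> against maximality, gives an
  intertwiner between the identity and \<open>\<alpha> g\<close>.
\<close>

lemma not_masa_intertwiner:
  assumes B: "masa type_cstar B" and not_masa: "\<not> masa CP (embed ` B)"
  obtains g a where "g \<in> carrier G" "g \<noteq> \<one>" "a \<noteq> 0" "\<And>b. b \<in> B \<Longrightarrow> b * a = a * \<alpha> g b"
proof -
  have sub: "sub_cstar_algebra CP (embed ` B)"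
    using B by (intro sub_cstar_algebra_embed) (simp add: masa_def)
  have "abelian_subset CP (embed ` B)"
    using commutative_cstar.comm[OF masa_commutant(1)[OF B]]
    by (auto simp: abelian_subset_def embed_mult)
  then obtain D where D: "sub_cstar_algebra CP D" "abelian_subset CP D" "embed ` B \<subseteq> D" "D \<noteq> embed ` B"
    using not_masa sub unfolding masa_def by blast
  then obtain f where f: "f \<in> D" "f \<notin> embed ` B" by blast
  have fC: "f \<in> carrier CP" using D(1) f(1) by (auto simp: sub_cstar_algebra_def)
  have comm: "b * f g = f g * \<alpha> g b" if "b \<in> B" "g \<in> carrier G" for b g
  proof -
    have "embed b \<otimes>\<^bsub>CP\<^esub> f = f \<otimes>\<^bsub>CP\<^esub> embed b"
      using D f that by (auto simp: abelian_subset_def)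
    then show ?thesis using that embed_mult_apply mult_embed_apply by metis
  qed
  \<comment> \<open>Otherwise \<open>f\<close> would be the copy of an element of the commutant of
    \<open>B\<close>, which is \<open>B\<close>.\<close>
  have "\<exists>g\<in>carrier G. g \<noteq> \<one> \<and> f g \<noteq> 0"
  proof (rule ccontr)
    assume "\<not> ?thesis"
    then have "f = embed (f \<one>)"
      by (intro CP_eqI fC embed_carrier) (auto simp: embed_apply)
    moreover have "f \<one> \<in> commutant B"
      using comm[OF _ one_closed] by (simp add: commutant_def act_one)
    ultimately show False using f masa_commutant(2)[OF B] by auto
  qed
  then show thesis using comm that by blast
qed

end

section \<open>Consequences of a cocycle whose perturbed action fixes B\<close>

locale inner_fixing_action = finite_action G \<alpha> for G :: "('g, 'm) monoid_scheme" (structure)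
    and \<alpha> :: "'g \<Rightarrow> 'a::unital_cstar_algebra \<Rightarrow> 'a" +
  fixes B :: "'a set" and u :: "'g \<Rightarrow> 'a"
  assumes masa: "masa type_cstar B" and cocycle: "action_cocycle G \<alpha> u"
    and fixes_B: "\<And>g b. g \<in> carrier G \<Longrightarrow> b \<in> B \<Longrightarrow> perturbed_action \<alpha> u g b = b"
begin

sublocale B: commutative_cstar B
  by (rule masa_commutant(1)[OF masa])

lemma unitary_u: "g \<in> carrier G \<Longrightarrow> star (u g) * u g = 1" "g \<in> carrier G \<Longrightarrow> u g * star (u g) = 1"
  using cocycle by (auto simp: action_cocycle_def unitary_def)

lemma u_mult: "g \<in> carrier G \<Longrightarrow> h \<in> carrier G \<Longrightarrow> u (g \<otimes> h) = u g * \<alpha> g (u h)"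
  using cocycle by (simp add: action_cocycle_def)

lemma u_one: "u \<one> = 1"
proof -
  have "u \<one> = u \<one> * u \<one>" using u_mult[of \<one> \<one>] by (simp add: act_one)
  then have "star (u \<one>) * u \<one> = star (u \<one>) * u \<one> * u \<one>" by (simp add: mult.assoc)
  then show ?thesis by (simp add: unitary_u)
qed

lemma u_act:
  assumes g: "g \<in> carrier G" and b: "b \<in> B"
  shows "u g * \<alpha> g b = b * u g"
proof -
  have "b * u g = perturbed_action \<alpha> u g b * u g" using fixes_B[OF g b] by simp
  also have "\<dots> = u g * \<alpha> g b * (star (u g) * u g)"
    by (simp add: perturbed_action_def mult.assoc)
  finally show ?thesis using g by (simp add: unitary_u)
qed

text \<open>The cocycle identity at \<open>g\<close> and \<open>inv g\<close>. In the crossed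
  product it says that \<open>u g * U g\<close> is the adjoint of the corresponding unitary for
  \<open>inv g\<close>.\<close>

lemma act_star_u: "g \<in> carrier G \<Longrightarrow> \<alpha> g (star (u (inv g))) = u g"
proof -
  assume g: "g \<in> carrier G"
  have "u g * \<alpha> g (u (inv g)) = 1" using u_mult[of g "inv g"] g by (simp add: u_one)
  then have "star (u g) * (u g * \<alpha> g (u (inv g))) = star (u g)" by simp
  then have "\<alpha> g (u (inv g)) = star (u g)" using g by (simp add: mult.assoc [symmetric] unitary_u)
  then have "star (\<alpha> g (u (inv g))) = u g" by (simp add: star_star)
  then show ?thesis using g by (simp add: act_simps)
qed

text \<open>The unitaries \<open>u g * U g\<close> of the crossed product represent \<open>G\<close> and commute with \<open>B\<close>; this is
  the commutative algebra they generate together with \<open>B\<close>.\<close>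

definition extension :: "('g \<Rightarrow> 'a) set" where
  "extension = {f \<in> carrier CP. \<forall>g\<in>carrier G. \<exists>b\<in>B. f g = b * u g}"

text \<open>The coefficient with respect to \<open>u g * U g\<close> instead of \<open>U g\<close>.
  Being continuous in \<open>f\<close>, it also yields closedness of
  \<open>extension\<close>.\<close>

definition coeff :: "('g \<Rightarrow> 'a) \<Rightarrow> 'g \<Rightarrow> 'a" where
  "coeff f g = f g * star (u g)"

lemma coeff:
  assumes "f \<in> extension" "g \<in> carrier G"
  shows "coeff f g \<in> B" "f g = coeff f g * u g"
proof -
  obtain b where b: "b \<in> B" "f g = b * u g" using assms by (auto simp: extension_def)
  then have "coeff f g = b" using unitary_u[OF assms(2)] by (simp add: coeff_def mult.assoc)
  then show "coeff f g \<in> B" "f g = coeff f g * u g" using b by auto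
qed

text \<open>In these coefficients the twisted convolution becomes the ordinary convolution of
  \<open>B\<close>-valued functions: \<open>u h\<close> carries \<open>\<alpha> h b\<close> to
  \<open>b\<close>, and the remaining unitaries multiply by the cocycle identity.\<close>

lemma extension_mult_apply:
  assumes f: "f \<in> extension" "f' \<in> extension" and g: "g \<in> carrier G"
  shows "(f \<otimes>\<^bsub>CP\<^esub> f') g = (\<Sum>h\<in>carrier G. coeff f h * coeff f' (inv h \<otimes> g)) * u g"
proof -
  have "f h * \<alpha> h (f' (inv h \<otimes> g)) = coeff f h * coeff f' (inv h \<otimes> g) * u g"
    if h: "h \<in> carrier G" for h
  proof -
    have k: "inv h \<otimes> g \<in> carrier G" using g h by simp
    have "f h * \<alpha> h (f' (inv h \<otimes> g))
        = coeff f h * (u h * \<alpha> h (coeff f' (inv h \<otimes> g))) * \<alpha> h (u (inv h \<otimes> g))"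
      using h coeff(2)[OF f(1) h] coeff(2)[OF f(2) k] by (simp add: act_simps mult.assoc)
    also have "\<dots> = coeff f h * coeff f' (inv h \<otimes> g) * (u h * \<alpha> h (u (inv h \<otimes> g)))"
      using u_act[OF h coeff(1)[OF f(2) k]] by (simp add: mult.assoc)
    also have "u h * \<alpha> h (u (inv h \<otimes> g)) = u g"
      using u_mult[OF h k] g h by (simp add: m_assoc [symmetric])
    finally show ?thesis .
  qed
  then show ?thesis using g by (simp add: CP_mult sum_distrib_right)
qed

lemma B_sum: "(\<And>i. i \<in> I \<Longrightarrow> f i \<in> B) \<Longrightarrow> sum f I \<in> B"
  by (induction I rule: infinite_finite_induct) (auto simp: B.mem)

lemma sub_cstar_algebra_extension: "sub_cstar_algebra CP extension"
  unfolding sub_cstar_algebra_CP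
proof (intro conjI ballI allI impI)
  show "extension \<subseteq> carrier CP" by (auto simp: extension_def)
  show "\<zero>\<^bsub>CP\<^esub> \<in> extension"
    using B.zero_mem by (auto simp: extension_def CP_zero CP_carrier intro!: bexI[of _ 0])
next
  fix x y assume xy: "x \<in> extension" "y \<in> extension"
  have "\<exists>b\<in>B. x g + y g = b * u g" if g: "g \<in> carrier G" for g
    using coeff[OF xy(1) g] coeff[OF xy(2) g]
    by (intro bexI[of _ "coeff x g + coeff y g"]) (auto simp: distrib_right B.mem)
  then show "x \<oplus>\<^bsub>CP\<^esub> y \<in> extension"
    using xy by (simp add: extension_def CP_add CP_carrier)
  have "\<exists>b\<in>B. (x \<otimes>\<^bsub>CP\<^esub> y) g = b * u g" if g: "g \<in> carrier G" for g
    using extension_mult_apply[OF xy g]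
  proof (rule bexI)
    show "(\<Sum>h\<in>carrier G. coeff x h * coeff y (inv h \<otimes> g)) \<in> B"
      using g xy by (intro B_sum B.mult_mem coeff) auto
  qed
  then show "x \<otimes>\<^bsub>CP\<^esub> y \<in> extension"
    by (simp add: extension_def CP_mult_carrier)
next
  fix x c assume x: "x \<in> extension"
  have "\<exists>b\<in>B. scaleC c (x g) = b * u g" if g: "g \<in> carrier G" for g
    using coeff[OF x g]
    by (intro bexI[of _ "scaleC c (coeff x g)"]) (auto simp: mult_scaleC_left B.mem)
  then show "cscale CP c x \<in> extension"
    using x by (simp add: extension_def CP_scale CP_carrier scaleC_cconst)
next
  fix x assume x: "x \<in> extension"
  have "\<exists>b\<in>B. \<alpha> g (star (x (inv g))) = b * u g" if g: "g \<in> carrier G" for g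
  proof
    let ?b = "star (coeff x (inv g))"
    show b: "?b \<in> B" using coeff(1)[OF x] g by (simp add: B.mem)
    have "\<alpha> g (star (x (inv g))) = \<alpha> g (star (u (inv g))) * \<alpha> g ?b"
      using coeff(2)[OF x, of "inv g"] g by (simp add: star_mult act_simps)
    also have "\<dots> = ?b * u g" using act_star_u[OF g] u_act[OF g b] by simp
    finally show "\<alpha> g (star (x (inv g))) = ?b * u g" .
  qed
  then show "cstar CP x \<in> extension"
    by (simp add: extension_def CP_star_carrier) (simp add: CP_star)
next
  fix F :: "nat \<Rightarrow> 'g \<Rightarrow> 'a" and l
  assume F: "(\<forall>n. F n \<in> extension) \<and> l \<in> carrier CP \<and> (\<forall>g\<in>carrier G. (\<lambda>n. F n g) \<longlonglongrightarrow> l g)"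
  have "\<exists>b\<in>B. l g = b * u g" if g: "g \<in> carrier G" for g
  proof
    have "(\<lambda>n. coeff (F n) g) \<longlonglongrightarrow> coeff l g"
      unfolding coeff_def using F g by (intro tendsto_intros) auto
    then show "coeff l g \<in> B"
      using closed_sequentially[OF B.closed_mem, of "\<lambda>n. coeff (F n) g"] coeff(1) F g by auto
    show "l g = coeff l g * u g" using unitary_u[OF g] by (simp add: coeff_def mult.assoc)
  qed
  then show "l \<in> extension" using F by (simp add: extension_def)
qed

text \<open>For an abelian group the substitution of \<open>inv h \<otimes> g\<close> for
  \<open>h\<close> is an involution, and it exchanges the two factors of the convolution.\<close>

lemma abelian_extension:
  assumes "comm_group G"
  shows "abelian_subset CP extension"
  unfolding abelian_subset_def
proof (intro ballI)
  interpret comm_group G by fact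
  fix x y assume xy: "x \<in> extension" "y \<in> extension"
  show "x \<otimes>\<^bsub>CP\<^esub> y = y \<otimes>\<^bsub>CP\<^esub> x"
  proof (rule CP_eqI[OF CP_mult_carrier CP_mult_carrier])
    fix g assume g: "g \<in> carrier G"
    have "(\<Sum>h\<in>carrier G. coeff x h * coeff y (inv h \<otimes> g))
        = (\<Sum>h\<in>carrier G. coeff y h * coeff x (inv h \<otimes> g))"
    proof (rule sum.reindex_bij_witness[of _ "\<lambda>h. inv h \<otimes> g" "\<lambda>h. inv h \<otimes> g"])
      fix h assume h: "h \<in> carrier G"
      have eq: "inv (inv h \<otimes> g) \<otimes> g = h"
      proof -
        have "inv (inv h \<otimes> g) = h \<otimes> inv g" using g h by (simp add: inv_mult_group m_comm)
        then show ?thesis using g h by (simp add: m_assoc)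
      qed
      show "inv (inv h \<otimes> g) \<otimes> g = h" "inv (inv h \<otimes> g) \<otimes> g = h" by (fact eq)+
      show "inv h \<otimes> g \<in> carrier G" "inv h \<otimes> g \<in> carrier G" using g h by auto
      show "coeff y (inv h \<otimes> g) * coeff x (inv (inv h \<otimes> g) \<otimes> g) = coeff x h * coeff y (inv h \<otimes> g)"
        unfolding eq using g h xy by (intro B.comm coeff) auto
    qed
    then show "(x \<otimes>\<^bsub>CP\<^esub> y) g = (y \<otimes>\<^bsub>CP\<^esub> x) g"
      by (simp add: extension_mult_apply[OF xy g] extension_mult_apply[OF xy(2,1) g])
  qed
qed

text \<open>The unitary \<open>u g * U g\<close> of the crossed product as a function on the
  group.\<close>

definition implementer :: "'g \<Rightarrow> 'g \<Rightarrow> 'a" where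
  "implementer g k = (if k = g then u g else 0)"

lemma implementer_extension: "g \<in> carrier G \<Longrightarrow> implementer g \<in> extension"
  using B.one_mem B.zero_mem unfolding extension_def
  by (auto simp: CP_carrier implementer_def) (metis mult_1, metis mult_zero_left)

lemma embed_extension: "b \<in> B \<Longrightarrow> embed b \<in> extension"
  using B.zero_mem
  by (auto simp: extension_def embed_carrier embed_apply u_one intro!: bexI[of _ b] bexI[of _ 0])

lemma not_masa_embed:
  assumes "comm_group G" and g: "g \<in> carrier G" "g \<noteq> \<one>"
  shows "\<not> masa CP (embed ` B)"
proof
  assume "masa CP (embed ` B)"
  then have "extension = embed ` B"
    using sub_cstar_algebra_extension abelian_extension[OF assms(1)] embed_extension
    unfolding masa_def by blast
  then obtain b where "implementer g = embed b" using implementer_extension[OF g(1)] by blast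
  then have "u g = 0" using g by (simp add: implementer_def embed_apply fun_eq_iff) (metis g(2))
  then show False using unitary_u(1)[OF g(1)] by simp
qed

text \<open>Conjugation by \<open>u g * U g\<close> is the perturbed action, which is trivial on
  \<open>B\<close>; both products therefore return \<open>embed b\<close> itself.\<close>

lemma implementer_normalizer:
  assumes g: "g \<in> carrier G"
  shows "implementer g \<in> normalizers CP (embed ` B)"
proof -
  have star_apply: "cstar CP (implementer g) k = (if k = inv g then \<alpha> (inv g) (star (u g)) else 0)"
    if k: "k \<in> carrier G" for k
  proof -
    have "inv k = g \<longleftrightarrow> k = inv g" using g k by auto
    then show ?thesis using k g by (simp add: CP_star implementer_def act_simps)
  qed
  have inv_iff: "inv g \<otimes> m = inv g \<longleftrightarrow> m = \<one>" "g \<otimes> m = g \<longleftrightarrow> m = \<one>" if "m \<in> carrier G" for m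
    using g that by auto
  have 1: "implementer g \<otimes>\<^bsub>CP\<^esub> embed b \<otimes>\<^bsub>CP\<^esub> cstar CP (implementer g) = embed b" if b: "b \<in> B" for b
  proof (rule CP_eqI[OF CP_mult_carrier embed_carrier])
    fix m assume m: "m \<in> carrier G"
    have "(implementer g \<otimes>\<^bsub>CP\<^esub> embed b) h * \<alpha> h (cstar CP (implementer g) (inv h \<otimes> m))
        = (if h = g then embed b m else 0)" if h: "h \<in> carrier G" for h
    proof (cases "h = g")
      case True
      show ?thesis
        using g m b inv_iff[OF m] unitary_u(2)[OF g]
        by (simp add: True mult_embed_apply implementer_def u_act star_apply embed_apply act_inv mult.assoc act_simps)
    next
      case False
      then show ?thesis using h by (simp add: mult_embed_apply implementer_def)
    qed
    then show "(implementer g \<otimes>\<^bsub>CP\<^esub> embed b \<otimes>\<^bsub>CP\<^esub> cstar CP (implementer g)) m = embed b m"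
      using m g fin by (subst CP_mult) simp
  qed
  have 2: "cstar CP (implementer g) \<otimes>\<^bsub>CP\<^esub> embed b \<otimes>\<^bsub>CP\<^esub> implementer g = embed b" if b: "b \<in> B" for b
  proof (rule CP_eqI[OF CP_mult_carrier embed_carrier])
    fix m assume m: "m \<in> carrier G"
    have "(cstar CP (implementer g) \<otimes>\<^bsub>CP\<^esub> embed b) h * \<alpha> h (implementer g (inv h \<otimes> m))
        = (if h = inv g then embed b m else 0)" if h: "h \<in> carrier G" for h
    proof (cases "h = inv g")
      case True
      have "\<alpha> (inv g) (star (u g)) * \<alpha> (inv g) b * \<alpha> (inv g) (u g) = \<alpha> (inv g) (star (u g) * (b * u g))"
        using g by (simp add: act_simps mult.assoc)
      also have "\<dots> = \<alpha> (inv g) (star (u g) * u g * \<alpha> g b)"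
        using u_act[OF g b] by (simp add: mult.assoc)
      also have "\<dots> = b" using g by (simp add: unitary_u act_inv')
      finally show ?thesis
        using g m inv_iff[OF m]
        by (simp add: True mult_embed_apply implementer_def star_apply embed_apply act_simps)
    next
      case False
      then show ?thesis using h by (simp add: mult_embed_apply star_apply)
    qed
    then show "(cstar CP (implementer g) \<otimes>\<^bsub>CP\<^esub> embed b \<otimes>\<^bsub>CP\<^esub> implementer g) m = embed b m"
      using m g fin by (subst CP_mult) simp
  qed
  show ?thesis
    unfolding normalizers_def using 1 2 g by (auto simp: CP_carrier implementer_def)
qed

lemma embed_normalizer:
  assumes "n \<in> normalizers type_cstar B"
  shows "embed n \<in> normalizers CP (embed ` B)"
proof -
  have "n * b * star n \<in> B" "star n * b * n \<in> B" if "b \<in> B" for b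
    using assms that by (auto simp: normalizers_def type_cstar_def)
  then show ?thesis
    by (auto simp: normalizers_def embed_carrier embed_star embed_mult)
qed

text \<open>A C*-algebra \<open>D\<close> containing the normalizers pulls back along
  \<open>embed\<close> to a C*-algebra containing the normalizers in A, hence to all of A. Each
  \<open>f g * U g\<close> is then a product of an element of A with the implementer of
  \<open>g\<close>, and finite sums of these exhaust the crossed product.\<close>

lemma regular_embed:
  assumes reg: "regular type_cstar B"
  shows "regular CP (embed ` B)"
proof -
  have sub: "sub_cstar_algebra CP (embed ` B)"
    using reg by (intro sub_cstar_algebra_embed) (simp add: regular_def)
  have "D = carrier CP" if D: "sub_cstar_algebra CP D" "normalizers CP (embed ` B) \<subseteq> D" for D
  proof -
    note D' = D(1)[unfolded sub_cstar_algebra_CP]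
    define A where "A = {a. embed a \<in> D}"
    have "closed A"
      unfolding closed_sequential_limits
    proof (intro allI impI)
      fix f l assume f: "(\<forall>n::nat. f n \<in> A) \<and> f \<longlonglongrightarrow> l"
      have conv: "(\<lambda>n. embed (f n) g) \<longlonglongrightarrow> embed l g" for g
        using f by (cases "g = \<one>") (auto simp: embed_apply)
      have "\<forall>n. embed (f n) \<in> D" using f by (simp add: A_def)
      then have "embed l \<in> D"
        using D'[THEN conjunct2, THEN conjunct2, THEN conjunct2, THEN conjunct2, THEN spec, THEN spec, THEN mp,
            of "\<lambda>n. embed (f n)" "embed l"] conv embed_carrier[of l] by simp
      then show "l \<in> A" by (simp add: A_def)
    qed
    moreover have "embed 0 = \<zero>\<^bsub>CP\<^esub>" by (auto simp: CP_zero embed_apply)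
    ultimately have "sub_cstar_algebra type_cstar A"
      unfolding sub_cstar_algebra_type_cstar A_def using D'
      by (auto simp: embed_add [symmetric] embed_mult [symmetric] embed_star [symmetric]
          embed_scale [symmetric])
    moreover have "normalizers type_cstar B \<subseteq> A"
      using embed_normalizer D(2) by (auto simp: A_def)
    ultimately have "generated_cstar_algebra type_cstar (normalizers type_cstar B) \<subseteq> A"
      by (auto simp: generated_cstar_algebra_def)
    then have A: "embed a \<in> D" for a
      using reg by (auto simp: regular_def type_cstar_def A_def)
    have "f \<in> D" if f: "f \<in> carrier CP" for f
    proof -
      have part: "(\<lambda>k. if k = g then f g else 0) \<in> D" if g: "g \<in> carrier G" for g
      proof -
        have "embed (f g * star (u g)) \<otimes>\<^bsub>CP\<^esub> implementer g \<in> D"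
          using A implementer_normalizer[OF g] D(2) D' by blast
        also have "embed (f g * star (u g)) \<otimes>\<^bsub>CP\<^esub> implementer g = (\<lambda>k. if k = g then f g else 0)"
          using g by (intro CP_eqI[OF CP_mult_carrier])
            (auto simp: CP_carrier embed_mult_apply implementer_def mult.assoc unitary_u)
        finally show ?thesis .
      qed
      have "(\<lambda>k. if k \<in> S then f k else 0) \<in> D" if "S \<subseteq> carrier G" for S
        using finite_subset[OF that fin] that
      proof (induction S rule: finite_induct)
        case empty
        then show ?case using D' by (simp add: CP_zero)
      next
        case (insert g S)
        have "(\<lambda>k. if k = g then f g else 0) \<oplus>\<^bsub>CP\<^esub> (\<lambda>k. if k \<in> S then f k else 0) \<in> D"
          using insert part D' by auto
        also have "(\<lambda>k. if k = g then f g else 0) \<oplus>\<^bsub>CP\<^esub> (\<lambda>k. if k \<in> S then f k else 0)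
            = (\<lambda>k. if k \<in> insert g S then f k else 0)"
          using insert by (auto simp: CP_add)
        finally show ?case .
      qed
      from this[OF order_refl] have "(\<lambda>k. if k \<in> carrier G then f k else 0) \<in> D" .
      also have "(\<lambda>k. if k \<in> carrier G then f k else 0) = f"
        using f by (auto simp: CP_carrier)
      finally show ?thesis .
    qed
    then show ?thesis using D' by blast
  qed
  moreover have "sub_cstar_algebra CP (carrier CP)"
    unfolding sub_cstar_algebra_CP
    by (auto simp: CP_mult CP_star CP_carrier CP_add CP_zero CP_scale scaleC_cconst)
  moreover have "normalizers CP (embed ` B) \<subseteq> carrier CP" by (auto simp: normalizers_def)
  ultimately have "generated_cstar_algebra CP (normalizers CP (embed ` B)) = carrier CP"
    unfolding generated_cstar_algebra_def by blast
  then show ?thesis using sub by (simp add: regular_def)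
qed

end

section \<open>Unitary intertwiners\<close>

text \<open>Two points carry the proof: the right support of \<open>v\<close> has to be recognised
  as \<open>\<phi> e\<close>, and \<open>b * star s\<close> is rewritten as
  \<open>star s * (s * b * star s)\<close>, whose last factor lies in \<open>B\<close> and may be
  moved past \<open>v\<close>.\<close>

lemma masa_unitary_intertwiner:
  fixes B :: "'a::unital_cstar_algebra set"
  assumes B: "masa type_cstar B"
    and td: "totally_disconnected_space (spectrum_topology type_cstar B)"
    and iso: "\<And>e. e \<in> B \<Longrightarrow> projection e \<Longrightarrow> e \<noteq> 0 \<Longrightarrow>
           \<exists>s. isometry s \<and> {s * b * star s | b. b \<in> B} \<subseteq> {e * b * e | b. b \<in> B}"
    and aut: "star_automorphism \<phi>"
    and a: "a \<noteq> 0" "\<And>b. b \<in> B \<Longrightarrow> b * a = a * \<phi> b"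
  obtains u where "unitary u" "\<And>b. b \<in> B \<Longrightarrow> b * u = u * \<phi> b"
proof -
  interpret commutative_cstar B by (rule masa_commutant(1)[OF B])
  note comm_B = masa_commutant(2)[OF B]
  note \<phi> = star_automorphismD[OF aut]
  have star_intertwine: "star x * b = \<phi> b * star x"
    if "\<And>b. b \<in> B \<Longrightarrow> b * x = x * \<phi> b" "b \<in> B" for x b
  proof -
    have "star (star b * x) = star (x * \<phi> (star b))"
      using that(1)[OF star_mem[OF that(2)]] by (rule arg_cong)
    then show ?thesis by (simp add: star_mult star_star \<phi>)
  qed
  define h where "h = a * star a"
  have "b * h = h * b" if "b \<in> B" for b
    using a(2)[OF that] star_intertwine[OF a(2) that] unfolding h_def by (metis mult.assoc)
  then have "h \<in> commutant B" by (simp add: commutant_def)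
  then have hB: "h \<in> B" by (simp only: comm_B)
  have h0: "h \<noteq> 0"
    using norm_mult_star_self[of a] a(1) by (auto simp: h_def)
  have "cpos h" using cpos_star_mult[of "star a"] by (simp add: h_def star_star)
  then have hpos: "w h \<in> \<real> \<and> 0 \<le> Re (w h)" if "w \<in> Spec" for w
    using cpos_iff[OF hB] that by blast
  obtain k where k: "k \<in> B" "projection (k * h * star k)" "k * h * star k \<noteq> 0"
    by (rule totally_disconnected_projection[OF td hB h0]) (erule hpos, blast)
  define e where "e = k * h * star k"
  have e: "e \<in> B" "star e = e" "e * e = e"
    using k hB by (auto simp: e_def mem projection_def)
  define v where "v = k * a"
  have vv: "v * star v = e" by (simp add: v_def e_def h_def star_mult mult.assoc)
  have v: "b * v = v * \<phi> b" if "b \<in> B" for b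
    unfolding v_def using comm[OF that k(1)] a(2)[OF that] by (metis mult.assoc)
  obtain s where s: "star s * s = 1" and sB: "\<And>b. b \<in> B \<Longrightarrow> \<exists>c\<in>B. s * b * star s = e * c * e"
    using iso[of e] k e by (auto simp: isometry_def e_def) blast
  have sbs: "s * b * star s \<in> B" if "b \<in> B" for b
    using sB[OF that] e by (auto simp: mem)
  have ss: "s * star s \<in> B" using sbs[OF one_mem] by simp
  \<comment> \<open>\<open>s * star s\<close> lies in \<open>e B e\<close> since the unit belongs to
    \<open>B\<close>.\<close>
  have es: "e * s = s"
  proof -
    obtain c where "s * star s = e * c * e" using sB[OF one_mem] by auto
    then have "e * (s * star s) = s * star s" using e by (simp add: mult.assoc [symmetric])
    then have "e * (s * star s) * s = s * star s * s" by simp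
    then show ?thesis by (simp add: mult.assoc s)
  qed
  have "norm (v - e * v) = 0"
  proof -
    have "(v - e * v) * star (v - e * v) = v * star v - v * star v * e - e * (v * star v) + e * (v * star v) * e"
      by (simp add: star_diff star_mult e(2) left_diff_distrib right_diff_distrib mult.assoc)
    also have "\<dots> = 0" by (simp add: vv e(3))
    finally show ?thesis using norm_mult_star_self[of "v - e * v"] by simp
  qed
  then have ev: "e * v = v" by simp
  \<comment> \<open>\<open>star v * v\<close> commutes with the image of \<open>B\<close> under
    \<open>\<phi>\<close>, so its preimage \<open>f\<close> lies in the commutant of
    \<open>B\<close>. Then \<open>f * e\<close> is computed twice: \<open>e * v = v\<close> gives
    \<open>f\<close>, and the intertwining relation for \<open>f\<close> itself gives
    \<open>e\<close>.\<close>
  obtain f where f: "\<phi> f = star v * v" using \<phi>(1) by (metis bij_pointE)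
  have "b * f = f * b" if b: "b \<in> B" for b
  proof -
    have "\<phi> (b * f) = \<phi> (f * b)"
      using v[OF b] star_intertwine[OF v b] unfolding \<phi>(3) f by (metis mult.assoc)
    then show ?thesis using \<phi>(1) by (simp add: bij_is_inj inj_eq)
  qed
  then have "f \<in> commutant B" by (simp add: commutant_def)
  then have fB: "f \<in> B" by (simp only: comm_B)
  have "\<phi> (f * e) = star v * (v * \<phi> e)" by (simp add: \<phi> f mult.assoc)
  also have "\<dots> = \<phi> f" using v[OF e(1)] ev by (simp add: f)
  finally have fe: "f * e = f" using \<phi>(1) by (simp add: bij_is_inj inj_eq)
  have "f * e = f * v * star v" by (simp add: vv [symmetric] mult.assoc)
  also have "\<dots> = v * star v * (v * star v)" by (simp add: v[OF fB] f mult.assoc)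
  also have "\<dots> = e" by (simp add: vv e)
  finally have "f = e" using fe by simp
  then have vv': "star v * v = \<phi> e" using f by simp
  define u where "u = star s * v * \<phi> s"
  have "b * u = u * \<phi> b" if b: "b \<in> B" for b
  proof -
    have "b * star s = star s * (s * b * star s)" by (simp add: mult.assoc [symmetric] s)
    then have "b * u = star s * (s * b * star s * v) * \<phi> s" by (simp add: u_def mult.assoc [symmetric])
    also have "\<dots> = star s * v * \<phi> (s * b * star s * s)"
      using v[OF sbs[OF b]] by (simp add: \<phi> mult.assoc)
    also have "s * b * star s * s = s * b" by (simp add: mult.assoc s)
    finally show ?thesis by (simp add: u_def \<phi> mult.assoc)
  qed
  moreover have "u * star u = 1"
  proof -
    have "u * star u = star s * (v * \<phi> (s * star s)) * star v * s"
      by (simp add: u_def star_mult star_star \<phi> mult.assoc)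
    also have "\<dots> = star s * (s * star s * v) * star v * s" by (simp only: v[OF ss])
    also have "\<dots> = (star s * s) * star s * (v * star v) * s" by (simp add: mult.assoc)
    also have "\<dots> = 1" by (simp only: s vv mult_1_left mult.assoc es)
    finally show ?thesis .
  qed
  moreover have "star u * u = 1"
  proof -
    have "star u * u = \<phi> (star s) * star v * (s * star s * v) * \<phi> s"
      by (simp add: u_def star_mult star_star \<phi> mult.assoc)
    also have "\<dots> = \<phi> (star s) * star v * (v * \<phi> (s * star s)) * \<phi> s" by (simp only: v[OF ss])
    also have "\<dots> = \<phi> (star s) * (star v * v) * \<phi> (s * star s * s)"
      by (simp add: \<phi> mult.assoc)
    also have "s * star s * s = s" by (simp add: mult.assoc s)
    also have "\<phi> (star s) * (star v * v) * \<phi> s = \<phi> (star s * (e * s))"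
      by (simp add: vv' \<phi> mult.assoc)
    also have "\<dots> = 1" by (simp add: es s star_automorphism_one[OF aut])
    finally show ?thesis .
  qed
  ultimately show thesis by (intro that) (auto simp: unitary_def)
qed

text \<open>If a unitary \<open>U\<close> implements \<open>\<phi>\<close>, then
  \<open>(u * U) ^ n\<close> is \<open>twisted_power \<phi> u n * U ^ n\<close>; the rules below are
  those of powers of \<open>u * U\<close>.\<close>

primrec twisted_power :: "('a::unital_cstar_algebra \<Rightarrow> 'a) \<Rightarrow> 'a \<Rightarrow> nat \<Rightarrow> 'a" where
  "twisted_power \<phi> u 0 = 1"
| "twisted_power \<phi> u (Suc n) = u * \<phi> (twisted_power \<phi> u n)"

lemma twisted_power_add:
  assumes "star_automorphism \<phi>"
  shows "twisted_power \<phi> u (m + n) = twisted_power \<phi> u m * (\<phi> ^^ m) (twisted_power \<phi> u n)"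
  by (induction m) (simp_all add: star_automorphismD[OF assms] mult.assoc)

lemma unitary_one: "unitary 1"
  by (simp add: unitary_def)

lemma unitary_mult: "unitary u \<Longrightarrow> unitary v \<Longrightarrow> unitary (u * v)"
  unfolding unitary_def star_mult by (metis mult.assoc mult_1)

lemma unitary_automorphism: "star_automorphism \<phi> \<Longrightarrow> unitary u \<Longrightarrow> unitary (\<phi> u)"
  unfolding unitary_def
  by (metis star_automorphismD(3,5) star_automorphism_one)

lemma unitary_twisted_power:
  assumes "star_automorphism \<phi>" "unitary u"
  shows "unitary (twisted_power \<phi> u n)"
  by (induction n) (simp_all add: unitary_one unitary_mult unitary_automorphism assms)

lemma twisted_power_intertwine:
  assumes aut: "star_automorphism \<phi>" and u: "\<And>b. b \<in> B \<Longrightarrow> b * u = u * \<phi> b" and b: "b \<in> B"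
  shows "b * twisted_power \<phi> u n = twisted_power \<phi> u n * (\<phi> ^^ n) b"
proof (induction n)
  case (Suc n)
  have "b * twisted_power \<phi> u (Suc n) = u * (\<phi> b * \<phi> (twisted_power \<phi> u n))"
    using u[OF b] by (simp add: mult.assoc [symmetric])
  also have "\<dots> = u * \<phi> (b * twisted_power \<phi> u n)" by (simp add: star_automorphismD[OF aut])
  also have "\<dots> = twisted_power \<phi> u (Suc n) * (\<phi> ^^ Suc n) b"
    by (simp add: Suc star_automorphismD[OF aut] mult.assoc)
  finally show ?case .
qed simp

text \<open>The hypothesis says that powers of \<open>z\<close> commute with \<open>u * U\<close>,
  so they can be collected in front of the product.\<close>

lemma twisted_power_mult_left:
  assumes aut: "star_automorphism \<phi>" and u: "\<And>n. z ^ n * u = u * \<phi> (z ^ n)"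
  shows "twisted_power \<phi> (z * u) n = z ^ n * twisted_power \<phi> u n"
proof (induction n)
  case (Suc n)
  have "twisted_power \<phi> (z * u) (Suc n) = z * (u * \<phi> (z ^ n)) * \<phi> (twisted_power \<phi> u n)"
    by (simp add: Suc star_automorphismD[OF aut] mult.assoc)
  also have "\<dots> = z ^ Suc n * twisted_power \<phi> u (Suc n)"
    by (simp only: u [symmetric] twisted_power.simps power_Suc mult.assoc)
  finally show ?case .
qed simp

lemma (in finite_action) cstar_action_perturbed:
  assumes u: "action_cocycle G \<alpha> u"
  shows "cstar_action G (perturbed_action \<alpha> u)"
proof -
  have uu: "star (u g) * u g = 1" "u g * star (u g) = 1" if "g \<in> carrier G" for g
    using u that by (auto simp: action_cocycle_def unitary_def)
  have um: "u (g \<otimes> h) = u g * \<alpha> g (u h)" if "g \<in> carrier G" "h \<in> carrier G" for g h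
    using u that by (auto simp: action_cocycle_def)
  have "star_automorphism (perturbed_action \<alpha> u g)" if g: "g \<in> carrier G" for g
    unfolding star_automorphism_def
  proof (intro conjI allI)
    have left: "star (u g) * perturbed_action \<alpha> u g x * u g = \<alpha> g x" for x
    proof -
      have "star (u g) * perturbed_action \<alpha> u g x * u g = (star (u g) * u g) * \<alpha> g x * (star (u g) * u g)"
        by (simp add: perturbed_action_def mult.assoc)
      then show ?thesis by (simp add: uu[OF g])
    qed
    show "bij (perturbed_action \<alpha> u g)"
    proof (rule bijI)
      show "inj (perturbed_action \<alpha> u g)"
      proof (rule injI)
        fix x y assume "perturbed_action \<alpha> u g x = perturbed_action \<alpha> u g y"
        then have "\<alpha> g x = \<alpha> g y" using left[of x] left[of y] by simp
        then show "x = y" by (metis act_inv'[OF g])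
      qed
      show "surj (perturbed_action \<alpha> u g)"
      proof (rule surjI)
        fix y
        have "perturbed_action \<alpha> u g (\<alpha> (inv g) (star (u g) * y * u g))
            = (u g * star (u g)) * y * (u g * star (u g))"
          using g by (simp add: perturbed_action_def act_inv mult.assoc)
        then show "perturbed_action \<alpha> u g (\<alpha> (inv g) (star (u g) * y * u g)) = y"
          by (simp add: uu[OF g])
      qed
    qed
    show "perturbed_action \<alpha> u g (x + y) = perturbed_action \<alpha> u g x + perturbed_action \<alpha> u g y" for x y
      using g by (simp add: perturbed_action_def act_simps distrib_left distrib_right)
    show "perturbed_action \<alpha> u g (x * y) = perturbed_action \<alpha> u g x * perturbed_action \<alpha> u g y" for x y
    proof -
      have "perturbed_action \<alpha> u g x * perturbed_action \<alpha> u g y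
          = u g * \<alpha> g x * (star (u g) * u g) * \<alpha> g y * star (u g)"
        by (simp add: perturbed_action_def mult.assoc)
      then show ?thesis using g by (simp add: uu perturbed_action_def act_simps mult.assoc)
    qed
    show "perturbed_action \<alpha> u g (scaleC c x) = scaleC c (perturbed_action \<alpha> u g x)" for c x
      using g by (simp add: perturbed_action_def act_simps mult_scaleC_left mult_scaleC_right)
    show "perturbed_action \<alpha> u g (star x) = star (perturbed_action \<alpha> u g x)" for x
      using g by (simp add: perturbed_action_def act_simps star_mult star_star mult.assoc)
  qed
  moreover have "perturbed_action \<alpha> u (g \<otimes> h) = perturbed_action \<alpha> u g \<circ> perturbed_action \<alpha> u h"
    if "g \<in> carrier G" "h \<in> carrier G" for g h
    using that
    by (auto simp: fun_eq_iff perturbed_action_def um act_mult star_mult act_simps mult.assoc)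
  ultimately show ?thesis by (simp add: cstar_action_def)
qed

section \<open>Actions of cyclic groups of prime order\<close>

context
  fixes p :: nat and \<alpha> :: "int \<Rightarrow> 'a::unital_cstar_algebra \<Rightarrow> 'a"
  assumes p: "prime p" and action: "cstar_action (integer_mod_group p) \<alpha>"
begin

lemma p_gt_1: "p > 1"
  using p prime_gt_1_nat by blast

lemma carrier_p: "carrier (integer_mod_group p) = {0..<int p}"
  using p_gt_1 by (simp add: carrier_integer_mod_group)

lemma finite_action_p: "finite_action (integer_mod_group p) \<alpha>"
  using action by (simp add: finite_action_def finite_action_axioms_def carrier_p)

lemma act_funpow:
  assumes g: "g \<in> carrier (integer_mod_group p)"
  shows "(\<alpha> g ^^ n) x = \<alpha> ((int n * g) mod int p) x"
proof -
  interpret finite_action "integer_mod_group p" \<alpha> by (rule finite_action_p)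
  show ?thesis
  proof (induction n)
    case 0
    then show ?case using act_one by simp
  next
    case (Suc n)
    have "(int n * g) mod int p \<in> carrier (integer_mod_group p)"
      using p_gt_1 by (simp add: carrier_p)
    then have "\<alpha> g (\<alpha> ((int n * g) mod int p) x) = \<alpha> ((g + (int n * g) mod int p) mod int p) x"
      using act_mult[OF g, of "(int n * g) mod int p" x] by simp
    also have "(g + (int n * g) mod int p) mod int p = (int (Suc n) * g) mod int p"
      by (simp add: mod_add_right_eq algebra_simps)
    finally show ?case using Suc by simp
  qed
qed

lemma one_carrier: "1 \<in> carrier (integer_mod_group p)"
  using p_gt_1 by simp

text \<open>
  The \<open>p\<close>-th twisted power \<open>N\<close> of \<open>u\<close> is a unitary of \<open>B\<close>; a \<open>p\<close>-th root of \<open>star N\<close> in \<open>B\<close> corrects the intertwiner \<open>u\<close> to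
  one whose \<open>p\<close>-th twisted power is \<open>1\<close>.
\<close>

lemma fixing_action_exists:
  fixes B :: "'a set"
  assumes B: "masa type_cstar B"
    and td: "totally_disconnected_space (spectrum_topology type_cstar B)"
    and u: "unitary u" "\<And>b. b \<in> B \<Longrightarrow> b * u = u * \<alpha> 1 b"
  shows "\<exists>\<beta>. cstar_action (integer_mod_group p) \<beta> \<and> exterior_equivalent (integer_mod_group p) \<alpha> \<beta> \<and>
                 (\<forall>g\<in>carrier (integer_mod_group p). \<forall>b\<in>B. \<beta> g b = b)"
proof -
  interpret finite_action "integer_mod_group p" \<alpha> by (rule finite_action_p)
  interpret B: commutative_cstar B by (rule masa_commutant(1)[OF B])
  have \<psi>: "star_automorphism (\<alpha> 1)" by (rule aut[OF one_carrier])
  have pow: "(\<alpha> 1 ^^ n) x = \<alpha> (int n mod int p) x" for n x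
    using act_funpow[OF one_carrier, of n x] by simp
  have pow_p: "(\<alpha> 1 ^^ p) x = x" for x
    using pow[of p x] act_one by simp
  define N where "N = twisted_power (\<alpha> 1) u p"
  have "b * N = N * b" if "b \<in> B" for b
    using twisted_power_intertwine[OF \<psi> u(2) that, of p] by (simp add: N_def pow_p)
  then have "N \<in> commutant B" by (simp add: commutant_def)
  then have N: "N \<in> B" "unitary N"
    using unitary_twisted_power[OF \<psi> u(1), of p] masa_commutant(2)[OF B] by (simp_all add: N_def)
  then have "star N \<in> B" "unitary (star N)"
    by (auto simp: B.star_mem unitary_def star_star)
  then obtain z where z: "z \<in> B" "unitary z" "z ^ p = star N"
    using B.totally_disconnected_unitary_root[OF td] p_gt_1 by (metis gr0I not_one_less_zero)
  define v where "v = z * u"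
  have v: "unitary v" "b * v = v * \<alpha> 1 b" if "b \<in> B" for b
  proof -
    show "unitary v" unfolding v_def by (rule unitary_mult[OF z(2) u(1)])
    have "b * v = z * (b * u)" using B.comm[OF that z(1)] by (simp add: v_def mult.assoc [symmetric])
    then show "b * v = v * \<alpha> 1 b" using u(2)[OF that] by (simp add: v_def mult.assoc)
  qed
  define P where "P = twisted_power (\<alpha> 1) v"
  have "P p = z ^ p * N"
    unfolding P_def v_def N_def
    by (rule twisted_power_mult_left[OF \<psi>]) (rule u(2)[OF B.power_mem[OF z(1)]])
  then have Pp: "P p = 1" using z N by (simp add: unitary_def)
  have P_add: "P (m + n) = P m * \<alpha> (int m mod int p) (P n)" for m n
    unfolding P_def pow [symmetric] by (rule twisted_power_add[OF \<psi>])
  have P_period: "P (p + n) = P n" for n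
    using P_add[of p n] act_one by (simp add: Pp)
  \<comment> \<open>A cocycle of a cyclic group is determined by its value at the generator;
    \<open>P p = 1\<close> makes the choice of representatives between 0 and \<open>p - 1\<close>
    consistent.\<close>
  define c where "c g = P (nat g)" for g
  have unitary_c: "unitary (c g)" for g
    unfolding c_def P_def using v(1)[OF B.one_mem] by (rule unitary_twisted_power[OF \<psi>])
  have "c ((g + h) mod int p) = c g * \<alpha> g (c h)" if gh: "0 \<le> g" "g < int p" "0 \<le> h" "h < int p" for g h
  proof -
    have "c g * \<alpha> g (c h) = P (nat g + nat h)"
      using gh P_add[of "nat g" "nat h"] by (simp add: c_def)
    also have "\<dots> = P (nat ((g + h) mod int p))"
    proof (cases "g + h < int p")
      case True
      then show ?thesis using gh by (simp add: nat_add_distrib)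
    next
      \<comment> \<open>The sum of representatives passes \<open>p\<close> and wraps around once,
        which the periodicity of \<open>P\<close> absorbs.\<close>
      case False
      have "(g + h) mod int p = (g + h - int p) mod int p" by simp
      also have "\<dots> = g + h - int p" using False gh by (intro mod_pos_pos_trivial) auto
      finally have "nat g + nat h = p + nat ((g + h) mod int p)" using False gh by simp
      then show ?thesis using P_period by simp
    qed
    finally show ?thesis by (simp add: c_def)
  qed
  then have c: "action_cocycle (integer_mod_group p) \<alpha> c"
    using unitary_c by (simp add: action_cocycle_def carrier_p)
  have "perturbed_action \<alpha> c g b = b" if g: "g \<in> carrier (integer_mod_group p)" and b: "b \<in> B" for g b
  proof -
    have "b * c g = c g * \<alpha> g b"
      using twisted_power_intertwine[OF \<psi> v(2) b, of "nat g"] g by (simp add: c_def P_def pow carrier_p)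
    then have "perturbed_action \<alpha> c g b = b * (c g * star (c g))"
      by (simp add: perturbed_action_def mult.assoc [symmetric])
    then show ?thesis using unitary_c by (simp add: unitary_def)
  qed
  moreover have "exterior_equivalent (integer_mod_group p) \<alpha> (perturbed_action \<alpha> c)"
    using c by (auto simp: exterior_equivalent_def)
  ultimately show ?thesis using cstar_action_perturbed[OF c] by blast
qed

end

theorem theorem4p10:
  fixes B :: "'a::unital_cstar_algebra set"
    and p :: nat
    and \<alpha> :: "int \<Rightarrow> 'a \<Rightarrow> 'a"
  assumes "masa type_cstar B"
    and "totally_disconnected_space (spectrum_topology type_cstar B)"
    and "\<And>e. e \<in> B \<Longrightarrow> projection e \<Longrightarrow> e \<noteq> 0 \<Longrightarrow>
           \<exists>s. isometry s \<and> {s * b * star s | b. b \<in> B} \<subseteq> {e * b * e | b. b \<in> B}"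
    and "prime p"
    and "cstar_action (integer_mod_group p) \<alpha>"
  shows "(\<not> masa (crossed_product (integer_mod_group p) \<alpha>)
              (crossed_product_embed (integer_mod_group p) ` B)
          \<longleftrightarrow> (\<exists>\<beta>. cstar_action (integer_mod_group p) \<beta> \<and>
                 exterior_equivalent (integer_mod_group p) \<alpha> \<beta> \<and>
                 (\<forall>g\<in>carrier (integer_mod_group p). \<forall>b\<in>B. \<beta> g b = b)))
       \<and> (regular type_cstar B \<and>
           \<not> masa (crossed_product (integer_mod_group p) \<alpha>)
              (crossed_product_embed (integer_mod_group p) ` B)
          \<longrightarrow> regular (crossed_product (integer_mod_group p) \<alpha>)
                (crossed_product_embed (integer_mod_group p) ` B))"
proof -
  note p = \<open>prime p\<close> and action = \<open>cstar_action (integer_mod_group p) \<alpha>\<close>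
  let ?G = "integer_mod_group p"
  interpret finite_action ?G \<alpha> by (rule finite_action_p[OF p action])
  have fixing: "\<exists>\<beta>. cstar_action ?G \<beta> \<and> exterior_equivalent ?G \<alpha> \<beta> \<and> (\<forall>g\<in>carrier ?G. \<forall>b\<in>B. \<beta> g b = b)"
    if not_masa: "\<not> masa (crossed_product ?G \<alpha>) (crossed_product_embed ?G ` B)"
  proof -
    obtain g a where g: "g \<in> carrier ?G" "g \<noteq> \<one>\<^bsub>?G\<^esub>" and a: "a \<noteq> 0" "\<And>b. b \<in> B \<Longrightarrow> b * a = a * \<alpha> g b"
      using not_masa_intertwiner[OF assms(1) not_masa] by metis
    obtain u where u: "unitary u" "\<And>b. b \<in> B \<Longrightarrow> b * u = u * \<alpha> g b"
      using masa_unitary_intertwiner[OF assms(1-3) aut[OF g(1)] a] by blast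
    have "0 < g" "g < int p" using g carrier_p[OF p action] by auto
    then have "coprime g (int p)"
      using p by (metis coprime_commute prime_imp_coprime prime_nat_int_transfer zdvd_not_zless)
    then obtain x y where x: "x * g + y * int p = 1"
      using bezout_int[of g "int p"] by auto
    \<comment> \<open>\<open>j\<close> inverts \<open>g\<close> modulo \<open>p\<close>, so the j-th
      power of \<open>\<alpha> g\<close> is the action of the generator 1.\<close>
    define j where "j = nat (x mod int p)"
    have "(int j * g) mod int p = (x * g) mod int p"
      using p_gt_1[OF p action] by (simp add: j_def mod_mult_left_eq)
    also have "\<dots> = (x * g + y * int p) mod int p" by simp
    also have "\<dots> = 1" using x p_gt_1[OF p action] by simp
    finally have j: "(\<alpha> g ^^ j) b = \<alpha> 1 b" for b
      using act_funpow[OF p action g(1), of j b] by simp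
    show ?thesis
    proof (rule fixing_action_exists[OF p action assms(1,2)])
      show "unitary (twisted_power (\<alpha> g) u j)"
        by (rule unitary_twisted_power[OF aut[OF g(1)] u(1)])
      show "b * twisted_power (\<alpha> g) u j = twisted_power (\<alpha> g) u j * \<alpha> 1 b" if "b \<in> B" for b
        using twisted_power_intertwine[OF aut[OF g(1)] u(2) that, of j] by (simp add: j)
    qed
  qed
  have inner: "\<exists>u. inner_fixing_action ?G \<alpha> B u"
    if \<beta>: "cstar_action ?G \<beta> \<and> exterior_equivalent ?G \<alpha> \<beta> \<and> (\<forall>g\<in>carrier ?G. \<forall>b\<in>B. \<beta> g b = b)" for \<beta>
  proof -
    obtain u where u: "action_cocycle ?G \<alpha> u" "\<And>g. g \<in> carrier ?G \<Longrightarrow> \<beta> g = perturbed_action \<alpha> u g"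
      using \<beta> unfolding exterior_equivalent_def by blast
    have "inner_fixing_action ?G \<alpha> B u"
    proof
      show "perturbed_action \<alpha> u g b = b" if "g \<in> carrier ?G" "b \<in> B" for g b
        using u(2)[OF that(1)] \<beta> that by metis
    qed (use assms(1) u(1) in auto)
    then show ?thesis by blast
  qed
  have "\<not> masa (crossed_product ?G \<alpha>) (crossed_product_embed ?G ` B)"
    if "inner_fixing_action ?G \<alpha> B u" for u
    using inner_fixing_action.not_masa_embed[OF that abelian_integer_mod_group one_carrier[OF p action]]
    by simp
  moreover have "regular (crossed_product ?G \<alpha>) (crossed_product_embed ?G ` B)"
    if "inner_fixing_action ?G \<alpha> B u" "regular type_cstar B" for u
    using inner_fixing_action.regular_embed[OF that] .
  ultimately show ?thesis using fixing inner by meson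
qed

end
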